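(* Let $c\in A=\mathbf{F}_q[T]$ and $\mu\in\mathbf{F}_q^{*}$ be such that $X^2-cX+\mu P^m$ is the characteristic polynomial of the Frobenius of some ordinary Drinfeld $A$-module of rank $2$ over $L$. Let $i_1,i_2\in A$ be monic polynomials, $I_1=(i_1)$, $I_2=(i_2)$, such that $I_1I_2=(1-c+\mu P^m)$, $i_2\mid i_1$ and $i_2\mid (c-2)$, and let $M=\frac{A}{I_1}\oplus\frac{A}{I_2}$. Then there exists an ordinary Drinfeld $A$-module $\Phi$ of rank $2$ over $L$, with characteristic polynomial of the Frobenius $P_\Phi(X)=X^2-cX+\mu P^m$, such that $L^\Phi\simeq M$ as $A$-modules.
   Context: Let $A=\mathbf{F}_q[T]$, and let $L$ be a finite field, extension of degree $n$ of $\mathbf{F}_q$, equipped with an $\mathbf{F}_q$-algebra homomorphism $\gamma:A\to L$ whose kernel is generated by the monic irreducible polynomial $P$ (the $A$-characteristic of $L$; the ideal $(P)$ is also denoted $P$). Put $m=[L:A/P]$ and $d=\deg P$. Let $\tau:x\mapsto x^q$ and let $L\{\tau\}$ be the Ore polynomial ring with $\tau\lambda=\lambda^q\tau$ for $\lambda\in L$. A Drinfeld $A$-module of rank $2$ over $L$ is an $\mathbf{F}_q$-algebra homomorphism $\Phi:A\to L\{\tau\}$, $a\mapsto\Phi_a$, with $\Phi_T=\gamma(T)+a_2\tau+a_3\tau^2$, $a_2\in L$, $a_3\in L^{*}$. $L^\Phi$ denotes the finite $A$-module with underlying group $L$ and action $a\cdot x=\Phi_a(x)$. $\Phi$ is supersingular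 if $\Phi_P(\overline L)=\{x\in\overline L:\Phi_a(x)=0\ \text{for all } a\in (P)\}$ is trivial, and ordinary otherwise. The Frobenius of $L$ is $F=\tau^n$, an endomorphism of every $\Phi$; its characteristic polynomial has the form $P_\Phi(X)=X^2-cX+\mu P^m$ with $c\in A$, $\mu\in\mathbf{F}_q^{*}$, $\deg c\le md/2$. *)

theory Defs
  imports
    "HOL-Algebra.Algebraic_Closure_Type"
    "HOL-Algebra.Embedded_Algebras"
    "HOL-Algebra.Ideal_Product"
    "HOL-Algebra.QuotRing"
    "HOL-Algebra.Module"
    "HOL-Library.Cardinality"
    "HOL-Number_Theory.Cong"
    "Jordan_Normal_Form.Char_Poly"
    "Jordan_Normal_Form.Missing_VectorSpace"
begin

text \<open>
  Conventions.  The field \<open>F_q\<close> is a finite field type \<open>'k\<close>, so that \<open>q = CARD('k)\<close> and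
  \<open>A = F_q[T]\<close> is the type \<open>'k poly\<close>.  The field \<open>L\<close> is a finite field type \<open>'l\<close> with structure
  map \<open>\<iota> :: 'k \<Rightarrow> 'l\<close>, and its algebraic closure is \<open>'l alg_closure\<close>.
\<close>

abbreviation A_ring :: "'k::comm_ring_1 poly ring" where
  "A_ring \<equiv> ring_of_type_algebra"

abbreviation A_ideal :: "'k::comm_ring_1 poly \<Rightarrow> 'k poly set" where
  "A_ideal a \<equiv> PIdl\<^bsub>A_ring\<^esub> a"


subsection \<open>Ore polynomials\<close>

text \<open>
  The Ore polynomial \<open>\<Sum>i. c i \<tau>^i\<close> is represented by the polynomial with coefficients \<open>c i\<close>;
  the product is governed by \<open>\<tau> c = c^q \<tau>\<close>, that is
  \<open>(a \<tau>^i) (b \<tau>^j) = a b^(q^i) \<tau>^(i+j)\<close>.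
\<close>

definition ore_mult :: "nat \<Rightarrow> 'l::comm_ring_1 poly \<Rightarrow> 'l poly \<Rightarrow> 'l poly" where
  "ore_mult q f g =
     (\<Sum>i\<le>degree f. \<Sum>j\<le>degree g.
        Polynomial.monom (poly.coeff f i * poly.coeff g j ^ (q ^ i)) (i + j))"

definition ore_ring :: "nat \<Rightarrow> 'l::comm_ring_1 poly ring" where
  "ore_ring q =
     \<lparr>carrier = UNIV, monoid.mult = ore_mult q, one = 1, ring.zero = 0, add = (+)\<rparr>"

definition ore_eval :: "nat \<Rightarrow> 'e::comm_ring_1 poly \<Rightarrow> 'e \<Rightarrow> 'e" where
  "ore_eval q f x = (\<Sum>i\<le>degree f. poly.coeff f i * x ^ (q ^ i))"

definition ore_eval_ac :: "nat \<Rightarrow> 'l::field poly \<Rightarrow> 'l alg_closure \<Rightarrow> 'l alg_closure" where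
  "ore_eval_ac q f x = ore_eval q (map_poly to_ac f) x"


subsection \<open>Drinfeld modules of rank 2\<close>

definition drinfeld_rank2 ::
  "('k::{field,finite} \<Rightarrow> 'l::field) \<Rightarrow> ('k poly \<Rightarrow> 'l) \<Rightarrow> ('k poly \<Rightarrow> 'l poly) \<Rightarrow> bool" where
  "drinfeld_rank2 \<iota> \<gamma> \<Phi> \<longleftrightarrow>
     \<Phi> \<in> Ring.ring_hom A_ring (ore_ring CARD('k)) \<and>
     (\<forall>c. \<Phi> [:c:] = [:\<iota> c:]) \<and>
     (\<exists>a2 a3. a3 \<noteq> 0 \<and> \<Phi> [:0, 1:] = [:\<gamma> [:0, 1:], a2, a3:])"

definition drinfeld_torsion ::
  "('k::{field,finite} poly \<Rightarrow> 'l::field poly) \<Rightarrow> 'k poly set \<Rightarrow> 'l alg_closure set" where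
  "drinfeld_torsion \<Phi> I = {x. \<forall>a\<in>I. ore_eval_ac CARD('k) (\<Phi> a) x = 0}"

definition supersingular ::
  "('k::{field,finite} poly \<Rightarrow> 'l::field poly) \<Rightarrow> 'k poly \<Rightarrow> bool" where
  "supersingular \<Phi> P \<longleftrightarrow> drinfeld_torsion \<Phi> (A_ideal P) = {0}"

abbreviation ordinary ::
  "('k::{field,finite} poly \<Rightarrow> 'l::field poly) \<Rightarrow> 'k poly \<Rightarrow> bool" where
  "ordinary \<Phi> P \<equiv> \<not> supersingular \<Phi> P"

text \<open>
  A module is a record extending \<open>ring\<close>; the fields \<open>mult\<close> and \<open>one\<close> play no role in it.
\<close>

definition point_module ::
  "('k::{field,finite} poly \<Rightarrow> 'l::field poly) \<Rightarrow> ('k poly, 'l) module" where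
  "point_module \<Phi> =
     \<lparr>carrier = UNIV, monoid.mult = undefined, one = undefined, ring.zero = 0, add = (+),
      module.smult = (\<lambda>a x. ore_eval CARD('k) (\<Phi> a) x)\<rparr>"

definition quotient_module ::
  "('k::comm_ring_1 poly) set \<Rightarrow> ('k poly, 'k poly set) module" where
  "quotient_module I =
     \<lparr>carrier = carrier (A_ring Quot I), monoid.mult = undefined, one = undefined,
      ring.zero = ring.zero (A_ring Quot I), add = add (A_ring Quot I),
      module.smult = (\<lambda>a B. (I +>\<^bsub>A_ring\<^esub> a) \<otimes>\<^bsub>A_ring Quot I\<^esub> B)\<rparr>"

definition module_isomorphic ::
  "('r, 's) ring_scheme \<Rightarrow> ('r, 'a, 'm) module_scheme \<Rightarrow> ('r, 'b, 'n) module_scheme \<Rightarrow> bool" where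
  "module_isomorphic R M N \<longleftrightarrow>
     (\<exists>f \<in> LinearCombinations.module_hom R M N. bij_betw f (carrier M) (carrier N))"


subsection \<open>Tate modules and the characteristic polynomial of the Frobenius\<close>

text \<open>
  The completion \<open>A_Q = lim A/Q^k\<close>: an element is the sequence of its canonical
  representatives modulo \<open>Q^k\<close>.
\<close>

definition adic_ring :: "'k::field poly \<Rightarrow> (nat \<Rightarrow> 'k poly) ring" where
  "adic_ring Q =
     \<lparr>carrier = {u. \<forall>k. u k = u (Suc k) mod Q ^ k},
      monoid.mult = (\<lambda>u v k. (u k * v k) mod Q ^ k), one = (\<lambda>k. 1 mod Q ^ k),
      ring.zero = (\<lambda>k. 0), add = (\<lambda>u v k. u k + v k)\<rparr>"

text \<open>
  The Tate module \<open>T_Q(\<Phi>)\<close> is the inverse limit of the torsion modules \<open>\<Phi>[Q^k]\<close> under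
  \<open>\<Phi>_Q : \<Phi>[Q^(k+1)] \<rightarrow> \<Phi>[Q^k]\<close>, as a module over \<open>A_Q\<close>.
\<close>

definition tate_module ::
  "('k::{field,finite} poly \<Rightarrow> 'l::field poly) \<Rightarrow> 'k poly \<Rightarrow>
     (nat \<Rightarrow> 'k poly, nat \<Rightarrow> 'l alg_closure) module" where
  "tate_module \<Phi> Q =
     \<lparr>carrier = {x. \<forall>k. x k \<in> drinfeld_torsion \<Phi> (A_ideal (Q ^ k)) \<and>
                       ore_eval_ac CARD('k) (\<Phi> Q) (x (Suc k)) = x k},
      monoid.mult = undefined, one = undefined, ring.zero = (\<lambda>k. 0),
      add = (\<lambda>x y k. x k + y k),
      module.smult = (\<lambda>u x k. ore_eval_ac CARD('k) (\<Phi> (u k)) (x k))\<rparr>"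

text \<open>The action on \<open>T_Q(\<Phi>)\<close> of the Frobenius \<open>F = \<tau>^n\<close>, where \<open>n = [L : F_q]\<close>.\<close>

definition tate_frobenius ::
  "nat \<Rightarrow> nat \<Rightarrow> (nat \<Rightarrow> 'l::field alg_closure) \<Rightarrow> (nat \<Rightarrow> 'l alg_closure)" where
  "tate_frobenius q n x = (\<lambda>k. ore_eval_ac q (Polynomial.monom (1::'l) n) (x k))"

definition module_basis2 ::
  "('r, 's) ring_scheme \<Rightarrow> ('r, 'a, 'm) module_scheme \<Rightarrow> 'a \<Rightarrow> 'a \<Rightarrow> bool" where
  "module_basis2 R M e1 e2 \<longleftrightarrow>
     e1 \<in> carrier M \<and> e2 \<in> carrier M \<and>
     (\<forall>x \<in> carrier M. \<exists>!w. w \<in> carrier R \<times> carrier R \<and>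
        x = (fst w \<odot>\<^bsub>M\<^esub> e1) \<oplus>\<^bsub>M\<^esub> (snd w \<odot>\<^bsub>M\<^esub> e2))"

text \<open>
  The polynomial \<open>f \<in> A[X]\<close> is the characteristic polynomial of \<open>F\<close> on the \<open>A_Q\<close>-module
  \<open>T_Q(\<Phi>)\<close>, which is free of rank 2: in a basis \<open>e1, e2\<close>, the map \<open>F\<close> has a matrix over \<open>A_Q\<close>
  whose characteristic polynomial is the image of \<open>f\<close> in \<open>A_Q[X]\<close>, that is, it agrees with \<open>f\<close>
  modulo every \<open>Q^k\<close>.
\<close>

definition tate_charpoly ::
  "nat \<Rightarrow> ('k::{field,finite} poly \<Rightarrow> 'l::field poly) \<Rightarrow> 'k poly \<Rightarrow> 'k poly poly \<Rightarrow> bool" where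
  "tate_charpoly n \<Phi> Q f \<longleftrightarrow>
     (\<exists>e1 e2 m11 m12 m21 m22.
        module_basis2 (adic_ring Q) (tate_module \<Phi> Q) e1 e2 \<and>
        {m11, m12, m21, m22} \<subseteq> carrier (adic_ring Q) \<and>
        tate_frobenius CARD('k) n e1 =
          (m11 \<odot>\<^bsub>tate_module \<Phi> Q\<^esub> e1) \<oplus>\<^bsub>tate_module \<Phi> Q\<^esub> (m21 \<odot>\<^bsub>tate_module \<Phi> Q\<^esub> e2) \<and>
        tate_frobenius CARD('k) n e2 =
          (m12 \<odot>\<^bsub>tate_module \<Phi> Q\<^esub> e1) \<oplus>\<^bsub>tate_module \<Phi> Q\<^esub> (m22 \<odot>\<^bsub>tate_module \<Phi> Q\<^esub> e2) \<and>
        (\<forall>k r. [poly.coeff f r =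
                  poly.coeff (char_poly (mat_of_rows_list 2 [[m11 k, m12 k], [m21 k, m22 k]])) r]
                (mod Q ^ k)))"

text \<open>
  The characteristic polynomial of the Frobenius of \<open>\<Phi>\<close> is the element of \<open>A[X]\<close> that is the
  characteristic polynomial of \<open>F\<close> on \<open>T_Q(\<Phi>)\<close> for every monic prime \<open>Q\<close> other than the
  characteristic \<open>P\<close>.  It is unique, since \<open>A\<close> embeds into \<open>A_Q\<close>.
\<close>

definition frobenius_charpoly ::
  "nat \<Rightarrow> 'k::{field,finite} poly \<Rightarrow> ('k poly \<Rightarrow> 'l::field poly) \<Rightarrow> 'k poly poly \<Rightarrow> bool" where
  "frobenius_charpoly n P \<Phi> f \<longleftrightarrow>
     (\<forall>Q. irreducible Q \<and> lead_coeff Q = 1 \<and> Q \<noteq> P \<longrightarrow> tate_charpoly n \<Phi> Q f)"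

end

theory Submission
  imports Defs
begin

text \<open>
  Write \<open>F\<close> for the Frobenius, \<open>D = \<mu>P^m\<close>, \<open>N = 1 - c + D\<close>, \<open>c - 2 = t i2\<close> and \<open>N = s i2^2\<close>, so that
  \<open>s i2\<close> is \<open>i1\<close> up to a constant.  The module is found among the quotients of the given one by finite
  submodules of the algebraic closure that \<open>F\<close> preserves: all of these are ordinary and have the same
  characteristic polynomial of \<open>F\<close>.

  The rational points are the kernel of \<open>F - 1\<close>, and \<open>F^2 - cF + D = 0\<close> says that \<open>y = (F - 1)/i2\<close>
  would satisfy \<open>y^2 - ty + s = 0\<close>.  If a Tate module \<open>T\<close> is stable under \<open>y\<close> and has a basis
  \<open>v, yv\<close>, then in \<open>T/(F - 1)T\<close> the images of \<open>v\<close> and \<open>yv\<close> have orders \<open>s i2\<close> and \<open>i2\<close> and there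
  is no further relation, which is the required structure.  So the aim is a module in the isogeny
  class that has \<open>y\<close> as an endomorphism and all of whose Tate modules are cyclic over \<open>A[y]\<close>.
  Two isogenies lead there.

  The quotient by the rational \<open>i2\<close>-torsion makes the whole \<open>i2\<close>-torsion rational, because \<open>y^2\<close> is a
  combination of \<open>y\<close> and \<open>1\<close>; then \<open>F - 1\<close> is divisible by \<open>i2\<close> (\<open>rational_torsion_isogeny\<close>).

  For the second one, write \<open>y = a + fz\<close> with an endomorphism \<open>z\<close> and \<open>f\<close> prime to \<open>P\<close> of the largest
  possible degree.  There is a largest one since \<open>F\<close> is not a scalar, and this is where ordinariness
  enters: the kernel of \<open>F\<close> is trivial, while a scalar without constant coefficient kills the
  nonzero \<open>P\<close>-torsion.  By maximality \<open>z\<close> is not a scalar on the \<open>Q\<close>-torsion for any prime \<open>Q\<close>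
  dividing \<open>f\<close>, so there is an \<open>f\<close>-torsion point \<open>v\<close> that is no eigenvector of \<open>z\<close> modulo any of them.
  Dividing out the submodule generated by \<open>v\<close> replaces a lattice with basis \<open>v, zv\<close> by the lattice
  with basis \<open>v/f, zv\<close>, and \<open>y (v/f) = a (v/f) + zv\<close>: it is cyclic over \<open>A[y]\<close>.  What is recorded of
  this is that \<open>y\<close> vanishes on the \<open>Q\<close>-torsion for no prime \<open>Q \<noteq> P\<close> (\<open>cyclic_frobenius_isogeny\<close>).

  The kernel of \<open>y\<close>, which is killed by \<open>s\<close> and has \<open>q^deg s\<close> elements, is then cyclic: its \<open>Q\<close>-torsion
  is smaller than the full one for \<open>Q \<noteq> P\<close> by construction, and for \<open>Q = P\<close> because multiplication by
  \<open>P\<close> is inseparable.  A preimage of a generator under \<open>i2\<close> can be chosen of order \<open>s i2\<close>, the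
  \<open>i2\<close>-torsion contains a complement, and counting shows that nothing else is rational
  (\<open>rational_points_structure\<close>).

  Tate modules occur only at the two ends.  Cayley-Hamilton turns the hypothesis into the equation
  \<open>F^2 - cF + D = 0\<close> on the algebraic closure (\<open>frobenius_equation_of_tate\<close>); conversely, as \<open>F\<close> is not
  a scalar, this equation determines its trace and determinant
  (\<open>tate_charpoly_of_frobenius_equation\<close>).
\<close>

section \<open>Polynomials over a finite field\<close>

text \<open>
  Annihilators of points are used throughout as ideals of the polynomial ring; this gives their
  generators.
\<close>

lemma poly_ideal_principal:
  fixes I :: "'k::field poly set"
  assumes add: "\<And>a b. a \<in> I \<Longrightarrow> b \<in> I \<Longrightarrow> a + b \<in> I"
    and mult: "\<And>a b. a \<in> I \<Longrightarrow> b * a \<in> I"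
    and g: "g \<in> I" "g \<noteq> 0"
  obtains e where "e \<noteq> 0" "\<And>a. a \<in> I \<longleftrightarrow> e dvd a"
proof -
  define e where "e = arg_min degree (\<lambda>a. a \<in> I \<and> a \<noteq> 0)"
  have e: "e \<in> I" "e \<noteq> 0"
    using arg_min_natI[of "\<lambda>a. a \<in> I \<and> a \<noteq> 0" g degree] g unfolding e_def by auto
  have min: "degree e \<le> degree a" if "a \<in> I" "a \<noteq> 0" for a
    using arg_min_nat_le[of "\<lambda>a. a \<in> I \<and> a \<noteq> 0" a degree] that unfolding e_def by auto
  have "e dvd a" if "a \<in> I" for a
  proof -
    have "a mod e = a + (- (a div e)) * e"
      by (simp add: minus_div_mult_eq_mod [symmetric])
    then have "a mod e \<in> I"
      using add[OF that mult[OF e(1)]] by metis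
    then have "a mod e = 0"
      using min[of "a mod e"] degree_mod_less[OF e(2), of a] by (metis leD)
    then show ?thesis by auto
  qed
  moreover have "a \<in> I" if "e dvd a" for a
    using that mult[OF e(1)] by (auto simp: dvd_def mult.commute)
  ultimately show ?thesis using that[OF e(2)] by blast
qed

lemma coprime_poly_bezout:
  fixes a b :: "'k::field poly"
  assumes "coprime a b"
  obtains u v where "u * a + v * b = 1"
proof -
  define I where "I = {u * a + v * b | u v. True}"
  have nz: "a \<noteq> 0 \<or> b \<noteq> 0"
    using assms by auto
  have ab: "a \<in> I" "b \<in> I"
    unfolding I_def by (rule CollectI, rule exI[of _ 1], rule exI[of _ 0], simp)
      (rule CollectI, rule exI[of _ 0], rule exI[of _ 1], simp)
  have add: "x + y \<in> I" if "x \<in> I" "y \<in> I" for x y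
  proof -
    from that obtain u v u' v' where "x = u * a + v * b" "y = u' * a + v' * b"
      unfolding I_def by blast
    then have "x + y = (u + u') * a + (v + v') * b" by (simp add: algebra_simps)
    then show ?thesis unfolding I_def by blast
  qed
  have mult: "y * x \<in> I" if "x \<in> I" for x y
  proof -
    from that obtain u v where "x = u * a + v * b"
      unfolding I_def by blast
    then have "y * x = (y * u) * a + (y * v) * b" by (simp add: algebra_simps)
    then show ?thesis unfolding I_def by blast
  qed
  obtain e where e: "\<And>x. x \<in> I \<longleftrightarrow> e dvd x"
  proof (cases "a = 0")
    case True
    then have "b \<noteq> 0" using nz by simp
    then show ?thesis using poly_ideal_principal[of I b] add mult ab that by metis
  next
    case False
    then show ?thesis using poly_ideal_principal[of I a] add mult ab that by metis
  qed
  have "e dvd 1"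
    using e ab assms by (meson not_coprimeI)
  then have "1 \<in> I" using e by blast
  then show ?thesis using that unfolding I_def by auto
qed

lemma coprime_poly_divides_mult:
  fixes a b c :: "'k::field poly"
  assumes "coprime a b" "a dvd c" "b dvd c"
  shows "a * b dvd c"
proof -
  obtain u v where "u * a + v * b = 1" using coprime_poly_bezout[OF assms(1)] .
  then have "c = (u * a + v * b) * c" by simp
  then have "c = u * (a * c) + v * (c * b)" by (simp add: algebra_simps)
  moreover have "a * b dvd u * (a * c)" "a * b dvd v * (c * b)"
    using assms(2,3) by (auto intro!: dvd_mult mult_dvd_mono)
  ultimately show ?thesis by (metis dvd_add)
qed

lemma coprime_poly_dvd_mult:
  fixes a b c :: "'k::field poly"
  assumes "coprime a b" "a dvd b * c"
  shows "a dvd c"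
proof -
  obtain u v where "u * a + v * b = 1" using coprime_poly_bezout[OF assms(1)] .
  then have "c = (u * a + v * b) * c" by simp
  then have "c = a * (u * c) + v * (b * c)" by (simp add: algebra_simps)
  then show ?thesis using assms(2) by (metis dvd_add dvd_mult dvd_triv_left)
qed

lemma irreducible_poly_coprime:
  fixes Q a :: "'k::field poly"
  assumes "irreducible Q" "\<not> Q dvd a"
  shows "coprime Q a"
proof (rule coprimeI)
  fix c assume c: "c dvd Q" "c dvd a"
  then obtain r where r: "Q = c * r" by (auto simp: dvd_def)
  then have "is_unit c \<or> is_unit r" using assms(1) irreducibleD by blast
  moreover have "\<not> is_unit r" using r c(2) assms(2)
    by (metis dvd_trans mult_unit_dvd_iff dvd_refl)
  ultimately show "is_unit c" by blast
qed

lemma irreducible_poly_dvd_mult: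
  fixes Q a :: "'k::field poly"
  assumes "irreducible Q" "Q dvd a * b"
  shows "Q dvd a \<or> Q dvd b"
  using assms irreducible_poly_coprime coprime_poly_dvd_mult by blast

lemma coprime_poly_power_left:
  fixes Q a :: "'k::field poly"
  assumes "coprime Q a"
  shows "coprime (Q ^ n) a"
proof (induction n)
  case 0
  show ?case by simp
next
  case (Suc n)
  obtain u v where uv: "u * Q + v * a = 1" using coprime_poly_bezout[OF assms] .
  obtain u' v' where uv': "u' * Q ^ n + v' * a = 1" using coprime_poly_bezout[OF Suc] .
  have "1 = (u * Q + v * a) * (u' * Q ^ n + v' * a)" using uv uv' by simp
  also have "\<dots> = (u * u') * Q ^ Suc n + (u * Q * v' + v * (u' * Q ^ n + v' * a)) * a"
    by (simp only: power_Suc algebra_simps)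
  finally have eq: "1 = (u * u') * Q ^ Suc n + (u * Q * v' + v * (u' * Q ^ n + v' * a)) * a" .
  show ?case
  proof (rule coprimeI)
    fix d assume "d dvd Q ^ Suc n" "d dvd a"
    then show "d dvd 1" using eq by (metis dvd_add dvd_mult)
  qed
qed

definition monic_irreducible :: "'k::field poly \<Rightarrow> bool" where
  "monic_irreducible Q \<longleftrightarrow> irreducible Q \<and> lead_coeff Q = 1"

lemma monic_irreducible_nz: "monic_irreducible Q \<Longrightarrow> Q \<noteq> 0"
  by (auto simp: monic_irreducible_def)

lemma monic_irreducible_degree: "monic_irreducible Q \<Longrightarrow> degree Q > 0"
  by (metis bot_nat_0.not_eq_extremum irreducible_def is_unit_iff_degree monic_irreducible_def)

lemma monic_irreducible_coprime:
  "monic_irreducible Q \<Longrightarrow> \<not> Q dvd a \<Longrightarrow> coprime Q a"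
  by (simp add: monic_irreducible_def irreducible_poly_coprime)

lemma monic_irreducible_dvd_eq:
  assumes "monic_irreducible Q" "monic_irreducible R" "Q dvd R"
  shows "Q = R"
proof -
  obtain s where s: "R = Q * s" using assms(3) by (auto simp: dvd_def)
  then have "is_unit s"
    using assms(1,2) irreducibleD unfolding monic_irreducible_def irreducible_def by blast
  then obtain x where x: "s = [:x:]" by (blast elim: is_unit_polyE)
  have "x = 1" using s assms(1,2) x unfolding monic_irreducible_def
    by (metis lead_coeff_mult lead_coeff_pCons(2) mult_1 pCons_0_0)
  then show ?thesis using s x by (simp add: one_pCons)
qed

lemma monic_irreducible_dvd_exists:
  fixes f :: "'k::field poly"
  assumes "f \<noteq> 0" "\<not> is_unit f"
  obtains Q where "monic_irreducible Q" "Q dvd f"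
proof -
  have "\<exists>Q. monic_irreducible Q \<and> Q dvd f"
    using assms
  proof (induction "degree f" arbitrary: f rule: less_induct)
    case less
    show ?case
    proof (cases "irreducible f")
      case True
      define Q where "Q = Polynomial.smult (inverse (lead_coeff f)) f"
      have u: "inverse (lead_coeff f) \<noteq> 0" using less.prems by simp
      have "irreducible Q"
        unfolding Q_def
        using True u irreducible_mult_unit_left[of "[:inverse (lead_coeff f):]" f] by (simp add: is_unit_pCons_iff)
      moreover have "lead_coeff Q = 1" unfolding Q_def using less.prems by simp
      moreover have "Q dvd f" unfolding Q_def using u by (simp add: smult_dvd_iff)
      ultimately show ?thesis unfolding monic_irreducible_def by blast
    next
      case False
      then obtain a b where ab: "f = a * b" "\<not> is_unit a" "\<not> is_unit b"
        using less.prems unfolding irreducible_def by blast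
      have nz: "a \<noteq> 0" "b \<noteq> 0" using ab less.prems by auto
      have "degree b > 0" using ab(3) nz is_unit_iff_degree by blast
      then have "degree a < degree f" using ab(1) nz by (simp add: degree_mult_eq)
      then obtain Q where "monic_irreducible Q" "Q dvd a" using less.hyps nz ab by blast
      then show ?thesis using ab(1) by (meson dvd_mult2)
    qed
  qed
  then show ?thesis using that by blast
qed

text \<open>
  A vanishing condition on coefficients is used instead of a bound on the degree, since it
  treats the zero polynomial, and the case \<open>n = 0\<close>, like the others.
\<close>

lemma card_degree_less:
  "card {a :: 'k::{field,finite} poly. \<forall>i\<ge>n. poly.coeff a i = 0} = CARD('k) ^ n
   \<and> finite {a :: 'k poly. \<forall>i\<ge>n. poly.coeff a i = 0}"
proof (induction n)
  case 0
  have "{a :: 'k poly. \<forall>i\<ge>0. poly.coeff a i = 0} = {0}" by (auto simp: poly_eq_iff)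
  then show ?case by simp
next
  case (Suc n)
  let ?S = "\<lambda>n. {a :: 'k poly. \<forall>i\<ge>n. poly.coeff a i = 0}"
  have "?S (Suc n) = (\<lambda>(x, a). pCons x a) ` (UNIV \<times> ?S n)"
  proof (intro Set.set_eqI iffI)
    fix a assume a: "a \<in> ?S (Suc n)"
    obtain x b where b: "a = pCons x b" by (cases a) auto
    have "b \<in> ?S n" using a b by (auto simp: coeff_pCons split: nat.splits)
    then show "a \<in> (\<lambda>(x, a). pCons x a) ` (UNIV \<times> ?S n)" using b by auto
  qed (auto simp: coeff_pCons split: nat.splits)
  moreover have "inj_on (\<lambda>(x, a). pCons x a) (UNIV \<times> ?S n)" by (auto simp: inj_on_def)
  ultimately show ?case using Suc by (simp add: card_image card_cartesian_product)
qed

lemma residues_eq: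
  fixes e :: "'k::field poly"
  assumes "e \<noteq> 0"
  shows "{a. a mod e = a} = {a. \<forall>i\<ge>degree e. poly.coeff a i = 0}"
proof (intro Set.set_eqI iffI; clarsimp)
  fix a :: "'k poly" and i assume a: "a mod e = a" "degree e \<le> i"
  then show "poly.coeff a i = 0"
    using degree_mod_less[OF assms, of a] by (metis coeff_0 coeff_eq_0 less_le_trans)
next
  fix a :: "'k poly" assume a: "\<forall>i\<ge>degree e. poly.coeff a i = 0"
  then have "a = 0 \<or> degree a < degree e"
    by (metis leading_coeff_0_iff not_le)
  then show "a mod e = a" by (auto simp: mod_poly_less)
qed

lemma card_residues:
  fixes e :: "'k::{field,finite} poly"
  assumes "e \<noteq> 0"
  shows "card {a. a mod e = a} = CARD('k) ^ degree e" "finite {a. a mod e = a}"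
  using card_degree_less[of "degree e"] unfolding residues_eq[OF assms] by auto

lemma finite_monic_irreducible_divisors:
  fixes f :: "'k::{field,finite} poly"
  assumes "f \<noteq> 0"
  shows "finite {Q. monic_irreducible Q \<and> Q dvd f}"
proof (rule finite_subset)
  show "{Q. monic_irreducible Q \<and> Q dvd f} \<subseteq> {a. \<forall>i\<ge>Suc (degree f). poly.coeff a i = 0}"
    using dvd_imp_degree_le[OF _ assms] by (auto intro!: coeff_eq_0 simp: Suc_le_eq) (meson le_less_trans)
  show "finite {a :: 'k poly. \<forall>i\<ge>Suc (degree f). poly.coeff a i = 0}"
    using card_degree_less by blast
qed

lemma extract_irreducible_power:
  fixes f Q :: "'k::field poly"
  assumes "monic_irreducible Q" "f \<noteq> 0"
  obtains r g where "f = Q ^ r * g" "\<not> Q dvd g"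
proof -
  have "\<exists>r g. f = Q ^ r * g \<and> \<not> Q dvd g" using assms(2)
  proof (induction "degree f" arbitrary: f rule: less_induct)
    case less
    show ?case
    proof (cases "Q dvd f")
      case False
      then show ?thesis by (metis mult_1 power_0)
    next
      case True
      then obtain h where h: "f = Q * h" by (auto simp: dvd_def)
      then have "h \<noteq> 0" "degree h < degree f"
        using less.prems monic_irreducible_degree[OF assms(1)] by (auto simp: degree_mult_eq)
      then obtain r g where "h = Q ^ r * g" "\<not> Q dvd g" using less.hyps by blast
      then show ?thesis using h by (metis mult.assoc power_Suc)
    qed
  qed
  then show ?thesis using that by blast
qed

text \<open>
  Some prime \<open>Q\<close> occurs in \<open>h\<close> to a higher power than in \<open>e\<close>; here \<open>Q^i\<close> is its exact power in \<open>e\<close>.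
\<close>

lemma not_dvd_prime_power_witness:
  fixes e h :: "'k::field poly"
  assumes "e \<noteq> 0" "h \<noteq> 0" "\<not> h dvd e"
  obtains Q i e' h' where "monic_irreducible Q" "e = Q ^ i * e'" "\<not> Q dvd e'" "h = Q ^ Suc i * h'"
proof -
  have "\<exists>Q i e' h'. monic_irreducible Q \<and> e = Q ^ i * e' \<and> \<not> Q dvd e' \<and> h = Q ^ Suc i * h'"
    using assms
  proof (induction "degree e" arbitrary: e h rule: less_induct)
    case less
    have "\<not> is_unit h" using less.prems unit_imp_dvd by blast
    then obtain Q where Q: "monic_irreducible Q" "Q dvd h"
      using monic_irreducible_dvd_exists less.prems by blast
    obtain h1 where h1: "h = Q * h1" using Q(2) by (auto simp: dvd_def)
    show ?case
    proof (cases "Q dvd e")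
      case False
      then show ?thesis using Q h1 by (intro exI[of _ Q] exI[of _ 0] exI[of _ e] exI[of _ h1]) auto
    next
      case True
      then obtain e1 where e1: "e = Q * e1" by (auto simp: dvd_def)
      have "e1 \<noteq> 0" "h1 \<noteq> 0" "degree e1 < degree e" "\<not> h1 dvd e1"
        using less.prems e1 h1 monic_irreducible_degree[OF Q(1)] by (auto simp: degree_mult_eq)
      then obtain R i e' h' where R: "monic_irreducible R" "e1 = R ^ i * e'" "\<not> R dvd e'" "h1 = R ^ Suc i * h'"
        using less.hyps by blast
      show ?thesis
      proof (cases "R = Q")
        case True
        then show ?thesis using R e1 h1
          by (intro exI[of _ Q] exI[of _ "Suc i"] exI[of _ e'] exI[of _ h']) auto
      next
        case False
        have "\<not> R dvd Q * e'"
          using R(1,3) irreducible_poly_dvd_mult monic_irreducible_dvd_eq[OF R(1) Q(1)] False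
          unfolding monic_irreducible_def by blast
        then show ?thesis using R e1 h1
          by (intro exI[of _ R] exI[of _ i] exI[of _ "Q * e'"] exI[of _ "Q * h'"]) (auto simp: algebra_simps)
      qed
    qed
  qed
  then show ?thesis using that by blast
qed

section \<open>Torsion modules of rank two over polynomial rings\<close>

text \<open>
  The properties of the algebraic closure, as a module under a Drinfeld module of rank two in
  characteristic \<open>P\<close>, from which the structure of its torsion follows: it is divisible, its torsion
  prime to \<open>P\<close> has the size of a free module of rank two, and its \<open>P\<close>-torsion is smaller than that.
\<close>

locale torsion_module = Modules.module act
  for act :: "'k::{field,finite} poly \<Rightarrow> 'b::ab_group_add \<Rightarrow> 'b" (infixr \<open>\<star>\<close> 75) +
  fixes P :: "'k poly"
  assumes act_surj: "a \<noteq> 0 \<Longrightarrow> \<exists>y. a \<star> y = x"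
    and card_torsion: "\<not> P dvd a \<Longrightarrow> card {x. a \<star> x = 0} = CARD('k) ^ (2 * degree a)"
    and finite_torsion: "a \<noteq> 0 \<Longrightarrow> finite {x. a \<star> x = 0}"
    and card_torsion_P: "card {x. P \<star> x = 0} < CARD('k) ^ (2 * degree P)"
begin

lemma card_scalars_ge_2: "CARD('k) \<ge> 2"
proof -
  have "card {0, 1 :: 'k} \<le> CARD('k)" by (rule card_mono) auto
  then show ?thesis by simp
qed

lemma coprime_scale_mem:
  assumes "coprime a b" "a \<star> x \<in> N" "b \<star> x \<in> N" "subspace N"
  shows "x \<in> N"
proof -
  obtain u v where uv: "u * a + v * b = 1" using coprime_poly_bezout[OF assms(1)] .
  have "x = (u * a + v * b) \<star> x" using uv by simp
  also have "\<dots> = u \<star> (a \<star> x) + v \<star> (b \<star> x)" by (simp only: scale_left_distrib scale_scale)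
  finally show ?thesis using assms(2-4) by (metis subspace_add subspace_scale)
qed

lemma coprime_torsion_zero: "coprime a b \<Longrightarrow> a \<star> x = 0 \<Longrightarrow> b \<star> x = 0 \<Longrightarrow> x = 0"
  using coprime_scale_mem[of a b x "{0}"] subspace_single_0 by simp

lemma scale_mod_cancel:
  assumes "e \<star> x = 0"
  shows "(a mod e) \<star> x = a \<star> x"
proof -
  have "a \<star> x = (a div e * e + a mod e) \<star> x" by simp
  also have "\<dots> = (a div e) \<star> (e \<star> x) + (a mod e) \<star> x"
    by (simp only: scale_left_distrib scale_scale)
  finally show ?thesis using assms by simp
qed

lemma scale_dvd_zero: "e \<star> x = 0 \<Longrightarrow> e dvd a \<Longrightarrow> a \<star> x = 0"
  by (metis dvdE mult.commute scale_scale scale_zero_right)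

text \<open>
  A relation and not a function, because the generator of the annihilator of \<open>x\<close> modulo \<open>N\<close> is
  determined only up to a constant.
\<close>

definition order_modulo :: "'b set \<Rightarrow> 'b \<Rightarrow> 'k poly \<Rightarrow> bool" where
  "order_modulo N x e \<longleftrightarrow> e \<noteq> 0 \<and> (\<forall>a. a \<star> x \<in> N \<longleftrightarrow> e dvd a)"

abbreviation has_order :: "'b \<Rightarrow> 'k poly \<Rightarrow> bool" where
  "has_order \<equiv> order_modulo {0}"

lemma subspace_zero [simp]: "subspace {0}"
  by (rule subspace_single_0)

lemma order_modulo_exists:
  assumes "subspace N" "g \<noteq> 0" "g \<star> x \<in> N"
  obtains e where "order_modulo N x e"
proof -
  have "\<exists>e. e \<noteq> 0 \<and> (\<forall>a. a \<in> {a. a \<star> x \<in> N} \<longleftrightarrow> e dvd a)"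
    by (rule poly_ideal_principal[of "{a. a \<star> x \<in> N}" g])
      (use assms in \<open>auto simp: scale_left_distrib subspace_add simp flip: scale_scale intro: subspace_scale\<close>)
  then show ?thesis using that unfolding order_modulo_def by auto
qed

lemma has_orderD:
  assumes "has_order x e"
  shows "e \<noteq> 0" "e \<star> x = 0" "a \<star> x = 0 \<longleftrightarrow> e dvd a"
  using assms unfolding order_modulo_def by auto

lemma subspace_cyclic: "subspace (range (\<lambda>a. a \<star> v))"
proof (rule subspaceI)
  show "0 \<in> range (\<lambda>a. a \<star> v)" by (rule range_eqI[of _ _ 0]) simp
  show "x + y \<in> range (\<lambda>a. a \<star> v)" if "x \<in> range (\<lambda>a. a \<star> v)" "y \<in> range (\<lambda>a. a \<star> v)" for x y
    using that by (auto simp flip: scale_left_distrib)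
  show "c \<star> x \<in> range (\<lambda>a. a \<star> v)" if "x \<in> range (\<lambda>a. a \<star> v)" for c x
    using that by auto
qed

lemma cyclic_eq_residues:
  assumes "e \<star> v = 0"
  shows "range (\<lambda>a. a \<star> v) = (\<lambda>a. a \<star> v) ` {a. a mod e = a}"
proof -
  have "a \<star> v \<in> (\<lambda>a. a \<star> v) ` {a. a mod e = a}" for a
    by (rule image_eqI[of _ _ "a mod e"]) (simp_all add: scale_mod_cancel[OF assms])
  then show ?thesis by auto
qed

lemma residues_eqI:
  assumes "e dvd a - b" "a mod e = a" "b mod e = b"
  shows "a = (b :: 'k poly)"
  using mod_eq_dvd_iff[of a e b] assms by simp

lemma card_cyclic:
  assumes "has_order v e"
  shows "card (range (\<lambda>a. a \<star> v)) = CARD('k) ^ degree e" "finite (range (\<lambda>a. a \<star> v))"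
proof -
  have "inj_on (\<lambda>a. a \<star> v) {a. a mod e = a}"
  proof (rule inj_onI)
    fix a b assume "a \<in> {a. a mod e = a}" "b \<in> {a. a mod e = a}" "a \<star> v = b \<star> v"
    moreover from this have "(a - b) \<star> v = 0" by (simp add: scale_left_diff_distrib)
    ultimately show "a = b" using has_orderD(3)[OF assms] residues_eqI by blast
  qed
  then show "card (range (\<lambda>a. a \<star> v)) = CARD('k) ^ degree e" "finite (range (\<lambda>a. a \<star> v))"
    using card_residues[OF has_orderD(1)[OF assms]] 
    unfolding cyclic_eq_residues[OF has_orderD(2)[OF assms]] by (simp_all add: card_image)
qed

text \<open>
  Take \<open>v\<close> of an order \<open>e\<close> of the largest possible degree.  If some order \<open>h\<close> does not divide \<open>e\<close>, a prime
  \<open>Q\<close> occurs in \<open>h\<close> more often than in \<open>e\<close>; replacing the \<open>Q\<close>-part of \<open>v\<close> by a point whose order is the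
  larger power of \<open>Q\<close> gives an order of larger degree.
\<close>

lemma exponent_attained:
  assumes M: "subspace M" "M \<noteq> {}" and g: "g \<noteq> 0" "\<And>x. x \<in> M \<Longrightarrow> g \<star> x = 0"
  obtains v e where "v \<in> M" "has_order v e" "\<And>x. x \<in> M \<Longrightarrow> e \<star> x = 0"
proof -
  define good where "good = (\<lambda>e. \<exists>v\<in>M. has_order v e)"
  have ex: "\<exists>e. has_order x e" if "x \<in> M" for x
    using order_modulo_exists[OF subspace_zero g(1), of x] g(2)[OF that] by auto
  have bound: "degree e \<le> degree g" if "good e" for e
    using that g dvd_imp_degree_le[OF _ g(1)] has_orderD(3) unfolding good_def by blast
  obtain e0 where e0: "good e0" using ex M(2) unfolding good_def by blast
  have "\<exists>e. good e \<and> (\<forall>e'. good e' \<longrightarrow> degree e' \<le> degree e)"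
    by (rule ex_has_greatest_nat[of good e0 degree "degree g + 1", OF e0]) (use bound in \<open>auto simp: less_Suc_eq_le\<close>)
  then obtain e where e: "good e" and max: "\<And>e'. good e' \<Longrightarrow> degree e' \<le> degree e" by blast
  obtain v where v: "v \<in> M" "has_order v e" using e unfolding good_def by blast
  have "e \<star> x = 0" if x: "x \<in> M" for x
  proof (rule ccontr)
    assume "e \<star> x \<noteq> 0"
    obtain h where h: "has_order x h" using ex[OF x] by blast
    then have "\<not> h dvd e" using \<open>e \<star> x \<noteq> 0\<close> has_orderD(3) by blast
    then obtain Q i e' h' where Q: "monic_irreducible Q" "e = Q ^ i * e'" "\<not> Q dvd e'" "h = Q ^ Suc i * h'"
      using not_dvd_prime_power_witness[of e h] has_orderD(1)[OF h] has_orderD(1)[OF v(2)] by blast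
    have nz: "e' \<noteq> 0" "h' \<noteq> 0" "Q \<noteq> 0"
      using Q has_orderD(1)[OF h] has_orderD(1)[OF v(2)] by auto
    have cop: "coprime (Q ^ Suc i) e'"
      using coprime_poly_power_left monic_irreducible_coprime Q(1,3) by blast
    define w where "w = Q ^ i \<star> v + h' \<star> x"
    have w1: "a \<star> w = 0 \<longleftrightarrow> Q ^ Suc i * e' dvd a" for a
    proof
      assume a: "a \<star> w = 0"
      have "(e' * a) \<star> w = (e' * a) \<star> (Q ^ i \<star> v) + (e' * a) \<star> (h' \<star> x)"
        unfolding w_def by (rule scale_right_distrib)
      also have "(e' * a) \<star> (Q ^ i \<star> v) = a \<star> (e \<star> v)" by (simp add: Q(2) ac_simps)
      also have "\<dots> = 0" by (simp add: has_orderD(2)[OF v(2)] del: scale_scale)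
      finally have "(e' * a) \<star> (h' \<star> x) = 0" using a by (simp flip: scale_scale)
      then have "h dvd e' * a * h'" using has_orderD(3)[OF h] by simp
      then have "Q ^ Suc i dvd e' * a" using nz Q(4) by simp
      then have d1: "Q ^ Suc i dvd a" using cop coprime_poly_dvd_mult by blast
      have "(Q ^ Suc i * a) \<star> w = (Q ^ Suc i * a) \<star> (Q ^ i \<star> v) + (Q ^ Suc i * a) \<star> (h' \<star> x)"
        unfolding w_def by (rule scale_right_distrib)
      also have "(Q ^ Suc i * a) \<star> (h' \<star> x) = a \<star> (h \<star> x)" by (simp add: Q(4) ac_simps)
      also have "\<dots> = 0" by (simp add: has_orderD(2)[OF h] del: scale_scale)
      finally have "(Q ^ Suc i * a) \<star> (Q ^ i \<star> v) = 0" using a by (simp flip: scale_scale)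
      then have "e dvd (Q ^ Suc i * a) * Q ^ i" using has_orderD(3)[OF v(2)] by simp
      then have "e' dvd Q ^ Suc i * a" using nz Q(2) by (simp add: mult.commute)
      then have "e' dvd a" using cop coprime_poly_dvd_mult by (meson coprime_commute)
      then show "Q ^ Suc i * e' dvd a" using d1 cop coprime_poly_divides_mult by blast
    next
      assume "Q ^ Suc i * e' dvd a"
      then obtain b where b: "a = Q ^ Suc i * e' * b" by (auto simp: dvd_def)
      have "a \<star> w = (Q ^ Suc i * b) \<star> (e \<star> v) + (e' * b) \<star> (h \<star> x)"
        unfolding w_def by (simp add: scale_right_distrib b Q(2,4) ac_simps)
      then show "a \<star> w = 0" by (simp add: has_orderD(2)[OF v(2)] has_orderD(2)[OF h] del: scale_scale)
    qed
    have "w \<in> M" unfolding w_def using v(1) x M(1) by (simp add: subspace_add subspace_scale)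
    then have "good (Q ^ Suc i * e')"
      using w1 nz unfolding good_def order_modulo_def by auto
    then have "degree (Q ^ Suc i * e') \<le> degree e" by (rule max)
    then show False using monic_irreducible_degree[OF Q(1)] nz by (simp add: Q(2) degree_mult_eq degree_power_eq)
  qed
  then show ?thesis using that v by blast
qed

text \<open>
  Let \<open>v\<close> have the exponent as its order.  A point outside \<open>A v\<close> yields a \<open>Q\<close>-torsion point \<open>x1\<close> outside
  \<open>A v\<close> for some prime \<open>Q\<close> dividing the exponent, and together with the \<open>Q\<close>-torsion \<open>A x2\<close> of \<open>A v\<close> it
  spans \<open>q^(2 deg Q)\<close> points of \<open>Q\<close>-torsion, more than there are.
\<close>

lemma cyclic_criterion:
  assumes M: "subspace M" "M \<noteq> {}" and g: "g \<noteq> 0" "\<And>x. x \<in> M \<Longrightarrow> g \<star> x = 0"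
    and small: "\<And>Q. monic_irreducible Q \<Longrightarrow> card {x\<in>M. Q \<star> x = 0} < CARD('k) ^ (2 * degree Q)"
  obtains v e where "v \<in> M" "has_order v e" "M = range (\<lambda>a. a \<star> v)"
proof -
  obtain v e where v: "v \<in> M" "has_order v e" "\<And>x. x \<in> M \<Longrightarrow> e \<star> x = 0"
    using exponent_attained[OF M g] by blast
  let ?V = "range (\<lambda>a. a \<star> v)"
  have "M \<subseteq> ?V"
  proof (rule ccontr)
    assume "\<not> M \<subseteq> ?V"
    then obtain y where y: "y \<in> M" "y \<notin> ?V" by blast
    obtain h where h: "order_modulo ?V y h"
      using order_modulo_exists[OF subspace_cyclic g(1), of y v] g(2)[OF y(1)] subspace_0[OF subspace_cyclic]
      by auto
    have "\<not> is_unit h" using h y(2) unfolding order_modulo_def by (metis scale_one)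
    then obtain Q h' where Q: "monic_irreducible Q" "h = Q * h'"
      using monic_irreducible_dvd_exists h unfolding order_modulo_def by (metis dvdE)
    have Qnz: "Q \<noteq> 0" "h' \<noteq> 0" using h Q unfolding order_modulo_def by auto
    have he: "h dvd e" using h v(3)[OF y(1)] subspace_0[OF subspace_cyclic] unfolding order_modulo_def by auto
    define x where "x = h' \<star> y"
    have "\<not> h dvd h'"
      using Q Qnz dvd_imp_degree_le[of h h'] monic_irreducible_degree[OF Q(1)] by (auto simp: degree_mult_eq)
    then have x: "x \<in> M" "x \<notin> ?V" "Q \<star> x \<in> ?V"
      using h y(1) M(1) Q(2) unfolding order_modulo_def x_def by (auto simp: subspace_scale)
    then obtain b where b: "Q \<star> x = b \<star> v" by auto
    obtain e' where e': "e = Q * e'" using he Q(2) by (auto simp: dvd_def mult.assoc)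
    have "e' \<noteq> 0" using e' has_orderD(1)[OF v(2)] by auto
    have "(e' * b) \<star> v = e' \<star> (Q \<star> x)" using b by simp
    also have "\<dots> = 0" using v(3)[OF x(1)] e' by (simp add: mult.commute)
    finally have "e dvd e' * b" using has_orderD(3)[OF v(2)] by simp
    then have "Q dvd b" using e' \<open>e' \<noteq> 0\<close> by (simp add: mult.commute)
    then obtain b' where b': "b = Q * b'" by (auto simp: dvd_def)
    define x1 where "x1 = x - b' \<star> v"
    define x2 where "x2 = e' \<star> v"
    have x1: "x1 \<in> M" "Q \<star> x1 = 0" "x1 \<notin> ?V"
    proof -
      show "x1 \<in> M" unfolding x1_def using x(1) v(1) M(1) by (simp add: subspace_diff subspace_scale)
      show "Q \<star> x1 = 0" unfolding x1_def using b b' by (simp add: scale_right_diff_distrib)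
      show "x1 \<notin> ?V"
      proof
        assume "x1 \<in> ?V"
        then have "x1 + b' \<star> v \<in> ?V" by (intro subspace_add[OF subspace_cyclic]) auto
        then show False using x(2) by (simp add: x1_def)
      qed
    qed
    have x2: "x2 \<in> M" "Q \<star> x2 = 0" "x2 \<in> ?V"
      unfolding x2_def using v M(1) e' has_orderD(2)[OF v(2)] by (auto simp: subspace_scale)
    let ?f = "\<lambda>(a, c). a \<star> x1 + c \<star> x2"
    let ?R = "{a :: 'k poly. a mod Q = a}"
    have "inj_on ?f (?R \<times> ?R)"
    proof (rule inj_onI; clarsimp)
      fix a c a' c' assume r: "a mod Q = a" "c mod Q = c" "a' mod Q = a'" "c' mod Q = c'"
        and eq: "a \<star> x1 + c \<star> x2 = a' \<star> x1 + c' \<star> x2"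
      then have "(a - a') \<star> x1 = (c' - c) \<star> x2" by (simp add: scale_left_diff_distrib algebra_simps)
      then have "(a - a') \<star> x1 \<in> ?V" using x2(3) by (metis subspace_scale[OF subspace_cyclic])
      have a: "Q dvd a - a'"
      proof (rule ccontr)
        assume "\<not> Q dvd a - a'"
        then have "coprime Q (a - a')" using Q(1) monic_irreducible_coprime by blast
        then show False
          using coprime_scale_mem[of Q "a - a'" x1 ?V] \<open>(a - a') \<star> x1 \<in> ?V\<close> x1 subspace_cyclic
            subspace_0[OF subspace_cyclic] by auto
      qed
      then have "a = a'" using r residues_eqI by blast
      then have "(c - c') \<star> x2 = 0" using eq by (simp add: scale_left_diff_distrib)
      then have "e dvd (c - c') * e'" using has_orderD(3)[OF v(2)] x2_def by simp
      then have "Q dvd c - c'" using e' \<open>e' \<noteq> 0\<close> by simp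
      then show "a = a' \<and> c = c'" using r residues_eqI \<open>a = a'\<close> by blast
    qed
    then have "card (?f ` (?R \<times> ?R)) = CARD('k) ^ (2 * degree Q)"
      using card_residues[OF Qnz(1)] by (simp add: card_image card_cartesian_product power_add mult_2)
    moreover have "?f ` (?R \<times> ?R) \<subseteq> {x\<in>M. Q \<star> x = 0}"
    proof (clarsimp)
      fix a c
      have "a \<star> (Q \<star> x1) + c \<star> (Q \<star> x2) = 0" using x1(2) x2(2) by (simp del: scale_scale)
      then show "a \<star> x1 + c \<star> x2 \<in> M \<and> Q \<star> (a \<star> x1 + c \<star> x2) = 0"
        using x1(1) x2(1) M(1) by (auto simp: subspace_add subspace_scale scale_right_distrib mult.commute)
    qed
    moreover have "finite {x\<in>M. Q \<star> x = 0}"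
      by (rule finite_subset[OF _ finite_torsion[OF Qnz(1)]]) auto
    ultimately have "CARD('k) ^ (2 * degree Q) \<le> card {x\<in>M. Q \<star> x = 0}"
      using card_mono[of "{x\<in>M. Q \<star> x = 0}" "?f ` (?R \<times> ?R)"] by simp
    then show False using small[OF Q(1)] by simp
  qed
  moreover have "?V \<subseteq> M" using v(1) M(1) by (auto simp: subspace_scale)
  ultimately show ?thesis using that v by blast
qed

text \<open>
  The Chinese remainder theorem for torsion points.  If \<open>f = Q^(r+1) g\<close> with \<open>g\<close> prime to \<open>Q\<close>, let \<open>y Q\<close>
  be a point with \<open>Q^r y = w Q\<close>; the factor \<open>f/Q\<close> takes \<open>y Q\<close> to \<open>g w Q\<close> and kills the points \<open>y R\<close> that
  belong to the other primes, so the sum of all of them has the property.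
\<close>

lemma glue_prime_torsion:
  assumes f: "f \<noteq> 0"
    and w: "\<And>Q. monic_irreducible Q \<Longrightarrow> Q dvd f \<Longrightarrow> Q \<star> w Q = 0"
  obtains v where "f \<star> v = 0"
    "\<And>Q. monic_irreducible Q \<Longrightarrow> Q dvd f \<Longrightarrow> \<exists>g. \<not> Q dvd g \<and> (f div Q) \<star> v = g \<star> w Q"
proof -
  let ?D = "{Q. monic_irreducible Q \<and> Q dvd f}"
  have "\<exists>t. f = Q ^ Suc (fst (snd t)) * snd (snd t) \<and> \<not> Q dvd snd (snd t) \<and>
      Q ^ fst (snd t) \<star> fst t = w Q" if Q: "Q \<in> ?D" for Q
  proof -
    obtain r g where rg: "f = Q ^ r * g" "\<not> Q dvd g"
      using extract_irreducible_power f Q by blast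
    then obtain r' where "r = Suc r'" using Q by (cases r) auto
    moreover have "Q ^ r' \<noteq> 0" using Q f by auto
    moreover obtain x where "Q ^ r' \<star> x = w Q" using act_surj[of "Q ^ r'"] calculation by blast
    ultimately show ?thesis using rg by (intro exI[of _ "(x, r', g)"]) auto
  qed
  then have "\<forall>Q\<in>?D. \<exists>t. f = Q ^ Suc (fst (snd t)) * snd (snd t) \<and> \<not> Q dvd snd (snd t) \<and>
      Q ^ fst (snd t) \<star> fst t = w Q" by blast
  from bchoice[OF this] obtain t where t: "\<And>Q. Q \<in> ?D \<Longrightarrow>
      f = Q ^ Suc (fst (snd (t Q))) * snd (snd (t Q)) \<and>
      \<not> Q dvd snd (snd (t Q)) \<and> Q ^ fst (snd (t Q)) \<star> fst (t Q) = w Q" by blast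
  define y where "y = (\<lambda>Q. fst (t Q))"
  define r where "r = (\<lambda>Q. fst (snd (t Q)))"
  define g where "g = (\<lambda>Q. snd (snd (t Q)))"
  have y: "f = Q ^ Suc (r Q) * g Q \<and> \<not> Q dvd g Q \<and> Q ^ r Q \<star> y Q = w Q" if "Q \<in> ?D" for Q
    using t[OF that] by (simp add: y_def r_def g_def)
  have kill: "Q ^ Suc (r Q) \<star> y Q = 0" if "Q \<in> ?D" for Q
    using y[OF that] w[of Q] that by (metis (no_types, lifting) mem_Collect_eq power_Suc scale_scale)
  have fin: "finite ?D" by (rule finite_monic_irreducible_divisors[OF f])
  define v where "v = (\<Sum>Q\<in>?D. y Q)"
  have other: "(f div R) \<star> y Q = 0" if "Q \<in> ?D" "R \<in> ?D" "Q \<noteq> R" for Q R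
  proof -
    have "f = R * (f div R)" using that(2) by simp
    moreover have "coprime (Q ^ Suc (r Q)) R"
      using coprime_poly_power_left monic_irreducible_coprime monic_irreducible_dvd_eq that by blast
    moreover have "Q ^ Suc (r Q) dvd f" using y[OF that(1)] by (metis dvd_triv_left)
    ultimately have "Q ^ Suc (r Q) dvd f div R" using coprime_poly_dvd_mult by metis
    then show ?thesis using kill[OF that(1)] scale_dvd_zero by blast
  qed
  have "f \<star> y Q = 0" if "Q \<in> ?D" for Q
    using y[OF that] scale_dvd_zero[OF kill[OF that]] by (metis dvd_triv_left)
  then have "f \<star> v = 0" unfolding v_def by (simp add: scale_sum_right)
  moreover have "\<exists>g. \<not> Q dvd g \<and> (f div Q) \<star> v = g \<star> w Q" if "monic_irreducible Q" "Q dvd f" for Q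
  proof -
    have Q: "Q \<in> ?D" using that by simp
    have "(f div Q) \<star> v = (\<Sum>R\<in>?D. (f div Q) \<star> y R)" unfolding v_def by (simp add: scale_sum_right)
    also have "\<dots> = (f div Q) \<star> y Q + (\<Sum>R\<in>?D - {Q}. (f div Q) \<star> y R)"
      by (rule sum.remove[OF fin Q])
    also have "(\<Sum>R\<in>?D - {Q}. (f div Q) \<star> y R) = 0" using other Q by (intro sum.neutral) auto
    also have "f div Q = g Q * Q ^ r Q"
    proof -
      have "f = Q * (g Q * Q ^ r Q)" using y[OF Q] by (simp add: algebra_simps)
      then show ?thesis using monic_irreducible_nz[OF that(1)] by (metis nonzero_mult_div_cancel_left)
    qed
    finally have "(f div Q) \<star> v = g Q \<star> (Q ^ r Q \<star> y Q)"
      using \<open>f div Q = g Q * Q ^ r Q\<close> by simp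
    then show ?thesis using y[OF Q] by metis
  qed
  ultimately show ?thesis using that by blast
qed

text \<open>
  If the order modulo \<open>N\<close> were a proper divisor of \<open>f\<close>, then \<open>f/Q\<close> would take \<open>v\<close> into \<open>N\<close> for some prime
  \<open>Q\<close>, hence \<open>w Q\<close> would lie in \<open>N\<close>.
\<close>

lemma glued_order_modulo:
  assumes f: "f \<noteq> 0" "f \<star> v \<in> N" and N: "subspace N"
    and v: "\<And>Q. monic_irreducible Q \<Longrightarrow> Q dvd f \<Longrightarrow> \<exists>g. \<not> Q dvd g \<and> (f div Q) \<star> v = g \<star> w Q"
    and w: "\<And>Q. monic_irreducible Q \<Longrightarrow> Q dvd f \<Longrightarrow> Q \<star> w Q = 0 \<and> w Q \<notin> N"
  shows "order_modulo N v f"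
proof -
  obtain e where e: "order_modulo N v e" using order_modulo_exists[OF N f] .
  then have "e dvd f" using f unfolding order_modulo_def by blast
  then obtain f' where f': "f = e * f'" by (auto simp: dvd_def)
  have "is_unit f'"
  proof (rule ccontr)
    assume "\<not> is_unit f'"
    then obtain Q where Q: "monic_irreducible Q" "Q dvd f'"
      using monic_irreducible_dvd_exists f f' by (metis mult_zero_right)
    then obtain f'' where f'': "f' = Q * f''" by (auto simp: dvd_def)
    have "f = Q * (e * f'')" using f' f'' by (simp add: algebra_simps)
    then have "f div Q = e * f''" "Q dvd f"
      using monic_irreducible_nz[OF Q(1)] by (metis nonzero_mult_div_cancel_left, simp)
    then have "(f div Q) \<star> v \<in> N" using e unfolding order_modulo_def by simp
    obtain g where g: "\<not> Q dvd g" "(f div Q) \<star> v = g \<star> w Q" using v[OF Q(1) \<open>Q dvd f\<close>] by blast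
    have "coprime Q g" using monic_irreducible_coprime Q(1) g(1) by blast
    moreover have "Q \<star> w Q \<in> N" using w[OF Q(1) \<open>Q dvd f\<close>] subspace_0[OF N] by simp
    ultimately have "w Q \<in> N"
      using coprime_scale_mem[of Q g "w Q" N] N g(2) \<open>(f div Q) \<star> v \<in> N\<close> by simp
    then show False using w[OF Q(1) \<open>Q dvd f\<close>] by blast
  qed
  then have "f dvd a \<longleftrightarrow> e dvd a" for a using f' by (simp add: mult_unit_dvd_iff)
  then show ?thesis using e f(1) unfolding order_modulo_def by blast
qed

text \<open>
  Independence makes the map from pairs of residues modulo \<open>e\<close> injective, and source and target have
  the same cardinality.
\<close>

lemma torsion_spanned:
  assumes e: "\<not> P dvd e" "e \<star> v = 0" "e \<star> w = 0"
    and indep: "\<And>a b. a \<star> v + b \<star> w = 0 \<Longrightarrow> e dvd a \<and> e dvd b"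
    and x: "e \<star> x = 0"
  obtains a b where "x = a \<star> v + b \<star> w"
proof -
  let ?f = "\<lambda>(a, b). a \<star> v + b \<star> w"
  let ?R = "{a :: 'k poly. a mod e = a}"
  have nz: "e \<noteq> 0" using e(1) by auto
  have "inj_on ?f (?R \<times> ?R)"
  proof (rule inj_onI; clarsimp)
    fix a c a' c' assume r: "a mod e = a" "c mod e = c" "a' mod e = a'" "c' mod e = c'"
      and eq: "a \<star> v + c \<star> w = a' \<star> v + c' \<star> w"
    then have "(a - a') \<star> v + (c - c') \<star> w = 0" by (simp add: scale_left_diff_distrib algebra_simps)
    then show "a = a' \<and> c = c'" using indep r residues_eqI by blast
  qed
  then have card: "card (?f ` (?R \<times> ?R)) = CARD('k) ^ (2 * degree e)"
    using card_residues[OF nz] by (simp add: card_image card_cartesian_product power_add mult_2)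
  have "?f ` (?R \<times> ?R) \<subseteq> {x. e \<star> x = 0}"
  proof (clarsimp)
    fix a b
    have "a \<star> (e \<star> v) + b \<star> (e \<star> w) = 0" using e by (simp del: scale_scale)
    then show "e \<star> (a \<star> v + b \<star> w) = 0" by (simp add: scale_right_distrib mult.commute)
  qed
  then have "?f ` (?R \<times> ?R) = {x. e \<star> x = 0}"
    by (rule card_subset_eq[OF finite_torsion[OF nz]]) (simp add: card card_torsion[OF e(1)])
  then show ?thesis using x that by force
qed

lemma irreducible_torsion_not_cyclic:
  assumes Q: "monic_irreducible Q" "\<not> P dvd Q" and x: "Q \<star> x = 0"
  obtains y where "Q \<star> y = 0" "y \<notin> range (\<lambda>a. a \<star> x)"
proof -
  obtain e where e: "has_order x e"
    using order_modulo_exists[OF subspace_zero monic_irreducible_nz[OF Q(1)], of x] x by auto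
  then have "e dvd Q" using x has_orderD(3) by blast
  then have "degree e \<le> degree Q" by (rule dvd_imp_degree_le) (rule monic_irreducible_nz[OF Q(1)])
  also have "\<dots> < 2 * degree Q" using monic_irreducible_degree[OF Q(1)] by simp
  finally have "CARD('k) ^ degree e < CARD('k) ^ (2 * degree Q)"
    using card_scalars_ge_2 by (intro power_strict_increasing) auto
  then have "card (range (\<lambda>a. a \<star> x)) < card {x. Q \<star> x = 0}"
    using card_cyclic[OF e] card_torsion[OF Q(2)] by simp
  then have "\<not> {x. Q \<star> x = 0} \<subseteq> range (\<lambda>a. a \<star> x)"
    using card_mono[OF card_cyclic(2)[OF e]] by (metis leD)
  then show ?thesis using that by blast
qed

lemma irreducible_torsion_independent:
  assumes Q: "monic_irreducible Q" and v: "v \<noteq> 0" "Q \<star> v = 0"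
    and w: "Q \<star> w = 0" "w \<notin> range (\<lambda>a. a \<star> v)"
    and eq: "a \<star> v + b \<star> w = 0"
  shows "Q dvd a \<and> Q dvd b"
proof -
  have cop: "coprime Q c" if "\<not> Q dvd c" for c
    using that Q monic_irreducible_coprime by blast
  have "b \<star> w = (- a) \<star> v" using eq by (simp add: eq_neg_iff_add_eq_0 add.commute)
  then have "b \<star> w \<in> range (\<lambda>a. a \<star> v)" by blast
  then have b: "Q dvd b"
    using cop[of b] coprime_scale_mem[of Q b w "range (\<lambda>a. a \<star> v)"] w subspace_cyclic subspace_0[OF subspace_cyclic]
    by auto
  then have "b \<star> w = 0" using w(1) by (metis dvdE scale_scale scale_zero_right mult.commute)
  then have "a \<star> v = 0" using eq by simp
  then have "Q dvd a" using cop[of a] coprime_torsion_zero v by blast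
  then show ?thesis using b by blast
qed

text \<open>
  A basis of the \<open>Q\<close>-torsion is lifted step by step along multiplication by \<open>Q\<close>; this produces a basis
  of the Tate module at \<open>Q\<close>, given by its levels.
\<close>

lemma prime_power_torsion_basis:
  assumes Q: "monic_irreducible Q" "\<not> P dvd Q"
  obtains v w :: "nat \<Rightarrow> 'b" where "v 0 = 0" "w 0 = 0"
    "\<And>k. Q \<star> v (Suc k) = v k" "\<And>k. Q \<star> w (Suc k) = w k"
    "\<And>k. Q ^ k \<star> v k = 0" "\<And>k. Q ^ k \<star> w k = 0"
    "\<And>k a b. a \<star> v k + b \<star> w k = 0 \<Longrightarrow> Q ^ k dvd a \<and> Q ^ k dvd b"
proof -
  have nz: "Q \<noteq> 0" by (rule monic_irreducible_nz[OF Q(1)])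
  obtain v1 where v1: "Q \<star> v1 = 0" "v1 \<notin> range (\<lambda>a. a \<star> 0)"
    using irreducible_torsion_not_cyclic[OF Q, of 0] by auto
  then have v1': "v1 \<noteq> 0" by auto
  obtain w1 where w1: "Q \<star> w1 = 0" "w1 \<notin> range (\<lambda>a. a \<star> v1)"
    using irreducible_torsion_not_cyclic[OF Q v1(1)] by blast
  have "\<exists>v :: nat \<Rightarrow> 'b. v 0 = 0 \<and> v 1 = x \<and> (\<forall>k. Q \<star> v (Suc k) = v k)" if "Q \<star> x = 0" for x
  proof -
    define v where "v = rec_nat x (\<lambda>_ y. SOME z. Q \<star> z = y)"
    have v: "v 0 = x" "\<And>k. Q \<star> v (Suc k) = v k"
      unfolding v_def using act_surj[OF nz] by (auto intro: someI_ex)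
    define v' where "v' = case_nat 0 v"
    have "v' 0 = 0" "v' 1 = x" "\<And>k. Q \<star> v' (Suc k) = v' k"
      unfolding v'_def using v that by (auto split: nat.split)
    then show ?thesis by blast
  qed
  then obtain v w where v: "v 0 = 0" "v 1 = v1" "\<And>k. Q \<star> v (Suc k) = v k"
    and w: "w 0 = 0" "w 1 = w1" "\<And>k. Q \<star> w (Suc k) = w k"
    using v1(1) w1(1) by meson
  have kill: "Q ^ k \<star> u k = 0" if u: "u 0 = 0" "\<And>k. Q \<star> u (Suc k) = u k" for u :: "nat \<Rightarrow> 'b" and k
  proof (induction k)
    case (Suc k)
    have "Q ^ Suc k \<star> u (Suc k) = Q ^ k \<star> (Q \<star> u (Suc k))" by (simp add: mult.commute)
    then show ?case using Suc u by simp
  qed (use u in simp)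
  have one: "u (Suc 0) = Q ^ k \<star> u (Suc k)" if u: "\<And>k. Q \<star> u (Suc k) = u k" for u :: "nat \<Rightarrow> 'b" and k
  proof (induction k)
    case (Suc k)
    have "Q ^ Suc k \<star> u (Suc (Suc k)) = Q ^ k \<star> (Q \<star> u (Suc (Suc k)))" by (simp add: mult.commute)
    then show ?case using Suc u by simp
  qed simp
  have "Q ^ k dvd a \<and> Q ^ k dvd b" if "a \<star> v k + b \<star> w k = 0" for k a b
    using that
  proof (induction k arbitrary: a b)
    case (Suc k)
    have "a \<star> v1 + b \<star> w1 = Q ^ k \<star> (a \<star> v (Suc k) + b \<star> w (Suc k))"
    proof -
      have "a \<star> v1 + b \<star> w1 = a \<star> (Q ^ k \<star> v (Suc k)) + b \<star> (Q ^ k \<star> w (Suc k))"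
        using one[of v k, OF v(3)] one[of w k, OF w(3)] v(2) w(2) by (simp del: scale_scale)
      also have "\<dots> = Q ^ k \<star> (a \<star> v (Suc k) + b \<star> w (Suc k))"
        by (simp add: scale_right_distrib mult.commute)
      finally show ?thesis .
    qed
    then have "Q dvd a \<and> Q dvd b"
      using irreducible_torsion_independent[OF Q(1) v1' v1(1) w1] Suc.prems by simp
    then obtain a' b' where ab: "a = Q * a'" "b = Q * b'" by (auto simp: dvd_def)
    have "a' \<star> v k + b' \<star> w k = a' \<star> (Q \<star> v (Suc k)) + b' \<star> (Q \<star> w (Suc k))" using v w by simp
    also have "\<dots> = a \<star> v (Suc k) + b \<star> w (Suc k)" by (simp add: ab mult.commute)
    finally show ?case using Suc ab by simp
  qed simp
  then show ?thesis using that v w kill[of v] kill[of w] by metis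
qed

end

section \<open>Ore polynomials as additive polynomials\<close>

text \<open>
  The \<open>q\<close>-th power map is additive; \<open>of_nat_q\<close> makes its derivative vanish, which is what separability
  of an additive polynomial rests on.
\<close>

locale additive_power =
  fixes q :: nat and field_type :: "'e::field itself"
  assumes q_ge_2: "q \<ge> 2"
    and of_nat_q: "of_nat q = (0 :: 'e)"
    and power_add_q: "\<And>x y :: 'e. (x + y) ^ q = x ^ q + y ^ q"
begin

lemma frob_add: "(x + y :: 'e) ^ (q ^ i) = x ^ (q ^ i) + y ^ (q ^ i)"
proof (induction i)
  case (Suc i)
  show ?case by (simp only: power_Suc2 power_mult Suc.IH power_add_q)
qed simp

lemma q_power_pos: "q ^ i > 0"
  using q_ge_2 by simp

lemma frob_zero [simp]: "(0 :: 'e) ^ (q ^ i) = 0"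
  using q_ge_2 by (simp add: zero_power)

lemma frob_minus: "(- x :: 'e) ^ (q ^ i) = - (x ^ (q ^ i))"
proof -
  have "(- x) ^ (q ^ i) + x ^ (q ^ i) = 0" unfolding frob_add[symmetric] by simp
  then show ?thesis by (simp add: eq_neg_iff_add_eq_0)
qed

lemma frob_diff: "(x - y :: 'e) ^ (q ^ i) = x ^ (q ^ i) - y ^ (q ^ i)"
  using frob_add[of x "- y"] by (simp add: frob_minus)

lemma frob_sum: "(\<Sum>j\<in>A. h j :: 'e) ^ (q ^ i) = (\<Sum>j\<in>A. h j ^ (q ^ i))"
  by (induction A rule: infinite_finite_induct) (simp_all add: frob_add)

lemma frob_inj: "(x :: 'e) ^ (q ^ i) = y ^ (q ^ i) \<Longrightarrow> x = y"
  using frob_diff[of x y i] q_power_pos[of i] by (simp add: power_eq_0_iff)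

lemma ore_eval_bound:
  assumes "degree f \<le> N"
  shows "ore_eval q f (x :: 'e) = (\<Sum>i\<le>N. poly.coeff f i * x ^ (q ^ i))"
  unfolding ore_eval_def using assms
  by (intro sum.mono_neutral_left) (auto simp: coeff_eq_0)

lemma ore_eval_0 [simp]: "ore_eval q 0 (x :: 'e) = 0"
  by (simp add: ore_eval_def)

lemma ore_eval_1 [simp]: "ore_eval q 1 (x :: 'e) = x"
  by (simp add: ore_eval_def)

lemma ore_eval_const [simp]: "ore_eval q [:c:] (x :: 'e) = c * x"
  by (simp add: ore_eval_def)

lemma ore_eval_add: "ore_eval q (f + g) (x :: 'e) = ore_eval q f x + ore_eval q g x"
proof -
  let ?N = "max (degree f) (degree g)"
  have "degree (f + g) \<le> ?N" by (rule degree_add_le_max)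
  then show ?thesis
    by (simp add: ore_eval_bound[of _ ?N] sum.distrib[symmetric] algebra_simps)
qed

lemma ore_eval_minus: "ore_eval q (- f) (x :: 'e) = - ore_eval q f x"
  by (simp add: ore_eval_def sum_negf)

lemma ore_eval_diff: "ore_eval q (f - g) (x :: 'e) = ore_eval q f x - ore_eval q g x"
  using ore_eval_add[of f "- g" x] by (simp add: ore_eval_minus)

lemma ore_eval_sum: "ore_eval q (\<Sum>i\<in>A. f i) (x :: 'e) = (\<Sum>i\<in>A. ore_eval q (f i) x)"
  by (induction A rule: infinite_finite_induct) (simp_all add: ore_eval_add)

lemma ore_eval_monom: "ore_eval q (Polynomial.monom c i) (x :: 'e) = c * x ^ (q ^ i)"
proof -
  have "ore_eval q (Polynomial.monom c i) x = (\<Sum>j\<le>i. (if i = j then c else 0) * x ^ (q ^ j))"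
    by (subst ore_eval_bound[of _ i]) (simp_all add: degree_monom_le)
  also have "\<dots> = (\<Sum>j\<le>i. if i = j then c * x ^ (q ^ j) else 0)" by (intro sum.cong) auto
  finally show ?thesis by simp
qed

lemma ore_eval_add_right: "ore_eval q f (x + y :: 'e) = ore_eval q f x + ore_eval q f y"
  by (simp add: ore_eval_def frob_add algebra_simps sum.distrib)

lemma ore_eval_zero_right [simp]: "ore_eval q f (0 :: 'e) = 0"
  by (simp add: ore_eval_def)

lemma ore_eval_minus_right: "ore_eval q f (- x :: 'e) = - ore_eval q f x"
  using ore_eval_add_right[of f x "- x"] by (simp add: eq_neg_iff_add_eq_0 add.commute)

lemma ore_eval_diff_right: "ore_eval q f (x - y :: 'e) = ore_eval q f x - ore_eval q f y"
  using ore_eval_add_right[of f x "- y"] by (simp add: ore_eval_minus_right)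

lemma ore_eval_mult: "ore_eval q (ore_mult q f g) (x :: 'e) = ore_eval q f (ore_eval q g x)"
proof -
  have "ore_eval q (ore_mult q f g) x =
      (\<Sum>i\<le>degree f. \<Sum>j\<le>degree g. poly.coeff f i * poly.coeff g j ^ (q ^ i) * x ^ (q ^ (i + j)))"
    by (simp add: ore_mult_def ore_eval_sum ore_eval_monom)
  also have "\<dots> = (\<Sum>i\<le>degree f. poly.coeff f i * (\<Sum>j\<le>degree g. poly.coeff g j * x ^ (q ^ j)) ^ (q ^ i))"
    by (simp add: frob_sum sum_distrib_left power_mult_distrib power_add mult.commute mult.left_commute flip: power_mult)
  finally show ?thesis by (simp add: ore_eval_def)
qed

lemma coeff_ore_mult:
  "poly.coeff (ore_mult q f (g :: 'e poly)) k = (\<Sum>i\<le>k. poly.coeff f i * poly.coeff g (k - i) ^ (q ^ i))"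
proof -
  have "poly.coeff (ore_mult q f g) k =
      (\<Sum>i\<le>degree f. \<Sum>j\<le>degree g. if i + j = k then poly.coeff f i * poly.coeff g j ^ (q ^ i) else 0)"
    by (simp add: ore_mult_def coeff_sum)
  also have "\<dots> = (\<Sum>i\<le>degree f. if i \<le> k then poly.coeff f i * poly.coeff g (k - i) ^ (q ^ i) else 0)"
  proof (rule sum.cong[OF refl])
    fix i
    have "(\<Sum>j\<le>degree g. if i + j = k then poly.coeff f i * poly.coeff g j ^ (q ^ i) else 0) =
      (\<Sum>j\<le>degree g. if j = k - i then (if i \<le> k then poly.coeff f i * poly.coeff g j ^ (q ^ i) else 0) else 0)"
      by (intro sum.cong) auto
    also have "\<dots> = (if i \<le> k then poly.coeff f i * poly.coeff g (k - i) ^ (q ^ i) else 0)"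
      using q_ge_2 by (simp add: coeff_eq_0)
    finally show "(\<Sum>j\<le>degree g. if i + j = k then poly.coeff f i * poly.coeff g j ^ (q ^ i) else 0) =
      (if i \<le> k then poly.coeff f i * poly.coeff g (k - i) ^ (q ^ i) else 0)" .
  qed
  also have "\<dots> = (\<Sum>i\<in>{..degree f} \<inter> {..k}. poly.coeff f i * poly.coeff g (k - i) ^ (q ^ i))"
    by (subst sum.inter_restrict) (simp_all only: atMost_iff finite_atMost)
  also have "\<dots> = (\<Sum>i\<le>k. poly.coeff f i * poly.coeff g (k - i) ^ (q ^ i))"
    by (rule sum.mono_neutral_left) (auto simp: coeff_eq_0)
  finally show ?thesis .
qed

lemma coeff_0_ore_mult: "poly.coeff (ore_mult q f (g :: 'e poly)) 0 = poly.coeff f 0 * poly.coeff g 0"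
  by (simp add: coeff_ore_mult)

lemma degree_ore_mult:
  assumes "f \<noteq> 0" "(g :: 'e poly) \<noteq> 0"
  shows "degree (ore_mult q f g) = degree f + degree g" "ore_mult q f g \<noteq> 0"
    "lead_coeff (ore_mult q f g) = lead_coeff f * lead_coeff g ^ (q ^ degree f)"
proof -
  have zero: "poly.coeff (ore_mult q f g) k = 0" if "k > degree f + degree g" for k
    unfolding coeff_ore_mult
  proof (rule sum.neutral, intro ballI)
    fix i assume "i \<in> {..k}"
    then have "i > degree f \<or> k - i > degree g" using that by auto
    then show "poly.coeff f i * poly.coeff g (k - i) ^ (q ^ i) = 0" using q_ge_2 by (auto simp: coeff_eq_0)
  qed
  have top: "poly.coeff (ore_mult q f g) (degree f + degree g) = lead_coeff f * lead_coeff g ^ (q ^ degree f)"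
  proof -
    have "poly.coeff (ore_mult q f g) (degree f + degree g) =
      (\<Sum>i\<in>{degree f}. poly.coeff f i * poly.coeff g (degree f + degree g - i) ^ (q ^ i))"
      unfolding coeff_ore_mult
    proof (rule sum.mono_neutral_right; (intro ballI)?)
      fix i assume "i \<in> {..degree f + degree g} - {degree f}"
      then have "i > degree f \<or> degree f + degree g - i > degree g" by auto
      then show "poly.coeff f i * poly.coeff g (degree f + degree g - i) ^ (q ^ i) = 0" using q_ge_2 by (auto simp: coeff_eq_0)
    qed auto
    then show ?thesis by simp
  qed
  have nz: "lead_coeff f * lead_coeff g ^ (q ^ degree f) \<noteq> 0" using assms by simp
  show deg: "degree (ore_mult q f g) = degree f + degree g"
    by (rule antisym[OF degree_le le_degree]) (use zero top nz in auto)
  show "ore_mult q f g \<noteq> 0" using top nz by auto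
  show "lead_coeff (ore_mult q f g) = lead_coeff f * lead_coeff g ^ (q ^ degree f)"
    unfolding deg by (rule top)
qed

lemma ore_mult_add_left: "ore_mult q (f1 + f2) (g :: 'e poly) = ore_mult q f1 g + ore_mult q f2 g"
  by (simp add: poly_eq_iff coeff_ore_mult algebra_simps sum.distrib)

lemma ore_right_division:
  assumes "(g :: 'e poly) \<noteq> 0"
  obtains z r where "f = ore_mult q z g + r" "r = 0 \<or> degree r < degree g"
proof -
  have "\<exists>z r. f = ore_mult q z g + r \<and> (r = 0 \<or> degree r < degree g)"
  proof (induction "degree f" arbitrary: f rule: less_induct)
    case less
    show ?case
    proof (cases "f = 0 \<or> degree f < degree g")
      case True
      then show ?thesis by (intro exI[of _ 0] exI[of _ f]) (auto simp: poly_eq_iff coeff_ore_mult)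
    next
      case False
      define j where "j = degree f - degree g"
      define z where "z = Polynomial.monom (lead_coeff f / lead_coeff g ^ (q ^ j)) j"
      have znz: "lead_coeff f / lead_coeff g ^ (q ^ j) \<noteq> 0" using False assms by simp
      then have z: "z \<noteq> 0" "degree z = j" unfolding z_def by (auto simp: degree_monom_eq)
      have deg: "degree (ore_mult q z g) = degree f" and lc: "lead_coeff (ore_mult q z g) = lead_coeff f"
        using degree_ore_mult[OF z(1) assms] z False znz assms by (auto simp: j_def z_def degree_monom_eq)
      define f' where "f' = f - ore_mult q z g"
      have f': "f' = 0 \<or> degree f' < degree f"
      proof -
        have "degree f' \<le> degree f" unfolding f'_def using deg by (intro degree_diff_le) auto
        moreover have "poly.coeff f' (degree f) = 0" unfolding f'_def using lc deg by simp
        ultimately show ?thesis by (metis leading_coeff_0_iff le_neq_implies_less)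
      qed
      have "\<exists>z' r. f' = ore_mult q z' g + r \<and> (r = 0 \<or> degree r < degree g)"
      proof (cases "f' = 0")
        case True
        then show ?thesis by (intro exI[of _ 0]) (auto simp: poly_eq_iff coeff_ore_mult)
      next
        case False
        then show ?thesis using f' less by blast
      qed
      then obtain z' r where "f' = ore_mult q z' g + r" "r = 0 \<or> degree r < degree g" by blast
      then show ?thesis
        by (intro exI[of _ "z + z'"] exI[of _ r]) (simp add: ore_mult_add_left f'_def algebra_simps)
    qed
  qed
  then show ?thesis using that by blast
qed

text \<open>
  The ordinary polynomial \<open>\<Sum> c_i X^(q^i)\<close> whose values are those of the Ore polynomial; it makes root
  counting available.
\<close>

definition additive_poly :: "'e poly \<Rightarrow> 'e poly" where
  "additive_poly f = (\<Sum>i\<le>degree f. Polynomial.monom (poly.coeff f i) (q ^ i))"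

lemma poly_additive_poly: "poly (additive_poly f) x = ore_eval q f x"
  by (simp add: additive_poly_def ore_eval_def poly_sum poly_monom)

lemma coeff_additive_poly: "poly.coeff (additive_poly f) (q ^ i) = poly.coeff f i"
proof -
  have inj: "q ^ j = q ^ i \<longleftrightarrow> j = i" for j i
    using q_ge_2 by (simp add: power_inject_exp)
  show ?thesis
    by (simp add: additive_poly_def coeff_sum inj coeff_eq_0)
qed

lemma additive_poly_eq_0: "additive_poly f = 0 \<longleftrightarrow> f = 0"
proof
  assume "additive_poly f = 0"
  then have "poly.coeff f i = 0" for i using coeff_additive_poly[of f i] by simp
  then show "f = 0" by (simp add: poly_eq_iff)
qed (simp add: additive_poly_def)

lemma degree_additive_poly:
  assumes "f \<noteq> 0"
  shows "degree (additive_poly f) = q ^ degree f"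
proof (rule antisym)
  show "degree (additive_poly f) \<le> q ^ degree f"
    unfolding additive_poly_def
  proof (rule degree_sum_le)
    fix i assume "i \<in> {..degree f}"
    then have "q ^ i \<le> q ^ degree f" using q_ge_2 by (intro power_increasing) auto
    then show "degree (Polynomial.monom (poly.coeff f i) (q ^ i)) \<le> q ^ degree f"
      using degree_monom_le order_trans by blast
  qed auto
  show "q ^ degree f \<le> degree (additive_poly f)"
    by (rule le_degree) (use assms coeff_additive_poly in auto)
qed

lemma ore_kernel_bound:
  assumes "f \<noteq> 0"
  shows "finite {x :: 'e. ore_eval q f x = 0}" "card {x :: 'e. ore_eval q f x = 0} \<le> q ^ degree f"
  using poly_roots_finite[of "additive_poly f"] card_poly_roots_bound[of "additive_poly f"]
    degree_additive_poly[OF assms] assms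
  by (auto simp: poly_additive_poly additive_poly_eq_0)

lemma ore_eq_0I:
  assumes "infinite {x :: 'e. ore_eval q f x = 0}"
  shows "f = 0"
  using ore_kernel_bound[of f] assms by blast

lemma ore_eq_0I_card:
  assumes "f = 0 \<or> degree f < h" "S \<subseteq> {x :: 'e. ore_eval q f x = 0}" "card S = q ^ h"
  shows "f = 0"
proof (rule ccontr)
  assume "f \<noteq> 0"
  then have "q ^ h \<le> q ^ degree f"
    using ore_kernel_bound[of f] assms card_mono[of "{x. ore_eval q f x = 0}" S] by auto
  moreover have "q ^ degree f < q ^ h"
    using assms(1) \<open>f \<noteq> 0\<close> q_ge_2 by (intro power_strict_increasing) auto
  ultimately show False by simp
qed

end

lemma card_roots_separable:
  fixes p :: "'e::alg_closed_field poly"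
  assumes "p \<noteq> 0" "\<And>x. poly p x = 0 \<Longrightarrow> poly (pderiv p) x \<noteq> 0"
  shows "card {x. poly p x = 0} = degree p"
proof -
  obtain M where M: "size M = degree p" "p = Polynomial.smult (lead_coeff p) (\<Prod>x\<in>#M. [:-x, 1:])"
    using alg_closed_imp_factorization[OF assms(1)] by blast
  have roots: "{x. poly p x = 0} = set_mset M"
  proof -
    have "poly p x = lead_coeff p * (\<Prod>y\<in>#M. x - y)" for x
      by (subst M(2)) (simp add: poly_prod_mset image_mset.compositionality o_def)
    then show ?thesis using assms(1) by (auto simp: prod_mset_zero_iff)
  qed
  have "count M x \<le> 1" for x
  proof (rule ccontr)
    assume "\<not> count M x \<le> 1"
    then have "2 \<le> count M x" by simp
    then have "{#x, x#} \<subseteq># M"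
      by (auto simp: subseteq_mset_def)
    then obtain N where "M = {#x, x#} + N" by (metis subset_mset.le_iff_add)
    then have "p = [:-x, 1:] * ([:-x, 1:] * Polynomial.smult (lead_coeff p) (\<Prod>x\<in>#N. [:-x, 1:]))"
      using M(2) by (simp add: mult.assoc)
    then have "\<exists>r. p = [:-x, 1:] * ([:-x, 1:] * r)" by blast
    then obtain l r where r: "p = l * (l * r)" "l = [:-x, 1:]" by blast
    then have "poly l x = 0" by simp
    have "poly p x = 0 \<and> poly (pderiv p) x = 0" unfolding r(1) using \<open>poly l x = 0\<close> by (simp add: pderiv_mult)
    then show False using assms(2) by blast
  qed
  then have one: "count M x = 1" if "x \<in># M" for x
    using that by (metis count_greater_eq_one_iff le_antisym)
  have "size M = (\<Sum>x\<in>set_mset M. count M x)" by (rule size_multiset_overloaded_eq)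
  also have "\<dots> = card (set_mset M)" using one by simp
  finally show ?thesis using roots M(1) by simp
qed

locale additive_power_closed = additive_power q field_type
  for q and field_type :: "'e::alg_closed_field itself"
begin

text \<open>
  The derivative of the additive polynomial is the constant coefficient of the Ore polynomial, so there
  are no multiple roots.
\<close>

lemma card_ore_kernel:
  assumes "poly.coeff f 0 \<noteq> 0"
  shows "card {x :: 'e. ore_eval q f x = 0} = q ^ degree f"
proof -
  have fnz: "f \<noteq> 0" using assms by auto
  have "poly (pderiv (additive_poly f)) x = poly.coeff f 0" for x
  proof -
    have q0: "(of_nat (q ^ i) :: 'e) = 0" if "i > 0" for i
      using that of_nat_q by simp
    have "poly (pderiv (additive_poly f)) x = (\<Sum>i\<le>degree f. poly.coeff f i * of_nat (q ^ i) * x ^ (q ^ i - 1))"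
      unfolding additive_poly_def pderiv_sum poly_sum
      by (intro sum.cong) (auto simp: pderiv_monom poly_monom)
    also have "\<dots> = (\<Sum>i\<in>{0}. poly.coeff f i * of_nat (q ^ i) * x ^ (q ^ i - 1))"
      by (rule sum.mono_neutral_right) (use q0 in auto)
    finally show ?thesis by simp
  qed
  then have "card {x. poly (additive_poly f) x = 0} = degree (additive_poly f)"
    using assms additive_poly_eq_0 fnz by (intro card_roots_separable) auto
  then show ?thesis using degree_additive_poly[OF fnz] by (simp add: poly_additive_poly)
qed

lemma ore_surj:
  assumes "f \<noteq> 0"
  obtains y :: 'e where "ore_eval q f y = x"
proof -
  have d: "degree (additive_poly f) > 0" using degree_additive_poly[OF assms] q_power_pos by simp
  then have "degree (additive_poly f + [:- x:]) > 0"
    by (simp add: degree_add_eq_left)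
  then obtain y where "poly (additive_poly f + [:- x:]) y = 0"
    using alg_closed_imp_poly_has_root by blast
  then show ?thesis using that by (simp add: poly_additive_poly)
qed

lemma infinite_UNIV: "infinite (UNIV :: 'e set)"
proof
  assume fin: "finite (UNIV :: 'e set)"
  define k where "k = Suc (CARD('e))"
  define f where "f = (Polynomial.monom 1 k - 1 :: 'e poly)"
  have f0: "poly.coeff f 0 \<noteq> 0" unfolding f_def k_def by simp
  have "degree f = k" using degree_add_eq_left[of "- 1" "Polynomial.monom (1 :: 'e) k"]
    by (simp add: f_def k_def degree_monom_eq)
  then have "q ^ k = card {x :: 'e. ore_eval q f x = 0}" using card_ore_kernel[OF f0] by simp
  also have "\<dots> \<le> CARD('e)" using fin by (intro card_mono) auto
  also have "\<dots> < k" by (simp add: k_def)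
  also have "k < q ^ k" using q_ge_2 by (intro power_gt_expt) auto
  finally show False .
qed

lemma ore_eqI:
  assumes "\<And>x :: 'e. ore_eval q f x = ore_eval q g x"
  shows "f = g"
  using ore_eq_0I[of "f - g"] infinite_UNIV assms by (simp add: ore_eval_diff)

end

section \<open>Ore polynomials over a finite field, acting on its algebraic closure\<close>

lemma power_card_same:
  fixes x :: "'a::{field,finite}"
  shows "x ^ CARD('a) = x"
proof (cases "x = 0")
  case False
  let ?U = "UNIV - {0 :: 'a}"
  have "bij_betw ((*) x) ?U ?U"
    by (rule bij_betw_byWitness[of _ "\<lambda>y. y / x"]) (use False in auto)
  then have "\<Prod>?U = (\<Prod>y\<in>?U. x * y)" by (rule prod.reindex_bij_betw[symmetric])
  also have "\<dots> = x ^ (CARD('a) - 1) * \<Prod>?U" by (simp add: prod.distrib card_Diff_singleton)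
  finally have "x ^ (CARD('a) - 1) = 1" by simp
  moreover have "CARD('a) = Suc (CARD('a) - 1)" by simp
  ultimately show ?thesis by (metis mult.right_neutral power_Suc)
qed (simp add: zero_power)

text \<open>
  The setting of Ore polynomials over a finite field \<open>L\<close> of degree \<open>n\<close> over the field of \<open>q\<close> elements.
  They act on the algebraic closure of \<open>L\<close>, where an Ore polynomial is determined by its values, and
  \<open>F = \<tau>^n\<close> commutes with all of them because it fixes \<open>L\<close>.
\<close>

locale finite_ore = additive_power_closed q field_type
  for q and field_type :: "'l::{field,finite} alg_closure itself" +
  fixes n :: nat
  assumes card_L: "CARD('l) = q ^ n"
begin

sublocale L: additive_power q "TYPE('l)"
proof
  show "2 \<le> q" by (rule q_ge_2)
  show "of_nat q = (0 :: 'l)" using of_nat_q by (metis to_ac_eq_0_iff to_ac_of_nat)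
  show "(x + y) ^ q = x ^ q + y ^ q" for x y :: 'l
    using power_add_q[of "to_ac x" "to_ac y"] by (metis to_ac_add to_ac_eq_iff to_ac_power)
qed

abbreviation E :: "'l poly \<Rightarrow> 'l alg_closure \<Rightarrow> 'l alg_closure" where
  "E \<equiv> ore_eval_ac q"

abbreviation F :: "'l alg_closure \<Rightarrow> 'l alg_closure" where
  "F x \<equiv> x ^ (q ^ n)"

lemma map_to_ac_add: "map_poly to_ac (f + g) = map_poly to_ac f + map_poly to_ac g"
  by (simp add: poly_eq_iff coeff_map_poly)

lemma map_to_ac_diff: "map_poly to_ac (f - g) = map_poly to_ac f - map_poly to_ac g"
  by (simp add: poly_eq_iff coeff_map_poly)

lemma map_to_ac_ore_mult:
  "map_poly to_ac (ore_mult q f g) = ore_mult q (map_poly to_ac f) (map_poly to_ac (g :: 'l poly))"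
  by (simp add: poly_eq_iff coeff_map_poly coeff_ore_mult L.coeff_ore_mult to_ac_sum)

lemma map_to_ac_eq_0: "map_poly to_ac f = 0 \<longleftrightarrow> f = 0"
  by (simp add: poly_eq_iff coeff_map_poly)

lemma degree_map_to_ac: "degree (map_poly to_ac f) = degree f"
  by (rule degree_map_poly) simp

lemma E_add: "E (f + g) x = E f x + E g x"
  by (simp add: ore_eval_ac_def map_to_ac_add ore_eval_add)

lemma E_diff: "E (f - g) x = E f x - E g x"
  by (simp add: ore_eval_ac_def map_to_ac_diff ore_eval_diff)

lemma E_mult: "E (ore_mult q f g) x = E f (E g x)"
  by (simp add: ore_eval_ac_def map_to_ac_ore_mult ore_eval_mult)

lemma E_0 [simp]: "E 0 x = 0"
  by (simp add: ore_eval_ac_def)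

lemma E_const [simp]: "E [:c:] x = to_ac c * x"
proof -
  have "map_poly to_ac [:c:] = [:to_ac c:]"
    by (simp add: poly_eq_iff coeff_map_poly coeff_pCons split: nat.split)
  then show ?thesis by (simp add: ore_eval_ac_def)
qed

lemma E_1 [simp]: "E 1 x = x"
  by (simp add: ore_eval_ac_def)

lemma E_monom: "E (Polynomial.monom c i) x = to_ac c * x ^ (q ^ i)"
  by (simp add: ore_eval_ac_def map_poly_monom ore_eval_monom)

lemma E_frobenius: "E (Polynomial.monom 1 n) x = F x"
  by (simp add: E_monom)

lemma E_add_right: "E f (x + y) = E f x + E f y"
  by (simp add: ore_eval_ac_def ore_eval_add_right)

lemma E_diff_right: "E f (x - y) = E f x - E f y"
  by (simp add: ore_eval_ac_def ore_eval_diff_right)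

lemma E_zero_right [simp]: "E f 0 = 0"
  by (simp add: ore_eval_ac_def)

lemma E_to_ac: "E f (to_ac x) = to_ac (ore_eval q f x)"
  by (simp add: ore_eval_ac_def ore_eval_def degree_map_to_ac coeff_map_poly to_ac_sum)

lemma E_eqI: "(\<And>x. E f x = E g x) \<Longrightarrow> f = g"
  using ore_eqI[of "map_poly to_ac f" "map_poly to_ac g"] map_to_ac_eq_0[of "f - g"]
  by (simp add: ore_eval_ac_def map_to_ac_diff)

lemma E_eq_0I: "infinite {x. E f x = 0} \<Longrightarrow> f = 0"
  using ore_eq_0I[of "map_poly to_ac f"] by (simp add: ore_eval_ac_def map_to_ac_eq_0)

lemma E_surj:
  assumes "f \<noteq> 0"
  obtains y where "E f y = x"
  using ore_surj[of "map_poly to_ac f" x] assms that by (auto simp: ore_eval_ac_def map_to_ac_eq_0)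

lemma E_kernel_bound:
  assumes "f \<noteq> 0"
  shows "finite {x. E f x = 0}" "card {x. E f x = 0} \<le> q ^ degree f"
  using ore_kernel_bound[of "map_poly to_ac f"] assms
  by (simp_all add: ore_eval_ac_def map_to_ac_eq_0 degree_map_to_ac)

lemma card_E_kernel:
  assumes "poly.coeff f 0 \<noteq> 0"
  shows "card {x. E f x = 0} = q ^ degree f"
  using card_ore_kernel[of "map_poly to_ac f"] assms
  by (simp add: ore_eval_ac_def coeff_map_poly degree_map_to_ac)

lemma n_pos: "n > 0"
proof (rule ccontr)
  assume "\<not> n > 0"
  then have "CARD('l) = 1" using card_L by simp
  moreover have "card {0, 1 :: 'l} \<le> CARD('l)" by (rule card_mono) auto
  ultimately show False by simp
qed

lemma frobenius_fixed: "F x = x \<longleftrightarrow> x \<in> range to_ac"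
proof -
  note n = n_pos
  define f where "f = (Polynomial.monom 1 n - 1 :: 'l poly)"
  have "poly.coeff f 0 \<noteq> 0" "degree f \<le> n" using n
    by (auto simp: f_def degree_monom_le intro!: degree_diff_le)
  then have f: "poly.coeff f 0 \<noteq> 0" "f \<noteq> 0" "degree f \<le> n" by auto
  have ker: "{x. E f x = 0} = {x. F x = x}" unfolding f_def by (simp add: E_diff E_monom)
  have sub: "range to_ac \<subseteq> {x. F x = x}"
  proof clarify
    fix y :: 'l
    have "y ^ CARD('l) = y" by (rule power_card_same)
    then show "F (to_ac y) = to_ac y" by (simp add: card_L flip: to_ac_power)
  qed
  have "card (range (to_ac :: 'l \<Rightarrow> _)) = q ^ n"
    using card_image[OF inj_to_ac] card_L by metis
  moreover have "card {x. F x = x} \<le> q ^ degree f" using E_kernel_bound(2)[OF f(2)] ker by simp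
  moreover have "q ^ degree f \<le> q ^ n" using f(3) q_ge_2 by (intro power_increasing) auto
  ultimately have "range to_ac = {x. F x = x}"
    using E_kernel_bound(1)[OF f(2)] ker sub by (intro card_seteq) auto
  then show ?thesis by auto
qed

lemma E_frobenius_commute: "E f (F x) = F (E f x)"
proof -
  have "F (to_ac c) = to_ac c" for c :: 'l using frobenius_fixed by blast
  then show ?thesis
    unfolding ore_eval_ac_def ore_eval_def
    by (simp add: frob_sum coeff_map_poly power_mult_distrib)
      (simp add: mult.commute flip: power_mult)
qed

text \<open>
  The remainder of \<open>f\<close> on division by \<open>g\<close> vanishes on the kernel of \<open>g\<close>, which by separability has more
  elements than a nonzero Ore polynomial of smaller degree has zeros.
\<close>

lemma E_right_divide:
  assumes g: "poly.coeff g 0 \<noteq> 0" and ker: "\<And>x. E g x = 0 \<Longrightarrow> E f x = 0"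
  obtains z where "\<And>x. E f x = E z (E g x)" "f = ore_mult q z g"
proof -
  have "g \<noteq> 0" using g by auto
  then obtain z r where zr: "f = ore_mult q z g + r" "r = 0 \<or> degree r < degree g"
    by (rule L.ore_right_division)
  have "E r x = 0" if "E g x = 0" for x
    using ker[OF that] that by (simp add: zr(1) E_add E_mult)
  then have "map_poly to_ac r = 0"
    using zr(2) card_E_kernel[OF g]
    by (intro ore_eq_0I_card[of _ "degree g" "{x. E g x = 0}"])
      (auto simp: degree_map_to_ac ore_eval_ac_def map_to_ac_eq_0)
  then have "r = 0" by (simp add: map_to_ac_eq_0)
  then show ?thesis using that[of z] zr(1) by (simp add: E_mult)
qed

text \<open>
  The product of all \<open>X - h\<close> with \<open>h\<close> in \<open>H\<close> is additive.  It is obtained here one point \<open>x\<close> at a time: if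
  \<open>u\<close> takes \<open>x\<close> to \<open>w \<noteq> 0\<close>, then \<open>(\<tau> - w^(q-1)) u\<close> has the kernel of \<open>u\<close> enlarged by the line through \<open>x\<close>.
\<close>

lemma additive_subgroup_polynomial:
  assumes "finite S" "S \<subseteq> H"
    and H: "0 \<in> H" "\<And>x y. x \<in> H \<Longrightarrow> y \<in> H \<Longrightarrow> x + y \<in> H" "\<And>t x. t ^ q = t \<Longrightarrow> x \<in> H \<Longrightarrow> t * x \<in> H"
  obtains u :: "'l alg_closure poly" where "lead_coeff u = 1" "poly.coeff u 0 \<noteq> 0"
    "S \<subseteq> {x. ore_eval q u x = 0}" "{x. ore_eval q u x = 0} \<subseteq> H"
proof -
  have "\<exists>u :: 'l alg_closure poly. lead_coeff u = 1 \<and> poly.coeff u 0 \<noteq> 0 \<and>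
    S \<subseteq> {x. ore_eval q u x = 0} \<and> {x. ore_eval q u x = 0} \<subseteq> H"
    using assms(1,2)
  proof (induction S rule: finite_induct)
    case empty
    show ?case by (rule exI[of _ 1]) (use H(1) in auto)
  next
    case (insert x S)
    then obtain u :: "'l alg_closure poly" where u: "lead_coeff u = 1" "poly.coeff u 0 \<noteq> 0"
      "S \<subseteq> {x. ore_eval q u x = 0}" "{x. ore_eval q u x = 0} \<subseteq> H" by auto
    define w where "w = ore_eval q u x"
    show ?case
    proof (cases "w = 0")
      case True
      then show ?thesis using u w_def by auto
    next
      case False
      define g where "g = [:- (w ^ (q - 1)), 1:]"
      have eval_g: "ore_eval q g y = y ^ q - w ^ (q - 1) * y" for y
        by (simp add: g_def ore_eval_def)
      define u' where "u' = ore_mult q g u"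
      have "u \<noteq> 0" using u(2) by auto
      then have "lead_coeff u' = 1" using degree_ore_mult(3)[of g u] u(1) by (simp add: u'_def g_def)
      moreover have "poly.coeff u' 0 \<noteq> 0" using u(2) False by (simp add: u'_def coeff_0_ore_mult g_def)
      moreover have "insert x S \<subseteq> {x. ore_eval q u' x = 0}"
      proof -
        have "w ^ q = w ^ (q - 1) * w" using q_ge_2 by (cases q) auto
        moreover have "(0 :: 'l alg_closure) ^ q = 0" using q_ge_2 by simp
        ultimately show ?thesis using u(3) by (auto simp: u'_def ore_eval_mult eval_g w_def)
      qed
      moreover have "y \<in> H" if "ore_eval q u' y = 0" for y
      proof -
        define t where "t = ore_eval q u y / w"
        have uy: "ore_eval q u y = t * w" using False by (simp add: t_def)
        have "(t * w) ^ q = w ^ (q - 1) * (t * w)" using that by (simp add: u'_def ore_eval_mult eval_g uy)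
        moreover have "w ^ q = w ^ (q - 1) * w" using q_ge_2 by (cases q) auto
        ultimately have t: "t ^ q = t" using False by (simp add: power_mult_distrib)
        have tq: "t ^ (q ^ i) = t" for i
        proof (induction i)
          case (Suc i)
          then show ?case using t by (simp only: power_Suc2 power_mult)
        qed simp
        have "ore_eval q u (t * x) = t * ore_eval q u x"
          by (simp add: ore_eval_def power_mult_distrib tq sum_distrib_left mult.left_commute)
        then have "ore_eval q u (y - t * x) = 0" by (simp add: ore_eval_diff_right uy w_def)
        then have "y - t * x \<in> H" using u(4) by auto
        then have "(y - t * x) + t * x \<in> H" using H(2) H(3)[OF t] insert.prems by blast
        then show ?thesis by simp
      qed
      ultimately show ?thesis by blast
    qed
  qed
  then show ?thesis using that by blast
qed

text \<open>
  The monic separable additive polynomial with kernel \<open>H\<close> is unique, hence fixed by \<open>F\<close>, so its coefficients lie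
  in \<open>L\<close>.
\<close>

lemma stable_subgroup_polynomial:
  assumes fin: "finite H"
    and H: "0 \<in> H" "\<And>x y. x \<in> H \<Longrightarrow> y \<in> H \<Longrightarrow> x + y \<in> H" "\<And>t x. t ^ q = t \<Longrightarrow> x \<in> H \<Longrightarrow> t * x \<in> H"
    and F: "\<And>x. x \<in> H \<Longrightarrow> F x \<in> H"
  obtains u :: "'l poly" where "poly.coeff u 0 \<noteq> 0" "\<And>x. E u x = 0 \<longleftrightarrow> x \<in> H"
proof -
  obtain v :: "'l alg_closure poly" where v: "lead_coeff v = 1" "poly.coeff v 0 \<noteq> 0"
    and "H \<subseteq> {x. ore_eval q v x = 0}" "{x. ore_eval q v x = 0} \<subseteq> H"
    using additive_subgroup_polynomial[OF fin order_refl H] by blast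
  then have ker: "ore_eval q v x = 0 \<longleftrightarrow> x \<in> H" for x by blast
  have cardH: "card H = q ^ degree v" using card_ore_kernel[OF v(2)] ker by simp
  have FH: "F ` H = H"
    using fin F frob_inj by (intro endo_inj_surj) (auto intro!: inj_onI)
  define v' where "v' = map_poly (\<lambda>c. c ^ (q ^ n)) v"
  have cv': "poly.coeff v' i = poly.coeff v i ^ (q ^ n)" for i
    unfolding v'_def by (rule coeff_map_poly) simp
  have dv': "degree v' = degree v"
    unfolding v'_def using q_power_pos[of n] by (intro degree_map_poly) auto
  have "ore_eval q v' (F x) = F (ore_eval q v x)" for x
    unfolding ore_eval_def dv' cv'
    by (simp add: frob_sum power_mult_distrib) (simp add: mult.commute flip: power_mult)
  then have zero: "ore_eval q v' y = 0" if "y \<in> H" for y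
  proof -
    have "y \<in> F ` H" using that by (simp only: FH)
    then obtain x where "x \<in> H" "y = F x" by (elim imageE)
    then show ?thesis using q_ge_2 \<open>\<And>x. ore_eval q v' (F x) = F (ore_eval q v x)\<close> ker by simp
  qed
  have "v' - v = 0"
  proof (rule ore_eq_0I_card[of _ "degree v" H])
    have "degree (v' - v) \<le> degree v" using dv' by (intro degree_diff_le) auto
    moreover have "poly.coeff (v' - v) (degree v) = 0" using v(1) by (simp add: cv')
    ultimately show "v' - v = 0 \<or> degree (v' - v) < degree v"
      by (metis leading_coeff_0_iff le_neq_implies_less)
    show "H \<subseteq> {x. ore_eval q (v' - v) x = 0}" using zero ker by (auto simp: ore_eval_diff)
  qed (rule cardH)
  then have "F (poly.coeff v i) = poly.coeff v i" for i using cv'[of i] by simp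
  then have coeffs: "to_ac (of_ac (poly.coeff v i)) = poly.coeff v i" for i
    using frobenius_fixed to_ac_of_ac by blast
  define u where "u = map_poly of_ac v"
  have "map_poly to_ac u = v" unfolding u_def
    by (simp add: poly_eq_iff coeff_map_poly coeffs)
  then have "poly.coeff u 0 \<noteq> 0" "\<And>x. E u x = 0 \<longleftrightarrow> x \<in> H"
    using v(2) ker by (auto simp: ore_eval_ac_def coeff_map_poly simp flip: \<open>map_poly to_ac u = v\<close>)
  then show ?thesis using that by blast
qed

end

section \<open>Drinfeld modules over a finite field\<close>

locale drinfeld_setting = finite_ore q field_type n
  for q and field_type :: "'l::{field,finite} alg_closure itself" and n +
  fixes \<iota> :: "'k::{field,finite} \<Rightarrow> 'l" and \<gamma> :: "'k poly \<Rightarrow> 'l" and P :: "'k poly"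
  assumes q_eq: "q = CARD('k)"
    and \<iota>_add: "\<iota> (a + b) = \<iota> a + \<iota> b" and \<iota>_mult: "\<iota> (a * b) = \<iota> a * \<iota> b" and \<iota>_one: "\<iota> 1 = 1"
    and \<gamma>_add: "\<gamma> (f + g) = \<gamma> f + \<gamma> g" and \<gamma>_mult: "\<gamma> (f * g) = \<gamma> f * \<gamma> g"
    and \<gamma>_const: "\<gamma> [:c:] = \<iota> c"
    and P_irred: "monic_irreducible P"
    and \<gamma>_kernel: "\<gamma> f = 0 \<longleftrightarrow> P dvd f"
begin

lemma \<iota>_zero [simp]: "\<iota> 0 = 0"
  using \<iota>_add[of 0 0] by (metis add_0 add_cancel_right_right)

lemma \<iota>_inj: "inj \<iota>"
proof (rule injI)
  fix a b assume eq: "\<iota> a = \<iota> b"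
  have "\<iota> (a - b) + \<iota> b = \<iota> a" using \<iota>_add[of "a - b" b] by simp
  then have zero: "\<iota> (a - b) = 0" using eq by simp
  show "a = b"
  proof (rule ccontr)
    assume "a \<noteq> b"
    then have "\<iota> (a - b) * \<iota> (inverse (a - b)) = 1" using \<iota>_one by (simp flip: \<iota>_mult)
    then show False using zero by simp
  qed
qed

lemma \<iota>_power: "\<iota> (c ^ i) = \<iota> c ^ i"
  by (induction i) (simp_all add: \<iota>_one \<iota>_mult)

lemma \<iota>_frobenius: "\<iota> c ^ (q ^ i) = \<iota> c"
proof (induction i)
  case (Suc i)
  have "\<iota> c ^ q = \<iota> c" using power_card_same[of c] by (simp add: q_eq flip: \<iota>_power)
  then show ?case using Suc by (simp only: power_Suc2 power_mult)
qed simp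

text \<open>
  The polynomial \<open>X^q - X\<close> has at most \<open>q\<close> roots, and the images of the scalars are \<open>q\<close> of them.
\<close>

lemma power_q_fixed:
  fixes t :: "'l alg_closure"
  assumes "t ^ q = t"
  obtains c where "t = to_ac (\<iota> c)"
proof -
  define f where "f = (Polynomial.monom 1 1 - 1 :: 'l poly)"
  have "poly.coeff f 0 = -1" by (simp add: f_def)
  then have f: "f \<noteq> 0" by auto
  have "degree f \<le> 1" by (auto simp: f_def degree_monom_le intro!: degree_diff_le)
  then have "q ^ degree f \<le> q ^ 1" using q_ge_2 by (intro power_increasing) auto
  have ker: "{x. E f x = 0} = {x. x ^ q = x}" by (simp add: f_def E_diff E_monom)
  have sub: "range (\<lambda>c. to_ac (\<iota> c)) \<subseteq> {x. x ^ q = x}"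
    using \<iota>_frobenius[of _ 1] by (auto simp flip: to_ac_power)
  have "inj (\<lambda>c. to_ac (\<iota> c))" using \<iota>_inj by (auto simp: inj_def)
  then have "card (range (\<lambda>c. to_ac (\<iota> c))) = q" by (metis card_image q_eq)
  moreover have "card {x :: 'l alg_closure. x ^ q = x} \<le> q"
    using E_kernel_bound(2)[OF f] \<open>q ^ degree f \<le> q ^ 1\<close> by (simp add: ker)
  ultimately have "range (\<lambda>c. to_ac (\<iota> c)) = {x. x ^ q = x}"
    using E_kernel_bound(1)[OF f] ker sub by (intro card_seteq) auto
  then show ?thesis using assms that by blast
qed

text \<open>
  An Ore polynomial without constant coefficient is a product \<open>g \<tau>\<close>, and \<open>\<tau>\<close> is injective.
\<close>

lemma E_kernel_inseparable:
  assumes "f \<noteq> 0" "poly.coeff f 0 = 0"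
  shows "card {x. E f x = 0} < q ^ degree f"
proof -
  obtain g where g: "f = pCons 0 g" using assms(2) by (cases f) auto
  then have gnz: "g \<noteq> 0" using assms(1) by auto
  have "E f x = E g (x ^ q)" for x
  proof -
    have "map_poly to_ac f = pCons 0 (map_poly to_ac g)"
      by (simp add: g poly_eq_iff coeff_map_poly coeff_pCons split: nat.split)
    then have "E f x = (\<Sum>i\<le>Suc (degree g). poly.coeff (pCons 0 (map_poly to_ac g)) i * x ^ (q ^ i))"
      unfolding ore_eval_ac_def by (subst ore_eval_bound[of _ "Suc (degree g)"]) (auto simp: degree_map_to_ac)
    also have "\<dots> = (\<Sum>i\<le>degree g. poly.coeff (map_poly to_ac g) i * (x ^ q) ^ (q ^ i))"
      by (subst sum.atMost_Suc_shift) (simp flip: power_mult)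
    finally show ?thesis by (simp add: ore_eval_ac_def ore_eval_def degree_map_to_ac)
  qed
  then have "(\<lambda>x. x ^ q) ` {x. E f x = 0} \<subseteq> {x. E g x = 0}" by auto
  then have "card {x. E f x = 0} \<le> card {x. E g x = 0}"
    using frob_inj[of _ 1] E_kernel_bound(1)[OF gnz] by (intro card_inj_on_le[of "\<lambda>x. x ^ q"]) (auto intro: inj_onI)
  also have "\<dots> \<le> q ^ degree g" using E_kernel_bound(2)[OF gnz] .
  also have "\<dots> < q ^ degree f" using gnz g q_ge_2 by (intro power_strict_increasing) auto
  finally show ?thesis .
qed

end

locale drinfeld_module = drinfeld_setting q field_type n \<iota> \<gamma> P
  for q and field_type :: "'l::{field,finite} alg_closure itself" and n
    and \<iota> :: "'k::{field,finite} \<Rightarrow> 'l" and \<gamma> P +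
  fixes \<Phi> :: "'k poly \<Rightarrow> 'l poly"
  assumes drinfeld: "drinfeld_rank2 \<iota> \<gamma> \<Phi>"
begin

lemma \<Phi>_add: "\<Phi> (a + b) = \<Phi> a + \<Phi> b"
  and \<Phi>_mult: "\<Phi> (a * b) = ore_mult q (\<Phi> a) (\<Phi> b)"
  and \<Phi>_one: "\<Phi> 1 = 1"
  and \<Phi>_const: "\<Phi> [:c:] = [:\<iota> c:]"
  using drinfeld
  by (auto simp: drinfeld_rank2_def Ring.ring_hom_def ring_of_type_algebra_def ore_ring_def q_eq)

lemma \<Phi>_T: obtains a2 a3 where "a3 \<noteq> 0" "\<Phi> [:0, 1:] = [:\<gamma> [:0, 1:], a2, a3:]"
  using drinfeld by (auto simp: drinfeld_rank2_def)

lemma \<Phi>_zero [simp]: "\<Phi> 0 = 0"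
  using \<Phi>_add[of 0 0] by (metis add_0 add_cancel_right_right)

lemma \<Phi>_pCons: "\<Phi> (pCons c a) = [:\<iota> c:] + ore_mult q (\<Phi> [:0, 1:]) (\<Phi> a)"
proof -
  have "pCons c a = [:c:] + [:0, 1:] * a" by simp
  then show ?thesis by (metis \<Phi>_add \<Phi>_mult \<Phi>_const)
qed

lemma coeff_0_\<Phi>: "poly.coeff (\<Phi> a) 0 = \<gamma> a"
proof (induction a rule: pCons_induct)
  case 0
  show ?case using \<gamma>_const[of 0] by simp
next
  case (pCons c a)
  obtain a2 a3 where "\<Phi> [:0, 1:] = [:\<gamma> [:0, 1:], a2, a3:]" by (rule \<Phi>_T)
  moreover have "\<gamma> (pCons c a) = \<gamma> [:c:] + \<gamma> [:0, 1:] * \<gamma> a"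
    by (subst \<gamma>_mult[symmetric], subst \<gamma>_add[symmetric]) simp
  ultimately show ?case by (simp add: \<Phi>_pCons[of c a] L.coeff_0_ore_mult pCons \<gamma>_const)
qed

lemma degree_\<Phi>: "a \<noteq> 0 \<Longrightarrow> \<Phi> a \<noteq> 0 \<and> degree (\<Phi> a) = 2 * degree a"
proof (induction a rule: pCons_induct)
  case (pCons c a)
  show ?case
  proof (cases "a = 0")
    case True
    then have "\<iota> c \<noteq> 0" using pCons.prems \<iota>_inj by (metis \<iota>_zero injD pCons_0_0)
    then show ?thesis using True by (simp add: \<Phi>_const)
  next
    case False
    obtain a2 a3 where T: "a3 \<noteq> 0" "\<Phi> [:0, 1:] = [:\<gamma> [:0, 1:], a2, a3:]" by (rule \<Phi>_T)
    have nz: "\<Phi> [:0, 1:] \<noteq> 0" "degree (\<Phi> [:0, 1:]) = 2" using T by auto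
    have d: "degree (ore_mult q (\<Phi> [:0, 1:]) (\<Phi> a)) = 2 + 2 * degree a"
      using L.degree_ore_mult(1)[OF nz(1), of "\<Phi> a"] pCons.IH[OF False] nz(2) by simp
    have "degree (\<Phi> (pCons c a)) = 2 + 2 * degree a"
      unfolding \<Phi>_pCons[of c a] using d by (subst degree_add_eq_right) auto
    then show ?thesis using False by auto
  qed
qed simp

sublocale torsion_module "\<lambda>a x. E (\<Phi> a) x" P
proof
  fix a b :: "'k poly" and x y :: "'l alg_closure"
  show "E (\<Phi> a) (x + y) = E (\<Phi> a) x + E (\<Phi> a) y" by (rule E_add_right)
  show "E (\<Phi> (a + b)) x = E (\<Phi> a) x + E (\<Phi> b) x" by (simp add: \<Phi>_add E_add)
  show "E (\<Phi> a) (E (\<Phi> b) x) = E (\<Phi> (a * b)) x" by (simp add: \<Phi>_mult E_mult)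
  show "E (\<Phi> 1) x = x" by (simp add: \<Phi>_one)
  show "\<exists>y. E (\<Phi> a) y = x" if "a \<noteq> 0" using degree_\<Phi>[OF that] E_surj by metis
  show "card {x. E (\<Phi> a) x = 0} = CARD('k) ^ (2 * degree a)" if "\<not> P dvd a"
  proof -
    have "a \<noteq> 0" using that by auto
    moreover have "poly.coeff (\<Phi> a) 0 \<noteq> 0" using that by (simp add: coeff_0_\<Phi> \<gamma>_kernel)
    ultimately show ?thesis using card_E_kernel degree_\<Phi> q_eq by metis
  qed
  show "finite {x. E (\<Phi> a) x = 0}" if "a \<noteq> 0" using degree_\<Phi>[OF that] E_kernel_bound by blast
  show "card {x. E (\<Phi> P) x = 0} < CARD('k) ^ (2 * degree P)"
    using E_kernel_inseparable[of "\<Phi> P"] degree_\<Phi>[of P] monic_irreducible_nz[OF P_irred]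
    by (simp add: coeff_0_\<Phi> \<gamma>_kernel q_eq)
qed

abbreviation act (infixr \<open>\<star>\<close> 75) where "a \<star> x \<equiv> E (\<Phi> a) x"

lemma act_frobenius: "a \<star> F x = F (a \<star> x)"
  by (rule E_frobenius_commute)

lemma const_act: "[:c:] \<star> x = to_ac (\<iota> c) * x"
  by (simp add: \<Phi>_const)

text \<open>
  The polynomial \<open>u\<close> with kernel \<open>H\<close> has coefficients in \<open>L\<close>, and \<open>u \<Phi>_a\<close> vanishes on \<open>H\<close> and so factors
  through \<open>u\<close>.  The constant coefficient of \<open>\<Psi>_T\<close> is still \<open>\<gamma>(T)\<close> because \<open>u\<close> is separable.
\<close>

lemma isogeny_quotient:
  assumes H: "finite H" "subspace H" and FH: "\<And>x. x \<in> H \<Longrightarrow> F x \<in> H"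
  obtains \<Psi> u where "drinfeld_rank2 \<iota> \<gamma> \<Psi>" "poly.coeff u 0 \<noteq> 0" "\<And>x. E u x = 0 \<longleftrightarrow> x \<in> H"
    "\<And>a x. E (\<Psi> a) (E u x) = E u (a \<star> x)"
proof -
  obtain u :: "'l poly" where u: "poly.coeff u 0 \<noteq> 0" "\<And>x. E u x = 0 \<longleftrightarrow> x \<in> H"
  proof (rule stable_subgroup_polynomial[OF H(1)])
    show "0 \<in> H" using H(2) by (rule subspace_0)
    show "x + y \<in> H" if "x \<in> H" "y \<in> H" for x y using H(2) that by (rule subspace_add)
    show "t * x \<in> H" if t: "t ^ q = t" and x: "x \<in> H" for t x
    proof -
      obtain c where "t = to_ac (\<iota> c)" using power_q_fixed[OF t] .
      then show ?thesis using subspace_scale[OF H(2) x, of "[:c:]"] by (simp add: const_act)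
    qed
  qed (use FH in auto)
  have unz: "u \<noteq> 0" using u(1) by auto
  have "\<exists>g. \<forall>x. E g (E u x) = E u (a \<star> x)" for a
  proof -
    have "E (ore_mult q u (\<Phi> a)) x = 0" if "E u x = 0" for x
      using that u(2) subspace_scale[OF H(2)] by (simp add: E_mult)
    then obtain z where "\<And>x. E (ore_mult q u (\<Phi> a)) x = E z (E u x)"
      using E_right_divide[OF u(1)] by metis
    then show ?thesis by (metis E_mult)
  qed
  then obtain \<Psi> where \<Psi>: "\<And>a x. E (\<Psi> a) (E u x) = E u (a \<star> x)" by metis
  have uniq: "g = h" if "\<And>x. E g (E u x) = E h (E u x)" for g h
    by (rule E_eqI) (metis E_surj[OF unz] that)
  have "\<Psi> (a + b) = \<Psi> a + \<Psi> b" for a b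
    by (rule uniq) (simp add: \<Psi> E_add E_add_right scale_left_distrib)
  moreover have "\<Psi> (a * b) = ore_mult q (\<Psi> a) (\<Psi> b)" for a b
    by (rule uniq) (simp add: \<Psi> E_mult)
  moreover have "\<Psi> 1 = 1"
    by (rule uniq) (simp add: \<Psi>)
  ultimately have "\<Psi> \<in> Ring.ring_hom A_ring (ore_ring CARD('k))"
    by (simp add: Ring.ring_hom_def ring_of_type_algebra_def ore_ring_def q_eq)
  moreover have "\<Psi> [:c:] = [:\<iota> c:]" for c
  proof (rule uniq)
    fix x
    have "E u (to_ac (\<iota> c) * x) = to_ac (\<iota> c) * E u x"
      by (simp add: ore_eval_ac_def ore_eval_def power_mult_distrib \<iota>_frobenius sum_distrib_left
        mult.left_commute flip: to_ac_power)
    then show "E (\<Psi> [:c:]) (E u x) = E [:\<iota> c:] (E u x)" by (simp add: \<Psi> const_act)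
  qed
  moreover have "\<exists>a2 a3. a3 \<noteq> 0 \<and> \<Psi> [:0, 1:] = [:\<gamma> [:0, 1:], a2, a3:]"
  proof -
    let ?T = "[:0, 1:] :: 'k poly"
    have eq: "ore_mult q (\<Psi> ?T) u = ore_mult q u (\<Phi> ?T)"
      by (rule E_eqI) (simp add: E_mult \<Psi>)
    have \<Phi>T: "\<Phi> ?T \<noteq> 0" "degree (\<Phi> ?T) = 2" using degree_\<Phi>[of ?T] by auto
    have nz: "\<Psi> ?T \<noteq> 0"
    proof
      assume "\<Psi> ?T = 0"
      then have "ore_mult q u (\<Phi> ?T) = 0" using eq by (simp add: ore_mult_def)
      then show False using L.degree_ore_mult(2)[OF unz \<Phi>T(1)] by simp
    qed
    have deg: "degree (\<Psi> ?T) = 2"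
      using L.degree_ore_mult(1)[OF nz unz] L.degree_ore_mult(1)[OF unz \<Phi>T(1)] eq \<Phi>T(2) by simp
    have "poly.coeff (\<Psi> ?T) 0 * poly.coeff u 0 = poly.coeff u 0 * \<gamma> ?T"
      using arg_cong[OF eq, of "\<lambda>f. poly.coeff f 0"] by (simp add: L.coeff_0_ore_mult coeff_0_\<Phi>)
    then have c0: "poly.coeff (\<Psi> ?T) 0 = \<gamma> ?T" using u(1) by simp
    have "\<Psi> ?T = [:poly.coeff (\<Psi> ?T) 0, poly.coeff (\<Psi> ?T) 1, poly.coeff (\<Psi> ?T) 2:]"
    proof (rule poly_eqI)
      fix i
      show "poly.coeff (\<Psi> ?T) i = poly.coeff [:poly.coeff (\<Psi> ?T) 0, poly.coeff (\<Psi> ?T) 1, poly.coeff (\<Psi> ?T) 2:] i"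
        using coeff_eq_0[of "\<Psi> ?T" i] deg by (auto simp: coeff_pCons numeral_2_eq_2 split: nat.split)
    qed
    then show ?thesis using c0 nz deg by (metis leading_coeff_neq_0)
  qed
  ultimately have "drinfeld_rank2 \<iota> \<gamma> \<Psi>" unfolding drinfeld_rank2_def by blast
  then show ?thesis using that u \<Psi> by blast
qed

lemma A_ideal_eq: "A_ideal a = {b * a | b. True}"
  by (auto simp: cgenideal_def ring_of_type_algebra_def)

lemma drinfeld_torsion_eq: "drinfeld_torsion \<Phi> (A_ideal a) = {x. a \<star> x = 0}"
proof -
  have "a \<in> A_ideal a" unfolding A_ideal_eq by (metis (mono_tags, lifting) CollectI mult_1)
  moreover have "b \<star> x = 0" if "a \<star> x = 0" "b \<in> A_ideal a" for b x
    using that scale_dvd_zero[of a x b] unfolding A_ideal_eq by auto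
  ultimately show ?thesis unfolding drinfeld_torsion_def q_eq[symmetric] by blast
qed

lemma ordinary_iff: "ordinary \<Phi> P \<longleftrightarrow> (\<exists>x. x \<noteq> 0 \<and> P \<star> x = 0)"
  unfolding supersingular_def drinfeld_torsion_eq using E_zero_right[of "\<Phi> P"] by blast

text \<open>
  The scalar \<open>a\<close> may be reduced modulo \<open>f\<close>.  If \<open>f\<close> had larger degree than \<open>g\<close>, then \<open>g - \<Phi>_a\<close> would have
  smaller degree than its divisor \<open>\<Phi>_f\<close>.
\<close>

lemma multiplier_bounded:
  assumes "\<And>a. g \<noteq> \<Phi> a" and f: "f \<noteq> 0" and eq: "g - \<Phi> a = ore_mult q z (\<Phi> f)"
  shows "degree f \<le> degree g"
proof (rule ccontr)
  assume *: "\<not> degree f \<le> degree g"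
  define b where "b = a mod f"
  define z' where "z' = z + \<Phi> (a div f)"
  have "g - \<Phi> b = ore_mult q z' (\<Phi> f)"
  proof -
    have "\<Phi> a = \<Phi> (a div f * f + b)" unfolding b_def by simp
    then have "\<Phi> a = ore_mult q (\<Phi> (a div f)) (\<Phi> f) + \<Phi> b" by (simp only: \<Phi>_add \<Phi>_mult)
    then show ?thesis using eq by (simp add: z'_def L.ore_mult_add_left algebra_simps)
  qed
  moreover have "z' \<noteq> 0"
  proof
    assume "z' = 0"
    then have "g = \<Phi> b" using \<open>g - \<Phi> b = ore_mult q z' (\<Phi> f)\<close> by (simp add: ore_mult_def)
    then show False using assms(1) by blast
  qed
  ultimately have "degree (g - \<Phi> b) \<ge> 2 * degree f"
    using L.degree_ore_mult(1)[of z' "\<Phi> f"] degree_\<Phi>[OF f] by simp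
  moreover have "degree (g - \<Phi> b) < 2 * degree f"
  proof -
    have "b = 0 \<or> degree b < degree f" unfolding b_def by (rule degree_mod_less[OF f])
    then have "degree (\<Phi> b) < 2 * degree f" using * by (cases "b = 0") (auto simp: degree_\<Phi>)
    then show ?thesis using * by (intro degree_diff_less) auto
  qed
  ultimately show False by simp
qed

text \<open>
  The constant coefficient \<open>\<gamma>(a)\<close> of \<open>\<tau>^n\<close> is zero, so \<open>P\<close> divides \<open>a\<close> and \<open>\<Phi>_a\<close> kills the \<open>P\<close>-torsion,
  whereas \<open>\<tau>^n\<close> is injective.
\<close>

lemma ordinary_frobenius_not_scalar:
  assumes "ordinary \<Phi> P"
  shows "Polynomial.monom 1 n \<noteq> \<Phi> a"
proof
  assume eq: "Polynomial.monom 1 n = \<Phi> a"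
  obtain x where x: "x \<noteq> 0" "P \<star> x = 0" using assms ordinary_iff by blast
  have "\<gamma> a = 0" using coeff_0_\<Phi>[of a] n_pos by (simp flip: eq)
  then have "a \<star> x = 0" using scale_dvd_zero[OF x(2)] by (simp add: \<gamma>_kernel)
  then have "F x = 0" by (simp add: E_monom flip: eq)
  then show False using x(1) by simp
qed

end

section \<open>Moving inside the isogeny class\<close>

context drinfeld_module
begin

lemma E_frobenius_minus_one: "E (Polynomial.monom 1 n - 1) x = F x - x"
  by (simp add: E_diff E_monom)

lemma frobenius_minus_one_quadratic:
  assumes "\<And>x. F (F x) - c \<star> F x + D \<star> x = 0"
  shows "F (F x - x) - (F x - x) = (c - 2) \<star> (F x - x) - (1 - c + D) \<star> x"
proof -
  have two: "(2 :: 'k poly) \<star> y = y + y" for y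
    using scale_left_distrib[of 1 1 y] by simp
  have "F (F x) = (F (F x) - c \<star> F x + D \<star> x) + (c \<star> F x - D \<star> x)" by simp
  then have "F (F x) = c \<star> F x - D \<star> x" by (simp only: assms add_0)
  then show ?thesis
    by (simp add: frob_diff scale_left_diff_distrib scale_left_distrib scale_right_diff_distrib two)
qed

text \<open>
  An isogeny is onto and commutes with \<open>F\<close>, and if its kernel is killed by some \<open>f\<close> prime to \<open>P\<close> it is injective on the
  \<open>P\<close>-torsion.
\<close>

lemma isogeny_transfer:
  assumes \<Psi>: "drinfeld_rank2 \<iota> \<gamma> \<Psi>"
    and u: "poly.coeff u 0 \<noteq> 0" "\<And>x. E u x = 0 \<longleftrightarrow> x \<in> H" "\<And>a x. E (\<Psi> a) (E u x) = E u (a \<star> x)"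
    and f: "\<not> P dvd f" "\<And>x. x \<in> H \<Longrightarrow> f \<star> x = 0"
  shows "ordinary \<Phi> P \<Longrightarrow> ordinary \<Psi> P"
    and "(\<And>x. F (F x) - c \<star> F x + D \<star> x = 0) \<Longrightarrow> F (F y) - E (\<Psi> c) (F y) + E (\<Psi> D) y = 0"
proof -
  interpret Psi: drinfeld_module q field_type n \<iota> \<gamma> P \<Psi>
    by unfold_locales (rule \<Psi>)
  have "u \<noteq> 0" using u(1) by auto
  {
    assume "ordinary \<Phi> P"
    then obtain x where x: "x \<noteq> 0" "P \<star> x = 0" using ordinary_iff by blast
    have "coprime P f" using monic_irreducible_coprime f(1) P_irred by blast
    then have "x \<notin> H" using x f(2) coprime_torsion_zero by blast
    then have "E u x \<noteq> 0" using u(2) by blast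
    moreover have "E (\<Psi> P) (E u x) = 0" using u(3) x(2) by simp
    ultimately show "ordinary \<Psi> P" using Psi.ordinary_iff by blast
  next
    assume eq: "\<And>x. F (F x) - c \<star> F x + D \<star> x = 0"
    obtain x where y: "y = E u x" using E_surj[OF \<open>u \<noteq> 0\<close>] by metis
    have "F (F y) - E (\<Psi> c) (F y) + E (\<Psi> D) y = E u (F (F x) - c \<star> F x + D \<star> x)"
      unfolding y by (simp only: E_add_right E_diff_right u(3) E_frobenius_commute[symmetric])
    then show "F (F y) - E (\<Psi> c) (F y) + E (\<Psi> D) y = 0" by (simp only: eq E_zero_right)
  }
qed

text \<open>
  As \<open>i\<close> is prime to \<open>P\<close>, \<open>\<Phi>_i\<close> is separable, and by assumption \<open>F - 1\<close> vanishes on its kernel.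
\<close>

lemma frobenius_quotient_exists:
  assumes i: "\<not> P dvd i" and rational: "\<And>x. i \<star> x = 0 \<Longrightarrow> F x = x"
  obtains y where "\<And>x. E y (i \<star> x) = F x - x"
proof -
  have "poly.coeff (\<Phi> i) 0 \<noteq> 0" using i by (simp add: coeff_0_\<Phi> \<gamma>_kernel)
  moreover have "E (Polynomial.monom 1 n - 1) x = 0" if "i \<star> x = 0" for x
    using rational[OF that] unfolding E_frobenius_minus_one by simp
  ultimately obtain y where "\<And>x. E (Polynomial.monom 1 n - 1) x = E y (i \<star> x)"
    using E_right_divide by metis
  then show ?thesis using that unfolding E_frobenius_minus_one by metis
qed

lemma frobenius_quotient_commute:
  assumes i: "i \<noteq> 0" and y: "\<And>x. E y (i \<star> x) = F x - x"
  shows "E y (a \<star> x) = a \<star> E y x"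
proof -
  obtain x' where x: "x = i \<star> x'" using act_surj[OF i] by metis
  have "E y (a \<star> x) = E y (i \<star> (a \<star> x'))" by (simp add: x mult.commute)
  also have "\<dots> = a \<star> (F x' - x')" by (simp only: y act_frobenius scale_right_diff_distrib)
  finally show ?thesis by (simp only: x y)
qed

text \<open>
  Divide by the rational \<open>i\<close>-torsion \<open>H\<close>.  A point that \<open>i\<close> takes into \<open>H\<close> is taken into \<open>H\<close> by \<open>F - 1\<close> as
  well: \<open>i (F - 1) x = (F - 1) (i x) = 0\<close>, and \<open>(F - 1)^2 x\<close> is a combination of \<open>(F - 1) (i x)\<close> and
  \<open>i (i x)\<close>, which both vanish.
\<close>

lemma rational_torsion_isogeny:
  assumes ord: "ordinary \<Phi> P" and eq: "\<And>x. F (F x) - c \<star> F x + D \<star> x = 0"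
    and i: "\<not> P dvd i" "c - 2 = t * i" "1 - c + D = s * i * i"
  obtains \<Psi> where "drinfeld_rank2 \<iota> \<gamma> \<Psi>" "ordinary \<Psi> P"
    "\<And>x. F (F x) - E (\<Psi> c) (F x) + E (\<Psi> D) x = 0" "\<And>x. E (\<Psi> i) x = 0 \<Longrightarrow> F x = x"
proof -
  have inz: "i \<noteq> 0" using i(1) by auto
  define H where "H = {x. i \<star> x = 0 \<and> F x = x}"
  have fin: "finite H" unfolding H_def by (rule finite_subset[OF _ finite_torsion[OF inz]]) auto
  have sub: "subspace H"
  proof (rule subspaceI)
    show "0 \<in> H" using q_ge_2 by (simp add: H_def)
    show "x + y \<in> H" if "x \<in> H" "y \<in> H" for x y
      using that by (simp add: H_def scale_right_distrib frob_add)
    show "a \<star> x \<in> H" if "x \<in> H" for a x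
      using that scale_dvd_zero[of i x "i * a"] by (simp add: H_def flip: act_frobenius)
  qed
  have FH: "F x \<in> H" if "x \<in> H" for x using that by (simp add: H_def)
  obtain \<Psi> u where \<Psi>: "drinfeld_rank2 \<iota> \<gamma> \<Psi>" and u: "poly.coeff u 0 \<noteq> 0" "\<And>x. E u x = 0 \<longleftrightarrow> x \<in> H"
    "\<And>a x. E (\<Psi> a) (E u x) = E u (a \<star> x)"
    using isogeny_quotient[OF fin sub FH] by blast
  note tr = isogeny_transfer[OF \<Psi> u i(1)]
  have kill: "i \<star> x = 0" if "x \<in> H" for x using that by (simp add: H_def)
  have "F x = x" if x: "E (\<Psi> i) x = 0" for x
  proof -
    have "u \<noteq> 0" using u(1) by auto
    then obtain x' where x': "x = E u x'" using E_surj by metis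
    have "i \<star> x' \<in> H" using x unfolding x' u(3) u(2) .
    then have ix: "i \<star> (i \<star> x') = 0" "F (i \<star> x') = i \<star> x'" unfolding H_def by auto
    define g where "g = F x' - x'"
    have ig: "i \<star> g = 0" unfolding g_def using ix(2) by (simp add: scale_right_diff_distrib act_frobenius)
    have "F g - g = (t * i) \<star> g - (s * i * i) \<star> x'"
      using frobenius_minus_one_quadratic[OF eq, of x'] unfolding g_def i(2,3) .
    also have "\<dots> = t \<star> (i \<star> g) - s \<star> (i \<star> (i \<star> x'))" by (simp add: mult.assoc)
    also have "\<dots> = 0" using ig ix(1) by (simp del: scale_scale)
    finally have "g \<in> H" using ig by (simp add: H_def)
    then have "E u (F x' - x') = 0" using u(2) g_def by blast
    then show ?thesis by (simp add: x' E_diff_right E_frobenius_commute)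
  qed
  then show ?thesis using that \<Psi> tr(1)[OF kill ord] tr(2)[OF kill eq] by blast
qed

text \<open>
  Write \<open>y = (F - 1)/i\<close> as \<open>a + f z\<close> with \<open>f\<close> prime to \<open>P\<close> of the largest degree and divide by \<open>A v\<close>, where
  the \<open>f\<close>-torsion point \<open>v\<close> is chosen such that \<open>z\<close> does not preserve the \<open>Q\<close>-torsion of \<open>A v\<close> for any
  prime \<open>Q\<close> dividing \<open>f\<close>.
\<close>

lemma cyclic_frobenius_isogeny:
  assumes ord: "ordinary \<Phi> P" and eq: "\<And>x. F (F x) - c \<star> F x + D \<star> x = 0"
    and i: "\<not> P dvd i" and rational: "\<And>x. i \<star> x = 0 \<Longrightarrow> F x = x"
  obtains \<Psi> y' where "drinfeld_rank2 \<iota> \<gamma> \<Psi>" "ordinary \<Psi> P"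
    "\<And>x. F (F x) - E (\<Psi> c) (F x) + E (\<Psi> D) x = 0" "\<And>x. E y' (E (\<Psi> i) x) = F x - x"
    "\<And>Q. monic_irreducible Q \<Longrightarrow> Q \<noteq> P \<Longrightarrow> \<exists>x. E (\<Psi> Q) x = 0 \<and> E y' x \<noteq> 0"
proof -
  have inz: "i \<noteq> 0" using i by auto
  obtain y where y: "\<And>x. E y (i \<star> x) = F x - x" using frobenius_quotient_exists[OF i rational] by blast
  have y_comm: "E y (a \<star> x) = a \<star> E y x" for a x by (rule frobenius_quotient_commute[OF inz y])
  have nP: "\<not> P dvd Q" if "monic_irreducible Q" "Q \<noteq> P" for Q
    using monic_irreducible_dvd_eq[OF P_irred that(1)] that(2) by blast
  have y_not_scalar: "y \<noteq> \<Phi> a" for a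
  proof
    assume "y = \<Phi> a"
    then have "F x = (a * i + 1) \<star> x" for x using y[of x] by (simp add: scale_left_distrib algebra_simps)
    then have "Polynomial.monom 1 n = \<Phi> (a * i + 1)" by (intro E_eqI) (simp add: E_monom)
    then show False using ordinary_frobenius_not_scalar[OF ord] by blast
  qed
  \<comment> \<open>Phrased through torsion points, which is easier to verify; by separability it is equivalent to a decomposition
    \<open>y = a + f z\<close>.\<close>
  define scalar where "scalar = (\<lambda>f. \<not> P dvd f \<and> (\<exists>a. \<forall>x. f \<star> x = 0 \<longrightarrow> E y x = a \<star> x))"
  have scalar_div: "\<exists>a z. \<forall>x. E y x = a \<star> x + E z (f \<star> x)" if "scalar f" for f
  proof -
    obtain a where a: "\<And>x. f \<star> x = 0 \<Longrightarrow> E y x = a \<star> x" using \<open>scalar f\<close> unfolding scalar_def by blast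
    have "poly.coeff (\<Phi> f) 0 \<noteq> 0" using that by (simp add: scalar_def coeff_0_\<Phi> \<gamma>_kernel)
    moreover have "E (y - \<Phi> a) x = 0" if "f \<star> x = 0" for x using a[OF that] by (simp add: E_diff)
    ultimately obtain z where z: "\<And>x. E (y - \<Phi> a) x = E z (f \<star> x)" by (rule E_right_divide) blast+
    have "E y x = a \<star> x + E z (f \<star> x)" for x using z[of x] by (simp add: E_diff algebra_simps)
    then show ?thesis by blast
  qed
  have bound: "degree f \<le> degree y" if "scalar f" for f
  proof -
    have fnz: "f \<noteq> 0" using \<open>scalar f\<close> by (auto simp: scalar_def)
    obtain a z where "\<And>x. E y x = a \<star> x + E z (f \<star> x)" using scalar_div[OF \<open>scalar f\<close>] by blast
    then have "y - \<Phi> a = ore_mult q z (\<Phi> f)" by (intro E_eqI) (simp add: E_diff E_mult)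
    then show ?thesis using multiplier_bounded[OF y_not_scalar fnz] by blast
  qed
  have "scalar 1"
    using P_irred unfolding scalar_def monic_irreducible_def irreducible_def by auto
  then have "\<exists>f. scalar f \<and> (\<forall>f'. scalar f' \<longrightarrow> degree f' \<le> degree f)"
    by (rule ex_has_greatest_nat[of scalar 1 degree "degree y + 1"])
      (use bound in \<open>auto simp: less_Suc_eq_le\<close>)
  then obtain f where f: "scalar f" and max: "\<And>f'. scalar f' \<Longrightarrow> degree f' \<le> degree f" by blast
  have fP: "\<not> P dvd f" using f by (simp add: scalar_def)
  then have fnz: "f \<noteq> 0" by auto
  obtain a z where z: "\<And>x. E y x = a \<star> x + E z (f \<star> x)" using scalar_div[OF f] by blast
  have z_comm: "E z (b \<star> x) = b \<star> E z x" for b x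
  proof -
    obtain x' where x: "x = f \<star> x'" using act_surj[OF fnz] by metis
    have zf: "E z (f \<star> x) = E y x - a \<star> x" for x using z[of x] by simp
    have "E z (b \<star> x) = E z (f \<star> (b \<star> x'))" by (simp add: x mult.commute)
    also have "\<dots> = b \<star> (E y x' - a \<star> x')"
      by (simp only: zf y_comm scale_right_diff_distrib) (simp add: mult.commute)
    finally show ?thesis by (simp only: x zf)
  qed
  have not_bigger: False if "scalar (Q * f)" "monic_irreducible Q" for Q
    using max[OF that(1)] monic_irreducible_degree[OF that(2)] monic_irreducible_nz[OF that(2)] fnz
    by (simp add: degree_mult_eq)
  have PQf: "\<not> P dvd Q * f" if "monic_irreducible Q" "Q \<noteq> P" for Q
    using irreducible_poly_dvd_mult[of P Q f] P_irred nP[OF that] fP unfolding monic_irreducible_def by blast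
  \<comment> \<open>If every point of a plane is an eigenvector, then \<open>v\<close>, \<open>w\<close> and \<open>v + w\<close> share one
    eigenvalue \<open>\<delta>\<close>, and \<open>y = (a + \<delta> f) + (Q f) z'\<close> contradicts maximality.\<close>
  have nonscalar: "\<exists>v. Q \<star> v = 0 \<and> E z v \<notin> range (\<lambda>a. a \<star> v)" if Q: "monic_irreducible Q" "Q \<noteq> P" for Q
  proof (rule ccontr)
    assume "\<not> ?thesis"
    then have eig: "\<exists>\<alpha>. E z v = \<alpha> \<star> v" if "Q \<star> v = 0" for v using that by blast
    obtain v where v: "Q \<star> v = 0" "v \<notin> range (\<lambda>a. a \<star> 0)"
      using irreducible_torsion_not_cyclic[OF Q(1) nP[OF Q], of 0] by auto
    then have vnz: "v \<noteq> 0" by auto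
    obtain w where w: "Q \<star> w = 0" "w \<notin> range (\<lambda>a. a \<star> v)"
      using irreducible_torsion_not_cyclic[OF Q(1) nP[OF Q] v(1)] by blast
    note indep = irreducible_torsion_independent[OF Q(1) vnz v(1) w]
    obtain \<alpha> \<beta> \<delta> where e: "E z v = \<alpha> \<star> v" "E z w = \<beta> \<star> w" "E z (v + w) = \<delta> \<star> (v + w)"
      using eig[OF v(1)] eig[OF w(1)] eig[of "v + w"] v(1) w(1) by (auto simp: scale_right_distrib)
    have "(\<delta> - \<alpha>) \<star> v + (\<delta> - \<beta>) \<star> w = \<delta> \<star> (v + w) - (\<alpha> \<star> v + \<beta> \<star> w)"
      by (simp add: scale_left_diff_distrib scale_right_distrib)
    also have "\<dots> = 0" by (simp only: e(3)[symmetric]) (simp only: E_add_right e(1,2) diff_self)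
    finally have "Q dvd \<delta> - \<alpha>" "Q dvd \<delta> - \<beta>" using indep by blast+
    then have "(\<delta> - \<alpha>) \<star> v = 0" "(\<delta> - \<beta>) \<star> w = 0"
      using scale_dvd_zero v(1) w(1) by blast+
    then have e': "E z v = \<delta> \<star> v" "E z w = \<delta> \<star> w" using e by (simp_all add: scale_left_diff_distrib)
    have "E z x = \<delta> \<star> x" if Qx: "Q \<star> x = 0" for x
    proof -
      obtain b c where x: "x = b \<star> v + c \<star> w"
        using torsion_spanned[OF nP[OF Q] v(1) w(1) indep Qx] by blast
      have "E z x = b \<star> (\<delta> \<star> v) + c \<star> (\<delta> \<star> w)" by (simp only: x E_add_right z_comm e')
      then show ?thesis by (simp add: x scale_right_distrib mult.commute)
    qed
    then have "E y x = (a + \<delta> * f) \<star> x" if "(Q * f) \<star> x = 0" for x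
      using z[of x] that by (simp add: scale_left_distrib)
    then have "scalar (Q * f)" unfolding scalar_def using PQf[OF Q] by blast
    then show False using not_bigger Q(1) by blast
  qed
  have QnP: "Q \<noteq> P" if "Q dvd f" for Q using that fP by auto
  define w where "w = (\<lambda>Q. SOME v. Q \<star> v = 0 \<and> E z v \<notin> range (\<lambda>a. a \<star> v))"
  have w: "Q \<star> w Q = 0" "E z (w Q) \<notin> range (\<lambda>a. a \<star> w Q)" if "monic_irreducible Q" "Q dvd f" for Q
    using someI_ex[OF nonscalar[OF that(1) QnP[OF that(2)]]] unfolding w_def by blast+
  have wnz: "w Q \<noteq> 0" if "monic_irreducible Q" "Q dvd f" for Q
    using w(2)[OF that] by force
  obtain v where v: "f \<star> v = 0"
    and vQ: "\<And>Q. monic_irreducible Q \<Longrightarrow> Q dvd f \<Longrightarrow> \<exists>g. \<not> Q dvd g \<and> (f div Q) \<star> v = g \<star> w Q"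
    using glue_prime_torsion[OF fnz, of w] w(1) by blast
  have v_order: "has_order v f"
    by (rule glued_order_modulo[where w = w]) (use fnz v vQ w wnz in auto)
  define H where "H = range (\<lambda>a. a \<star> v)"
  have sub: "subspace H" unfolding H_def by (rule subspace_cyclic)
  have fin: "finite H" unfolding H_def by (rule card_cyclic(2)[OF v_order])
  have kill: "f \<star> x = 0" if "x \<in> H" for x
    using that scale_dvd_zero[OF v] unfolding H_def by auto
  have yv: "E y v = a \<star> v" using z[of v] v by simp
  have yH: "E y x \<in> H" if "x \<in> H" for x
  proof -
    obtain b where b: "x = b \<star> v" using \<open>x \<in> H\<close> unfolding H_def by blast
    have "E y x = b \<star> (a \<star> v)" by (simp only: b y_comm yv)
    then show ?thesis unfolding H_def by auto
  qed
  have FH: "F x \<in> H" if "x \<in> H" for x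
  proof -
    have "F x = x + i \<star> E y x" using y[of x] by (simp only: y_comm[symmetric]) simp
    then show ?thesis using yH[OF that] that sub by (simp add: subspace_add subspace_scale)
  qed
  \<comment> \<open>The \<open>Q\<close>-torsion of \<open>H\<close> is the line through \<open>(f/Q) v = g (w Q)\<close>, and
    \<open>w Q\<close> is no eigenvector.\<close>
  have z_escape: "(f div Q) \<star> E z v \<notin> H" if Q: "monic_irreducible Q" "Q dvd f" for Q
  proof
    assume "(f div Q) \<star> E z v \<in> H"
    then obtain b where b: "(f div Q) \<star> E z v = b \<star> v" unfolding H_def by blast
    obtain g where g: "\<not> Q dvd g" "(f div Q) \<star> v = g \<star> w Q" using vQ[OF Q] by blast
    have f': "f = Q * (f div Q)" "f div Q \<noteq> 0" using Q(2) fnz by auto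
    have zg: "g \<star> E z (w Q) = b \<star> v" using b g(2) by (metis z_comm)
    have "(Q * b) \<star> v = Q \<star> (g \<star> E z (w Q))" using zg by simp
    also have "\<dots> = g \<star> E z (Q \<star> w Q)" by (simp only: z_comm) (simp add: mult.commute)
    also have "\<dots> = 0" using w(1)[OF Q] by simp
    finally have "f dvd Q * b" using has_orderD(3)[OF v_order] by blast
    then have "Q * (f div Q) dvd Q * b" using f'(1) by simp
    then have "f div Q dvd b" using monic_irreducible_nz[OF Q(1)] by simp
    then obtain b' where b': "b = b' * (f div Q)" by (auto simp: dvd_def mult.commute)
    have "b \<star> v = b' \<star> ((f div Q) \<star> v)" by (simp add: b')
    then have "g \<star> E z (w Q) = b' \<star> (g \<star> w Q)" using zg g(2) by simp
    then have gz: "g \<star> E z (w Q) \<in> range (\<lambda>a. a \<star> w Q)" by auto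
    have "Q \<star> E z (w Q) = 0" using w(1)[OF Q] by (simp flip: z_comm)
    then have Qz: "Q \<star> E z (w Q) \<in> range (\<lambda>a. a \<star> w Q)" using subspace_0[OF subspace_cyclic] by simp
    have "coprime Q g" using monic_irreducible_coprime g(1) Q(1) by blast
    then show False using coprime_scale_mem[OF _ Qz gz subspace_cyclic] w(2)[OF Q] by blast
  qed
  obtain \<Psi> u where \<Psi>: "drinfeld_rank2 \<iota> \<gamma> \<Psi>" and u: "poly.coeff u 0 \<noteq> 0" "\<And>x. E u x = 0 \<longleftrightarrow> x \<in> H"
    "\<And>a x. E (\<Psi> a) (E u x) = E u (a \<star> x)"
    using isogeny_quotient[OF fin sub FH] by blast
  interpret Psi: drinfeld_module q field_type n \<iota> \<gamma> P \<Psi>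
    by unfold_locales (rule \<Psi>)
  note tr = isogeny_transfer[OF \<Psi> u fP kill]
  have unz: "u \<noteq> 0" using u(1) by auto
  have "F p = p" if p: "E (\<Psi> i) p = 0" for p
  proof -
    obtain x where x: "p = E u x" using E_surj[OF unz] by metis
    have "i \<star> x \<in> H" using p unfolding x u(3) u(2) .
    then have "F x - x \<in> H" using yH y by metis
    then have "E u (F x - x) = 0" using u(2) by blast
    then show ?thesis by (simp add: x E_diff_right E_frobenius_commute)
  qed
  then obtain y' where y': "\<And>x. E y' (E (\<Psi> i) x) = F x - x"
    using Psi.frobenius_quotient_exists[OF i] by blast
  have y'u: "E y' (E u x) = E u (E y x)" for x
  proof -
    obtain x' where x: "x = i \<star> x'" using act_surj[OF inz] by metis
    have "E y' (E u x) = F (E u x') - E u x'" by (simp only: x u(3)[symmetric] y')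
    also have "\<dots> = E u (E y x)" by (simp only: x y E_diff_right E_frobenius_commute)
    finally show ?thesis .
  qed
  have "\<exists>p. E (\<Psi> Q) p = 0 \<and> E y' p \<noteq> 0" if Q: "monic_irreducible Q" "Q \<noteq> P" for Q
  proof (rule ccontr)
    assume contr: "\<not> ?thesis"
    \<comment> \<open>\<open>y'\<close> vanishing on the \<open>Q\<close>-torsion of the quotient means that \<open>y\<close> takes into
      \<open>H\<close> what \<open>Q\<close> takes into \<open>H\<close>.\<close>
    have yx: "E y x \<in> H" if "Q \<star> x \<in> H" for x
      using contr that u(2) u(3)[of Q x] y'u[of x] by metis
    have Qnz: "Q \<noteq> 0" by (rule monic_irreducible_nz[OF Q(1)])
    show False
    proof (cases "Q dvd f")
      case True
      \<comment> \<open>At a \<open>Q\<close>-division point \<open>x\<close> of \<open>v\<close> this forces \<open>Q\<close> to divide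
        \<open>a\<close>, so that \<open>y x - a x = (f/Q) z v\<close> lies in \<open>H\<close>.\<close>
      obtain x where x: "Q \<star> x = v" using act_surj[OF Qnz] by metis
      have f': "f = (f div Q) * Q" "f div Q \<noteq> 0" using True fnz by auto
      have fx: "f \<star> x = (f div Q) \<star> v" using x f'(1) by (metis scale_scale)
      have v_in: "v \<in> H" unfolding H_def by (metis rangeI scale_one)
      then have yxH: "E y x \<in> H" using yx x by simp
      have "f \<star> E y x = (f div Q) \<star> (Q \<star> E y x)" using f'(1) by (metis scale_scale)
      also have "\<dots> = (f div Q) \<star> E y v" by (simp only: x[symmetric] y_comm)
      also have "\<dots> = ((f div Q) * a) \<star> v" by (simp add: yv)
      finally have "f dvd (f div Q) * a" using kill[OF yxH] has_orderD(3)[OF v_order] by metis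
      then have "(f div Q) * Q dvd (f div Q) * a" using f'(1) by simp
      then have "Q dvd a" using f'(2) by simp
      then obtain a' where "a = a' * Q" by (auto simp: dvd_def mult.commute)
      then have ax: "a \<star> x = a' \<star> v" using x by (metis scale_scale)
      have "E y x - a \<star> x \<in> H"
        using yxH v_in sub unfolding ax by (simp add: subspace_diff subspace_scale)
      moreover have "E y x - a \<star> x = (f div Q) \<star> E z v" by (simp only: z fx z_comm) simp
      ultimately show False using z_escape[OF Q(1) True] by simp
    next
      case False
      have cop: "coprime Q f" using monic_irreducible_coprime Q(1) False by blast
      have y0: "E y x = 0" if "Q \<star> x = 0" for x
      proof (rule coprime_torsion_zero[OF cop])
        show "Q \<star> E y x = 0" using that by (simp flip: y_comm)
        show "f \<star> E y x = 0" using that subspace_0[OF sub] by (intro kill yx) simp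
      qed
      \<comment> \<open>Here \<open>y\<close> is \<open>0\<close> on the \<open>Q\<close>-torsion and \<open>a\<close> on the
        \<open>f\<close>-torsion, hence a scalar on the \<open>Q f\<close>-torsion.\<close>
      obtain r r' where r: "r * Q + r' * f = 1" using coprime_poly_bezout[OF cop] .
      have "E y x = (r * Q * a) \<star> x" if "(Q * f) \<star> x = 0" for x
      proof -
        have "x = (r * Q + r' * f) \<star> x" using r by simp
        then have xs: "x = r \<star> (Q \<star> x) + r' \<star> (f \<star> x)" by (simp add: scale_left_distrib)
        have "f \<star> (Q \<star> x) = 0" "Q \<star> (f \<star> x) = 0" using that by (simp_all add: mult.commute)
        then have "E y (Q \<star> x) = a \<star> (Q \<star> x)" "E y (f \<star> x) = 0"
          using z[of "Q \<star> x"] y0 by (simp_all del: scale_scale)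
        then have "E y x = r \<star> (a \<star> (Q \<star> x))"
          by (subst xs) (simp only: E_add_right y_comm E_zero_right add_0_right)
        then show ?thesis by (simp add: ac_simps)
      qed
      then have "scalar (Q * f)" unfolding scalar_def using PQf[OF Q] by blast
      then show False using not_bigger Q(1) by blast
    qed
  qed
  then show ?thesis using that \<Psi> tr(1)[OF _ ord] tr(2)[OF _ eq] y' by blast
qed

end

section \<open>The module of rational points\<close>

lemma dvd_degree_imp_dvd:
  fixes e m :: "'k::field poly"
  assumes "e dvd m" "m \<noteq> 0" "degree m \<le> degree e"
  shows "m dvd e"
proof -
  obtain r where r: "m = e * r" using assms(1) by (auto simp: dvd_def)
  then have nz: "e \<noteq> 0" "r \<noteq> 0" using assms(2) by auto
  then have "degree r = 0" using assms(3) r by (simp add: degree_mult_eq)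
  then have "is_unit r" using nz is_unit_iff_degree by blast
  then show ?thesis using r by (simp add: mult_unit_dvd_iff)
qed

context torsion_module
begin

text \<open>
  For every prime power \<open>Q^k\<close> dividing \<open>f\<close> there is a point of order \<open>Q^k\<close>.
\<close>

lemma torsion_annihilator_dvd:
  assumes f: "\<not> P dvd f" "e \<noteq> 0" and kill: "\<And>x. f \<star> x = 0 \<Longrightarrow> e \<star> x = 0"
    and P: "monic_irreducible P"
  shows "f dvd e"
proof (rule ccontr)
  assume "\<not> f dvd e"
  moreover have "f \<noteq> 0" using f(1) by auto
  ultimately obtain Q i e' f' where Q: "monic_irreducible Q" "e = Q ^ i * e'" "\<not> Q dvd e'" "f = Q ^ Suc i * f'"
    using not_dvd_prime_power_witness[OF f(2)] by blast
  have "Q dvd f" using Q(4) by simp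
  then have "Q \<noteq> P" using f(1) by blast
  then have "\<not> P dvd Q" using monic_irreducible_dvd_eq[OF P Q(1)] by blast
  then obtain v w :: "nat \<Rightarrow> 'b" where v: "Q ^ Suc i \<star> v (Suc i) = 0"
    and indep: "\<And>a b. a \<star> v (Suc i) + b \<star> w (Suc i) = 0 \<Longrightarrow> Q ^ Suc i dvd a \<and> Q ^ Suc i dvd b"
    using prime_power_torsion_basis[OF Q(1)] by metis
  have "f \<star> v (Suc i) = 0" by (rule scale_dvd_zero[OF v]) (simp add: Q(4))
  then have "e \<star> v (Suc i) + 0 \<star> w (Suc i) = 0" using kill by simp
  then have "Q ^ Suc i dvd e" using indep by blast
  then have "Q dvd e'" using Q(2) monic_irreducible_nz[OF Q(1)] by simp
  then show False using Q(3) by blast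
qed

end

context drinfeld_module
begin

lemma card_rational: "card {x. F x = x} = q ^ n"
proof -
  have "{x. F x = x} = range to_ac" using frobenius_fixed by auto
  then show ?thesis using card_image[OF inj_to_ac] card_L by metis
qed

lemma rational_subspace: "subspace {x. F x = x}"
  by (rule subspaceI) (use q_ge_2 in \<open>simp_all add: frob_add flip: act_frobenius\<close>)

lemma frobenius_quotient_quadratic:
  assumes i: "i \<noteq> 0" and y: "\<And>x. E y (i \<star> x) = F x - x"
    and eq: "\<And>x. F (F x) - c \<star> F x + D \<star> x = 0"
    and t: "c - 2 = t * i" and s: "1 - c + D = s * i * i"
  shows "E y (E y x) = t \<star> E y x - s \<star> x"
proof -
  obtain x1 where x1: "x = i \<star> x1" using act_surj[OF i] by metis
  obtain x2 where x2: "x1 = i \<star> x2" using act_surj[OF i] by metis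
  define g where "g = F x2 - x2"
  have yx: "E y x = i \<star> g"
    by (simp only: x1 y x2 act_frobenius[symmetric] scale_right_diff_distrib[symmetric] g_def)
  have "E y (E y x) = F g - g" by (simp only: yx y)
  also have "\<dots> = (t * i) \<star> g - (s * i * i) \<star> x2"
    using frobenius_minus_one_quadratic[OF eq, of x2] unfolding g_def t s .
  also have "\<dots> = t \<star> E y x - s \<star> x" by (simp only: yx) (simp add: x1 x2 mult.assoc)
  finally show ?thesis .
qed

text \<open>
  The kernel \<open>K\<close> of \<open>y = (F - 1)/i\<close> has \<open>q^deg s\<close> elements because \<open>y\<close> is separable of degree \<open>n - 2 deg i\<close>.
  It satisfies the criterion for being cyclic at the primes different from \<open>P\<close> by assumption and at \<open>P\<close>
  by inseparability.
\<close>

lemma frobenius_quotient_kernel_cyclic: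
  assumes i: "\<not> P dvd i" and y: "\<And>x. E y (i \<star> x) = F x - x"
    and proper: "\<And>Q. monic_irreducible Q \<Longrightarrow> Q \<noteq> P \<Longrightarrow> \<exists>x. Q \<star> x = 0 \<and> E y x \<noteq> 0"
    and s: "s \<noteq> 0" "\<And>x. E y x = 0 \<Longrightarrow> s \<star> x = 0" and deg: "n = degree s + 2 * degree i"
  obtains \<kappa> where "E y \<kappa> = 0" "has_order \<kappa> s"
proof -
  have inz: "i \<noteq> 0" using i by auto
  define K where "K = {x. E y x = 0}"
  have sub: "subspace K"
    by (rule subspaceI) (simp_all add: K_def E_add_right frobenius_quotient_commute[OF inz y])
  have Ky: "ore_mult q y (\<Phi> i) = Polynomial.monom 1 n - 1"
    by (rule E_eqI) (simp add: E_mult y E_frobenius_minus_one)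
  have n1: "degree (Polynomial.monom 1 n - 1 :: 'l poly) = n"
    using degree_add_eq_left[of "- 1" "Polynomial.monom (1 :: 'l) n"] n_pos by (simp add: degree_monom_eq)
  have c0: "poly.coeff y 0 \<noteq> 0"
    using arg_cong[OF Ky, of "\<lambda>f. poly.coeff f 0"] n_pos by (auto simp: L.coeff_0_ore_mult)
  then have "y \<noteq> 0" by auto
  then have "degree y + 2 * degree i = n"
    using L.degree_ore_mult(1)[of y "\<Phi> i"] degree_\<Phi>[OF inz] Ky n1 by simp
  then have "card K = q ^ degree s" unfolding K_def using card_E_kernel[OF c0] deg by simp
  have small: "card {x \<in> K. Q \<star> x = 0} < CARD('k) ^ (2 * degree Q)" if Q: "monic_irreducible Q" for Q
  proof (cases "Q = P")
    case True
    have "card {x \<in> K. P \<star> x = 0} \<le> card {x. P \<star> x = 0}"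
      by (rule card_mono[OF finite_torsion[OF monic_irreducible_nz[OF P_irred]]]) auto
    then show ?thesis using card_torsion_P True by simp
  next
    case False
    then have "\<not> P dvd Q" using monic_irreducible_dvd_eq[OF P_irred Q] by blast
    moreover have "card {x \<in> K. Q \<star> x = 0} < card {x. Q \<star> x = 0}"
      using proper[OF Q False] unfolding K_def
      by (intro psubset_card_mono[OF finite_torsion[OF monic_irreducible_nz[OF Q]]]) auto
    ultimately show ?thesis using card_torsion by simp
  qed
  obtain \<kappa> e where \<kappa>: "\<kappa> \<in> K" "has_order \<kappa> e" "K = range (\<lambda>a. a \<star> \<kappa>)"
    using cyclic_criterion[OF sub _ s(1) _ small] s(2) subspace_0[OF sub] unfolding K_def by blast
  have "q ^ degree e = q ^ degree s"
    using card_cyclic(1)[OF \<kappa>(2)] \<kappa>(3) \<open>card K = q ^ degree s\<close> q_eq by simp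
  then have "degree e = degree s" using q_ge_2 q_eq by (simp add: power_inject_exp)
  moreover have "e dvd s" using s(2) \<kappa>(1) has_orderD(3)[OF \<kappa>(2)] unfolding K_def by blast
  ultimately have "s dvd e" using dvd_degree_imp_dvd[of e s] s(1) by simp
  then have "e dvd a \<longleftrightarrow> s dvd a" for a using \<open>e dvd s\<close> dvd_trans by blast
  then have "has_order \<kappa> s" using \<kappa>(2) s(1) unfolding order_modulo_def by simp
  then show ?thesis using that \<kappa>(1) unfolding K_def by simp
qed

text \<open>
  The rational points \<open>M\<close> are the preimage under \<open>i\<close> of the kernel of \<open>y\<close>, cyclic of order \<open>s\<close>, and they
  contain the \<open>i\<close>-torsion, so their exponent is \<open>s i\<close>.  A point \<open>v\<close> of that order meets the \<open>Q\<close>-torsion in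
  a line for each prime \<open>Q\<close> dividing \<open>i\<close>; an \<open>i\<close>-torsion point \<open>w\<close> that avoids all these lines has order
  \<open>i\<close> modulo \<open>A v\<close>.  Counting gives \<open>M = A v + A w\<close>.
\<close>

lemma rational_points_structure:
  assumes i: "\<not> P dvd i" and y: "\<And>x. E y (i \<star> x) = F x - x"
    and proper: "\<And>Q. monic_irreducible Q \<Longrightarrow> Q \<noteq> P \<Longrightarrow> \<exists>x. Q \<star> x = 0 \<and> E y x \<noteq> 0"
    and eq: "\<And>x. F (F x) - c \<star> F x + D \<star> x = 0"
    and t: "c - 2 = t * i" and s: "1 - c + D = s * i * i" "s \<noteq> 0" and deg: "n = degree s + 2 * degree i"
  obtains v w where "F v = v" "F w = w" "\<And>x. F x = x \<Longrightarrow> \<exists>a b. x = a \<star> v + b \<star> w"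
    "\<And>a b. a \<star> v + b \<star> w = 0 \<longleftrightarrow> s * i dvd a \<and> i dvd b"
proof -
  have inz: "i \<noteq> 0" using i by auto
  define M where "M = {x. F x = x}"
  have sub: "subspace M" unfolding M_def by (rule rational_subspace)
  have nzsi: "s * i \<noteq> 0" using s(2) inz by simp
  have sK: "s \<star> x = 0" if "E y x = 0" for x
    using frobenius_quotient_quadratic[OF inz y eq t s(1), of x] that by simp
  obtain \<kappa> where \<kappa>: "E y \<kappa> = 0" "has_order \<kappa> s"
    using frobenius_quotient_kernel_cyclic[OF i y proper s(2) sK deg] by blast
  have in_M: "x \<in> M \<longleftrightarrow> E y (i \<star> x) = 0" for x unfolding M_def y by simp
  have M_kill: "(s * i) \<star> x = 0" if "x \<in> M" for x
    using sK[of "i \<star> x"] that in_M by simp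
  obtain v e where v: "v \<in> M" "has_order v e" "\<And>x. x \<in> M \<Longrightarrow> e \<star> x = 0"
    using exponent_attained[OF sub _ nzsi M_kill] subspace_0[OF sub] by blast
  have "i dvd e"
  proof (rule torsion_annihilator_dvd[OF i has_orderD(1)[OF v(2)] _ P_irred])
    show "e \<star> x = 0" if "i \<star> x = 0" for x using that by (intro v(3)) (simp add: in_M)
  qed
  then obtain e' where e': "e = e' * i" by (auto simp: dvd_def mult.commute)
  obtain x where x: "\<kappa> = i \<star> x" using act_surj[OF inz] by metis
  then have "x \<in> M" using \<kappa>(1) in_M by simp
  then have "e' \<star> \<kappa> = 0" using v(3)[of x] by (simp add: x e')
  then have "s dvd e'" using has_orderD(3)[OF \<kappa>(2)] by blast
  then have "s * i dvd e" by (simp add: e')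
  moreover have "e dvd s * i" using M_kill[OF v(1)] has_orderD(3)[OF v(2)] by blast
  ultimately have "e dvd a \<longleftrightarrow> s * i dvd a" for a using dvd_trans by blast
  then have v_order: "has_order v (s * i)" using v(2) nzsi unfolding order_modulo_def by simp
  define V where "V = range (\<lambda>a. a \<star> v)"
  have subV: "subspace V" unfolding V_def by (rule subspace_cyclic)
  have "\<exists>u. Q \<star> u = 0 \<and> u \<notin> V" if Q: "monic_irreducible Q" "Q dvd i" for Q
  proof -
    obtain r where r: "s * i = Q * r" using dvd_mult[OF Q(2), of s] by (auto simp: dvd_def)
    have Qnz: "Q \<noteq> 0" by (rule monic_irreducible_nz[OF Q(1)])
    have "\<not> P dvd Q" using i Q(2) dvd_trans by blast
    moreover have "Q \<star> (r \<star> v) = 0" using has_orderD(2)[OF v_order] by (simp add: r)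
    ultimately obtain u where u: "Q \<star> u = 0" "u \<notin> range (\<lambda>a. a \<star> (r \<star> v))"
      using irreducible_torsion_not_cyclic[OF Q(1)] by blast
    have "u \<notin> V"
    proof
      assume "u \<in> V"
      then obtain a where a: "u = a \<star> v" unfolding V_def by blast
      then have "s * i dvd Q * a" using u(1) has_orderD(3)[OF v_order] by simp
      then have "r dvd a" using r Qnz by simp
      then obtain a' where "a = a' * r" by (auto simp: dvd_def mult.commute)
      then have "u = a' \<star> (r \<star> v)" using a by simp
      then show False using u(2) by blast
    qed
    then show ?thesis using u(1) by blast
  qed
  then obtain u where u: "\<And>Q. monic_irreducible Q \<Longrightarrow> Q dvd i \<Longrightarrow> Q \<star> u Q = 0 \<and> u Q \<notin> V" by metis
  obtain w where w: "i \<star> w = 0"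
    and wQ: "\<And>Q. monic_irreducible Q \<Longrightarrow> Q dvd i \<Longrightarrow> \<exists>g. \<not> Q dvd g \<and> (i div Q) \<star> w = g \<star> u Q"
    using glue_prime_torsion[OF inz, of u] u by blast
  have w_order: "order_modulo V w i"
    using glued_order_modulo[OF inz _ subV wQ u] w subspace_0[OF subV] by simp
  have wM: "w \<in> M" using in_M w by simp
  have rel: "a \<star> v + b \<star> w = 0 \<longleftrightarrow> s * i dvd a \<and> i dvd b" for a b
  proof
    assume 0: "a \<star> v + b \<star> w = 0"
    then have "b \<star> w = (- a) \<star> v" by (simp add: eq_neg_iff_add_eq_0 add.commute)
    then have "b \<star> w \<in> V" unfolding V_def by blast
    then have b: "i dvd b" using w_order unfolding order_modulo_def by blast
    then have "a \<star> v = 0" using 0 scale_dvd_zero[OF w] by simp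
    then show "s * i dvd a \<and> i dvd b" using b has_orderD(3)[OF v_order] by blast
  next
    assume "s * i dvd a \<and> i dvd b"
    then show "a \<star> v + b \<star> w = 0"
      using scale_dvd_zero[OF w] scale_dvd_zero[OF has_orderD(2)[OF v_order]] by simp
  qed
  let ?f = "\<lambda>(a, b). a \<star> v + b \<star> w"
  let ?R = "\<lambda>e. {a :: 'k poly. a mod e = a}"
  have "inj_on ?f (?R (s * i) \<times> ?R i)"
  proof (rule inj_onI; clarsimp)
    fix a b a' b' assume r: "a mod (s * i) = a" "b mod i = b" "a' mod (s * i) = a'" "b' mod i = b'"
      and "a \<star> v + b \<star> w = a' \<star> v + b' \<star> w"
    then have "(a - a') \<star> v + (b - b') \<star> w = 0" by (simp add: scale_left_diff_distrib algebra_simps)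
    then show "a = a' \<and> b = b'" using rel r residues_eqI by blast
  qed
  then have "card (?f ` (?R (s * i) \<times> ?R i)) = q ^ (degree (s * i)) * q ^ degree i"
    using card_residues(1)[OF nzsi] card_residues(1)[OF inz] q_eq by (simp add: card_image card_cartesian_product)
  also have "\<dots> = q ^ n" using deg s(2) inz by (simp add: degree_mult_eq power_add mult_2)
  finally have card: "card (?f ` (?R (s * i) \<times> ?R i)) = card M" unfolding M_def card_rational .
  have finM: "finite M"
    using card_rational q_ge_2 q_eq unfolding M_def by (intro card_ge_0_finite) simp
  have "?f ` (?R (s * i) \<times> ?R i) \<subseteq> M"
    using v(1) wM sub by (auto simp: subspace_add subspace_scale)
  then have img: "?f ` (?R (s * i) \<times> ?R i) = M" by (rule card_subset_eq[OF finM _ card])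
  have span: "\<exists>a b. x = a \<star> v + b \<star> w" if "x \<in> M" for x
    using that unfolding img[symmetric] by auto
  show ?thesis
  proof (rule that[of v w])
    show "F v = v" "F w = w" using v(1) wM by (simp_all add: M_def)
    show "\<exists>a b. x = a \<star> v + b \<star> w" if "F x = x" for x using span that by (simp add: M_def)
  qed (rule rel)
qed

end

section \<open>Tate modules\<close>

lemma char_poly_2x2:
  fixes a b c d :: "'a::comm_ring_1"
  shows "char_poly (mat_of_rows_list 2 [[a, b], [c, d]]) = [:a * d - b * c, - (a + d), 1:]"
proof -
  define A where "A = mat_of_rows_list 2 [[a, b], [c, d]]"
  have A: "A \<in> carrier_mat 2 2"
    by (intro carrier_matI) (simp_all add: A_def mat_of_rows_list_def)
  define B where "B = char_poly_matrix A"
  have B: "B \<in> carrier_mat 2 2" unfolding B_def by (rule char_poly_matrix_closed[OF A])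
  have entry: "B $$ (i, j) = (if i = j then [:0, 1:] else 0) + [:- (A $$ (i, j)):]" if "i < 2" "j < 2" for i j
    using that A by (auto simp: B_def char_poly_matrix_def)
  have A_entries: "A $$ (0, 0) = a" "A $$ (0, 1) = b" "A $$ (1, 0) = c" "A $$ (1, 1) = d"
    by (simp_all add: A_def mat_of_rows_list_def)
  have minors: "det (mat_delete B 0 0) = B $$ (1, 1)" "det (mat_delete B 1 0) = B $$ (0, 1)"
    using B by (auto simp: mat_delete_def det_single)
  have "char_poly A = (\<Sum>i<2. B $$ (i, 0) * cofactor B i 0)"
    unfolding char_poly_def B_def[symmetric] by (rule laplace_expansion_column[OF B]) simp
  also have "\<dots> = B $$ (0, 0) * B $$ (1, 1) - B $$ (1, 0) * B $$ (0, 1)"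
  proof -
    have "{..<2 :: nat} = {0, 1}" by auto
    then show ?thesis using minors by (simp add: cofactor_def)
  qed
  also have "\<dots> = [:a * d - b * c, - (a + d), 1:]"
    using A_entries by (simp add: entry)
  finally show ?thesis unfolding A_def .
qed

lemma diff_eq_of_relations:
  fixes A :: "'b::ab_group_add"
  assumes "A - B' + C' = 0" "A - B + C = 0"
  shows "B - B' = C - C'"
proof -
  have "B - B' = (A - B' + C') - (A - B + C) + (C - C')" by simp
  then show ?thesis by (simp only: assms) simp
qed

context drinfeld_module
begin

lemma tate_carrier:
  "x \<in> carrier (tate_module \<Phi> Q) \<longleftrightarrow> (\<forall>k. Q ^ k \<star> x k = 0 \<and> Q \<star> x (Suc k) = x k)"
  by (simp add: tate_module_def drinfeld_torsion_eq flip: q_eq)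

abbreviation tate_sum where
  "tate_sum Q u x v y \<equiv> (u \<odot>\<^bsub>tate_module \<Phi> Q\<^esub> x) \<oplus>\<^bsub>tate_module \<Phi> Q\<^esub> (v \<odot>\<^bsub>tate_module \<Phi> Q\<^esub> y)"

lemma tate_combination:
  "tate_sum Q u x v y = (\<lambda>k. u k \<star> x k + v k \<star> y k)"
  by (simp add: tate_module_def flip: q_eq)

lemma tate_frobenius_eq: "tate_frobenius CARD('k) n x = (\<lambda>k. F (x k))"
  by (simp add: tate_frobenius_def E_frobenius flip: q_eq)

lemma adic_carrier: "u \<in> carrier (adic_ring Q) \<longleftrightarrow> (\<forall>k. u k = u (Suc k) mod Q ^ k)"
  by (simp add: adic_ring_def)

lemma adic_reduced:
  assumes "u \<in> carrier (adic_ring Q)"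
  shows "u k mod Q ^ k = u k"
  using assms unfolding adic_carrier by (metis mod_mod_trivial)

lemma adic_cong:
  assumes "u \<in> carrier (adic_ring Q)" "k \<le> j"
  shows "Q ^ k dvd u j - u k"
  using assms(2)
proof (induction j rule: dec_induct)
  case (step j)
  have "u j = u (Suc j) mod Q ^ j" using assms(1) unfolding adic_carrier by blast
  then have "Q ^ j dvd u (Suc j) - u j" by (metis dvd_minus_mod)
  then have "Q ^ k dvd u (Suc j) - u j" using step(1) le_imp_power_dvd dvd_trans by blast
  then have "Q ^ k dvd (u (Suc j) - u j) + (u j - u k)" using step(3) by (rule dvd_add)
  then show ?case by simp
qed simp

text \<open>
  Used at the finite levels of a Tate module, where \<open>x\<close> and \<open>y\<close> are torsion points and the
  coefficients are not unique.
\<close>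

lemma cayley_hamilton_2:
  assumes "F x = a \<star> x + c \<star> y" "F y = b \<star> x + d \<star> y"
  shows "F (F x) - (a + d) \<star> F x + (a * d - b * c) \<star> x = 0"
proof -
  have "F (F x) = a \<star> F x + c \<star> F y"
    using arg_cong[OF assms(1), of "\<lambda>x. F x"] by (simp add: frob_add act_frobenius)
  also have "\<dots> = (a * a) \<star> x + (a * c) \<star> y + ((c * b) \<star> x + (c * d) \<star> y)"
    by (simp add: assms scale_right_distrib)
  finally have "F (F x) = (a * a) \<star> x + (a * c) \<star> y + ((c * b) \<star> x + (c * d) \<star> y)" .
  moreover have "(a + d) \<star> F x = (a * a) \<star> x + (a * c) \<star> y + ((d * a) \<star> x + (d * c) \<star> y)"
    by (subst assms(1)) (simp add: scale_right_distrib scale_left_distrib distrib_right add_ac)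
  ultimately show ?thesis by (simp only: scale_left_diff_distrib) (simp add: mult.commute)
qed

text \<open>
  By Cayley-Hamilton the Ore polynomial \<open>F^2 - cF + D\<close> vanishes at every level of a basis vector of the
  Tate module.  The levels of a nonzero vector are infinitely many points, so the Ore polynomial is zero.
\<close>

lemma frobenius_equation_of_tate:
  assumes Q: "monic_irreducible Q" and tate: "tate_charpoly n \<Phi> Q [:D, - c, 1:]"
  shows "F (F x) - c \<star> F x + D \<star> x = 0"
proof -
  obtain e1 e2 m11 m12 m21 m22 where
    basis: "module_basis2 (adic_ring Q) (tate_module \<Phi> Q) e1 e2"
    and F1: "tate_frobenius CARD('k) n e1 =
          tate_sum Q m11 e1 m21 e2"
    and F2: "tate_frobenius CARD('k) n e2 =
          tate_sum Q m12 e1 m22 e2"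
    and cp: "\<forall>k r. [poly.coeff [:D, - c, 1:] r =
                  poly.coeff (char_poly (mat_of_rows_list 2 [[m11 k, m12 k], [m21 k, m22 k]])) r] (mod Q ^ k)"
    using tate unfolding tate_charpoly_def by auto
  have e1: "Q ^ k \<star> e1 k = 0" "Q \<star> e1 (Suc k) = e1 k" for k
    using basis unfolding module_basis2_def tate_carrier by auto
  define g where "g = Polynomial.monom 1 (n + n) - ore_mult q (\<Phi> c) (Polynomial.monom 1 n) + \<Phi> D"
  have Eg: "E g x = F (F x) - c \<star> F x + D \<star> x" for x
    unfolding g_def by (simp add: E_add E_diff E_mult E_monom power_add power_mult)
  have zero: "E g (e1 k) = 0" for k
  proof -
    have "[D = m11 k * m22 k - m12 k * m21 k] (mod Q ^ k)" "[- c = - (m11 k + m22 k)] (mod Q ^ k)"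
      using cp[rule_format, of 0 k] cp[rule_format, of 1 k] by (simp_all add: char_poly_2x2)
    then have d: "Q ^ k dvd D - (m11 k * m22 k - m12 k * m21 k)" "Q ^ k dvd - c - - (m11 k + m22 k)"
      by (simp_all add: cong_iff_dvd_diff)
    then have d2: "Q ^ k dvd c - (m11 k + m22 k)" by (metis dvd_minus_iff minus_diff_eq diff_minus_eq_add add.commute uminus_add_conv_diff)
    have "F (e1 k) = m11 k \<star> e1 k + m21 k \<star> e2 k" "F (e2 k) = m12 k \<star> e1 k + m22 k \<star> e2 k"
      using fun_cong[OF F1, of k] fun_cong[OF F2, of k] unfolding tate_combination tate_frobenius_eq by auto
    then have ch: "F (F (e1 k)) - (m11 k + m22 k) \<star> F (e1 k) + (m11 k * m22 k - m12 k * m21 k) \<star> e1 k = 0"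
      by (rule cayley_hamilton_2)
    have "Q ^ k \<star> F (e1 k) = 0" using e1(1) by (simp add: act_frobenius)
    then have "(c - (m11 k + m22 k)) \<star> F (e1 k) = 0" using d2 scale_dvd_zero by blast
    moreover have "(D - (m11 k * m22 k - m12 k * m21 k)) \<star> e1 k = 0" using d(1) scale_dvd_zero e1(1) by blast
    ultimately have "c \<star> F (e1 k) = (m11 k + m22 k) \<star> F (e1 k)" "D \<star> e1 k = (m11 k * m22 k - m12 k * m21 k) \<star> e1 k"
      by (simp_all add: scale_left_diff_distrib)
    then show ?thesis unfolding Eg using ch by simp
  qed
  have "\<exists>k0. e1 k0 \<noteq> 0"
  proof (rule ccontr)
    assume "\<not> ?thesis"
    then have e10: "e1 = (\<lambda>k. 0)" by auto
    \<comment> \<open>If \<open>e1\<close> were zero, its coordinates could be both \<open>(0, 0)\<close> and \<open>(1, 0)\<close>.\<close>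
    let ?z = "(\<lambda>k. 0) :: nat \<Rightarrow> 'k poly" and ?o = "(\<lambda>k. 1 mod Q ^ k) :: nat \<Rightarrow> 'k poly"
    have z: "?z \<in> carrier (adic_ring Q)" by (simp add: adic_carrier)
    have o: "?o \<in> carrier (adic_ring Q)"
      unfolding adic_carrier by (simp add: mod_mod_cancel le_imp_power_dvd)
    have "e1 \<in> carrier (tate_module \<Phi> Q)" using basis unfolding module_basis2_def by blast
    then have "\<exists>!w. w \<in> carrier (adic_ring Q) \<times> carrier (adic_ring Q) \<and>
        e1 = tate_sum Q (fst w) e1 (snd w) e2"
      using basis unfolding module_basis2_def by blast
    moreover have "e1 = tate_sum Q (fst (?z, ?z)) e1 (snd (?z, ?z)) e2"
      "e1 = tate_sum Q (fst (?o, ?z)) e1 (snd (?o, ?z)) e2"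
      unfolding tate_combination e10 by auto
    ultimately have "(?z, ?z) = (?o, ?z)" using z o by (metis (no_types, lifting) mem_Sigma_iff)
    then have "1 mod Q ^ 1 = 0" by (metis fst_conv)
    then have "Q dvd 1" by (simp add: mod_eq_0_iff_dvd)
    then show False using Q unfolding monic_irreducible_def irreducible_def by blast
  qed
  then obtain k0 where k0: "e1 k0 \<noteq> 0" by blast
  have down: "Q ^ j \<star> e1 (k + j) = e1 k" for k j
  proof (induction j)
    case (Suc j)
    have "Q ^ Suc j \<star> e1 (k + Suc j) = Q ^ j \<star> (Q \<star> e1 (Suc (k + j)))" by (simp add: mult.commute)
    then show ?case using Suc e1(2) by simp
  qed simp
  have "inj_on e1 {k0..}"
  proof (rule linorder_inj_onI')
    fix i j assume ij: "i \<in> {k0..}" "j \<in> {k0..}" "i < j"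
    show "e1 i \<noteq> e1 j"
    proof
      assume eq: "e1 i = e1 j"
      define d where "d = j - i"
      have 1: "Q ^ d \<star> e1 j = e1 j" using down[of d i] eq ij by (simp add: d_def)
      have "Q ^ (d * N) \<star> e1 j = e1 j" for N
      proof (induction N)
        case (Suc N)
        have "Q ^ (d * Suc N) \<star> e1 j = Q ^ (d * N) \<star> (Q ^ d \<star> e1 j)"
          by (simp add: power_add mult.commute)
        then show ?case using Suc 1 by simp
      qed simp
      then have "e1 j = Q ^ (d * j) \<star> e1 j" by simp
      also have "\<dots> = 0"
        by (rule scale_dvd_zero[OF e1(1)], rule le_imp_power_dvd) (use ij in \<open>simp add: d_def\<close>)
      finally have "e1 j = 0" .
      then have "e1 k0 = 0" using down[of "j - k0" k0] ij by simp
      then show False using k0 by blast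
    qed
  qed
  then have "infinite (e1 ` {k0..})" using infinite_Ici finite_imageD by blast
  then have "infinite {x. E g x = 0}" using zero by (elim contrapos_nn) (erule finite_subset[rotated], auto)
  then have "g = 0" by (rule E_eq_0I)
  then show ?thesis using Eg[of x] by simp
qed

lemma not_P_dvd_power:
  assumes Q: "monic_irreducible Q" "Q \<noteq> P"
  shows "\<not> P dvd Q ^ k"
proof (induction k)
  case 0
  show ?case using P_irred by (auto simp: monic_irreducible_def irreducible_def)
next
  case (Suc k)
  then show ?case
    using irreducible_poly_dvd_mult[of P Q "Q ^ k"] monic_irreducible_dvd_eq[OF P_irred Q(1)] Q(2) P_irred
    unfolding monic_irreducible_def by auto
qed

lemma tate_basis:
  assumes Q: "monic_irreducible Q" "Q \<noteq> P"
    and v: "\<And>k. Q \<star> v (Suc k) = v k" "\<And>k. Q ^ k \<star> v k = 0"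
    and w: "\<And>k. Q \<star> w (Suc k) = w k" "\<And>k. Q ^ k \<star> w k = 0"
    and indep: "\<And>k a b. a \<star> v k + b \<star> w k = 0 \<Longrightarrow> Q ^ k dvd a \<and> Q ^ k dvd b"
  shows "module_basis2 (adic_ring Q) (tate_module \<Phi> Q) v w"
  unfolding module_basis2_def
proof (intro conjI ballI)
  show "v \<in> carrier (tate_module \<Phi> Q)" "w \<in> carrier (tate_module \<Phi> Q)"
    using v w by (simp_all add: tate_carrier)
  fix x assume "x \<in> carrier (tate_module \<Phi> Q)"
  then have x: "Q ^ k \<star> x k = 0" "Q \<star> x (Suc k) = x k" for k by (simp_all add: tate_carrier)
  note nP = not_P_dvd_power[OF Q]
  have "\<exists>p. fst p mod Q ^ k = fst p \<and> snd p mod Q ^ k = snd p \<and> x k = fst p \<star> v k + snd p \<star> w k" for k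
  proof -
    obtain a b where "x k = a \<star> v k + b \<star> w k"
      using torsion_spanned[OF nP v(2) w(2) indep x(1)] by blast
    then show ?thesis
      by (intro exI[of _ "(a mod Q ^ k, b mod Q ^ k)"])
        (simp add: scale_mod_cancel[OF v(2)] scale_mod_cancel[OF w(2)])
  qed
  then obtain p where p: "\<And>k. fst (p k) mod Q ^ k = fst (p k) \<and> snd (p k) mod Q ^ k = snd (p k) \<and>
      x k = fst (p k) \<star> v k + snd (p k) \<star> w k" by metis
  define \<alpha> \<beta> where "\<alpha> = (\<lambda>k. fst (p k))" and "\<beta> = (\<lambda>k. snd (p k))"
  have red: "\<alpha> k mod Q ^ k = \<alpha> k" "\<beta> k mod Q ^ k = \<beta> k" and xk: "x k = \<alpha> k \<star> v k + \<beta> k \<star> w k" for k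
    using p[of k] by (simp_all add: \<alpha>_def \<beta>_def)
  have uniq: "a mod Q ^ k = a' mod Q ^ k \<and> b mod Q ^ k = b' mod Q ^ k"
    if "a \<star> v k + b \<star> w k = a' \<star> v k + b' \<star> w k" for a b a' b' k
  proof -
    have "(a - a') \<star> v k + (b - b') \<star> w k = 0" using that by (simp add: scale_left_diff_distrib algebra_simps)
    then show ?thesis using indep by (simp add: mod_eq_dvd_iff)
  qed
  have step: "\<alpha> k = \<alpha> (Suc k) mod Q ^ k \<and> \<beta> k = \<beta> (Suc k) mod Q ^ k" for k
  proof -
    have "\<alpha> k \<star> v k + \<beta> k \<star> w k = Q \<star> (\<alpha> (Suc k) \<star> v (Suc k) + \<beta> (Suc k) \<star> w (Suc k))"
      using x(2)[of k] xk by simp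
    also have "\<dots> = \<alpha> (Suc k) \<star> (Q \<star> v (Suc k)) + \<beta> (Suc k) \<star> (Q \<star> w (Suc k))"
      by (simp add: scale_right_distrib mult.commute)
    also have "\<dots> = \<alpha> (Suc k) \<star> v k + \<beta> (Suc k) \<star> w k" by (simp only: v(1) w(1))
    finally show ?thesis using uniq red by metis
  qed
  show "\<exists>!p. p \<in> carrier (adic_ring Q) \<times> carrier (adic_ring Q) \<and>
      x = tate_sum Q (fst p) v (snd p) w"
  proof (rule ex1I[of _ "(\<alpha>, \<beta>)"])
    show "(\<alpha>, \<beta>) \<in> carrier (adic_ring Q) \<times> carrier (adic_ring Q) \<and>
      x = tate_sum Q (fst (\<alpha>, \<beta>)) v (snd (\<alpha>, \<beta>)) w"
      unfolding tate_combination adic_carrier mem_Times_iff fst_conv snd_conv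
      using step xk by (intro conjI ext allI) blast+
  next
    fix p' assume p': "p' \<in> carrier (adic_ring Q) \<times> carrier (adic_ring Q) \<and>
      x = tate_sum Q (fst p') v (snd p') w"
    then have car: "fst p' \<in> carrier (adic_ring Q)" "snd p' \<in> carrier (adic_ring Q)" by auto
    have "x k = fst p' k \<star> v k + snd p' k \<star> w k" for k
      using p' unfolding tate_combination by (metis (no_types, lifting))
    then have "fst p' k = \<alpha> k \<and> snd p' k = \<beta> k" for k
      using uniq[of "fst p' k" k "snd p' k" "\<alpha> k" "\<beta> k"] xk red adic_reduced[OF car(1)] adic_reduced[OF car(2)]
      by metis
    then have "fst p' = \<alpha>" "snd p' = \<beta>" by auto
    then show "p' = (\<alpha>, \<beta>)" by (cases p') auto
  qed
qed

text \<open>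
  Let \<open>tr\<close> and \<open>dt\<close> be the trace and determinant of \<open>F\<close> in a basis.  Comparing the given equation with
  Cayley-Hamilton gives \<open>(c - tr) F = D - dt\<close>.  If \<open>c\<close> and \<open>tr\<close> differed modulo \<open>Q^k0\<close>, then dividing by the
  power of \<open>Q\<close> in \<open>c - tr\<close> would make \<open>F\<close> a scalar on the torsion of arbitrarily large powers of \<open>Q\<close>,
  which \<open>multiplier_bounded\<close> excludes.
\<close>

lemma tate_charpoly_of_frobenius_equation:
  assumes ord: "ordinary \<Phi> P" and eq: "\<And>x. F (F x) - c \<star> F x + D \<star> x = 0"
    and Q: "monic_irreducible Q" "Q \<noteq> P"
  shows "tate_charpoly n \<Phi> Q [:D, - c, 1:]"
proof -
  have nP: "\<not> P dvd Q" using monic_irreducible_dvd_eq[OF P_irred Q(1)] Q(2) by blast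
  have Qnz: "Q \<noteq> 0" by (rule monic_irreducible_nz[OF Q(1)])
  obtain v w :: "nat \<Rightarrow> 'l alg_closure" where
    v: "\<And>k. Q \<star> v (Suc k) = v k" "\<And>k. Q ^ k \<star> v k = 0" and
    w: "\<And>k. Q \<star> w (Suc k) = w k" "\<And>k. Q ^ k \<star> w k = 0" and
    indep: "\<And>k a b. a \<star> v k + b \<star> w k = 0 \<Longrightarrow> Q ^ k dvd a \<and> Q ^ k dvd b"
    using prime_power_torsion_basis[OF Q(1) nP] by metis
  note basis = tate_basis[OF Q v w indep]
  have Fcar: "(\<lambda>k. F (x k)) \<in> carrier (tate_module \<Phi> Q)" if "x \<in> carrier (tate_module \<Phi> Q)" for x
    using that by (simp add: tate_carrier act_frobenius)
  have coord: "\<exists>a b. a \<in> carrier (adic_ring Q) \<and> b \<in> carrier (adic_ring Q) \<and> (\<forall>k. F (x k) = a k \<star> v k + b k \<star> w k)"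
    if xc: "x \<in> carrier (tate_module \<Phi> Q)" for x
  proof -
    obtain p where p: "p \<in> carrier (adic_ring Q) \<times> carrier (adic_ring Q)"
      "(\<lambda>k. F (x k)) = tate_sum Q (fst p) v (snd p) w"
      using basis Fcar[OF xc] unfolding module_basis2_def by blast
    show ?thesis
      using p(1) fun_cong[OF p(2)] unfolding tate_combination by (intro exI[of _ "fst p"] exI[of _ "snd p"]) auto
  qed
  obtain m11 m21 where m1: "m11 \<in> carrier (adic_ring Q)" "m21 \<in> carrier (adic_ring Q)"
    "\<And>k. F (v k) = m11 k \<star> v k + m21 k \<star> w k"
    using coord[of v] basis unfolding module_basis2_def by blast
  obtain m12 m22 where m2: "m12 \<in> carrier (adic_ring Q)" "m22 \<in> carrier (adic_ring Q)"
    "\<And>k. F (w k) = m12 k \<star> v k + m22 k \<star> w k"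
    using coord[of w] basis unfolding module_basis2_def by blast
  define tr where "tr = (\<lambda>k. m11 k + m22 k)"
  define dt where "dt = (\<lambda>k. m11 k * m22 k - m12 k * m21 k)"
  have rel_v: "(c - tr k) \<star> F (v k) = (D - dt k) \<star> v k" for k
  proof -
    have "F (F (v k)) - tr k \<star> F (v k) + dt k \<star> v k = 0"
      unfolding tr_def dt_def by (rule cayley_hamilton_2[OF m1(3) m2(3)])
    then show ?thesis unfolding scale_left_diff_distrib by (rule diff_eq_of_relations) (rule eq)
  qed
  have rel_w: "(c - tr k) \<star> F (w k) = (D - dt k) \<star> w k" for k
  proof -
    have "F (w k) = m22 k \<star> w k + m12 k \<star> v k" "F (v k) = m21 k \<star> w k + m11 k \<star> v k"
      using m1(3)[of k] m2(3)[of k] by (simp_all add: add.commute)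
    then have "F (F (w k)) - (m22 k + m11 k) \<star> F (w k) + (m22 k * m11 k - m21 k * m12 k) \<star> w k = 0"
      by (rule cayley_hamilton_2)
    then have "F (F (w k)) - tr k \<star> F (w k) + dt k \<star> w k = 0"
      unfolding tr_def dt_def by (simp only: add.commute mult.commute)
    then show ?thesis unfolding scale_left_diff_distrib by (rule diff_eq_of_relations) (rule eq)
  qed
  note nPk = not_P_dvd_power[OF Q]
  have rel: "(c - tr k) \<star> F x = (D - dt k) \<star> x" if x: "Q ^ k \<star> x = 0" for k x
  proof -
    obtain a b where ab: "x = a \<star> v k + b \<star> w k"
      using torsion_spanned[OF nPk v(2) w(2) indep x] by blast
    have "(c - tr k) \<star> F x = a \<star> ((c - tr k) \<star> F (v k)) + b \<star> ((c - tr k) \<star> F (w k))"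
      unfolding ab frob_add act_frobenius[symmetric] scale_right_distrib by (simp add: mult.commute)
    also have "\<dots> = (D - dt k) \<star> x"
      unfolding rel_v rel_w ab scale_right_distrib by (simp add: mult.commute)
    finally show ?thesis .
  qed
  have dvd_of_kill: "Q ^ k dvd a" if "a \<star> v k = 0" for a k
    using indep[of a k 0] that by simp
  have trace: "Q ^ k0 dvd c - tr k0" for k0
  proof (rule ccontr)
    assume no: "\<not> Q ^ k0 dvd c - tr k0"
    \<comment> \<open>The divisor \<open>Q^(K - r)\<close> with \<open>r < k0\<close> has degree larger than \<open>n\<close>, the degree of
      \<open>F\<close>.\<close>
    define K where "K = k0 + Suc n"
    have "Q ^ k0 dvd tr K - tr k0"
    proof -
      have "Q ^ k0 dvd (m11 K - m11 k0) + (m22 K - m22 k0)"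
        using adic_cong[OF m1(1), of k0 K] adic_cong[OF m2(2), of k0 K] by (intro dvd_add) (simp_all add: K_def)
      then show ?thesis by (simp add: tr_def algebra_simps)
    qed
    then have no': "\<not> Q ^ k0 dvd c - tr K"
      using no dvd_add[of "Q ^ k0" "c - tr K" "tr K - tr k0"] by auto
    then have "c - tr K \<noteq> 0" by auto
    then obtain r g where rg: "c - tr K = Q ^ r * g" "\<not> Q dvd g"
      using extract_irreducible_power[OF Q(1)] by metis
    have r: "r < k0"
    proof (rule ccontr)
      assume "\<not> r < k0"
      then have "Q ^ k0 dvd Q ^ r" by (intro le_imp_power_dvd) simp
      then show False using no' rg(1) by (metis dvd_mult2)
    qed
    have "Q ^ r dvd D - dt K"
    proof (rule dvd_of_kill)
      have Kr: "Q ^ r \<star> v r = 0" by (rule v(2))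
      then have "Q ^ K \<star> v r = 0" using r by (elim scale_dvd_zero) (simp add: le_imp_power_dvd K_def)
      then have "(D - dt K) \<star> v r = (Q ^ r * g) \<star> F (v r)" using rel rg(1) by metis
      also have "\<dots> = F ((Q ^ r * g) \<star> v r)" by (rule act_frobenius)
      also have "(Q ^ r * g) \<star> v r = 0" by (rule scale_dvd_zero[OF Kr]) simp
      finally show "(D - dt K) \<star> v r = 0" by simp
    qed
    then obtain h where h: "D - dt K = Q ^ r * h" by (auto simp: dvd_def)
    define e where "e = Q ^ (K - r)"
    have gF: "g \<star> F y = h \<star> y" if "e \<star> y = 0" for y
    proof -
      obtain x where x: "y = Q ^ r \<star> x" using act_surj[of "Q ^ r" y] Qnz by auto
      have "Q ^ K \<star> x = e \<star> y"
        using r by (simp add: x e_def K_def flip: power_add)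
      then have "(c - tr K) \<star> F x = (D - dt K) \<star> x" using rel that by simp
      then show ?thesis unfolding x rg(1) h act_frobenius[symmetric] by (simp add: mult.commute)
    qed
    have "coprime e g" unfolding e_def
      using coprime_poly_power_left monic_irreducible_coprime Q(1) rg(2) by blast
    then obtain j j' where j: "j * e + j' * g = 1" by (rule coprime_poly_bezout)
    have scalar: "F y = (j' * h) \<star> y" if y: "e \<star> y = 0" for y
    proof -
      have "F y = (j * e + j' * g) \<star> F y" using j by simp
      also have "\<dots> = j \<star> (e \<star> F y) + j' \<star> (g \<star> F y)" by (simp add: scale_left_distrib)
      also have "\<dots> = j' \<star> (h \<star> y)" using gF[OF y] y by (simp only: act_frobenius) (simp del: scale_scale)
      finally show ?thesis by simp
    qed
    have "poly.coeff (\<Phi> e) 0 \<noteq> 0" using nPk by (simp add: coeff_0_\<Phi> \<gamma>_kernel e_def)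
    moreover have "E (Polynomial.monom 1 n - \<Phi> (j' * h)) y = 0" if "e \<star> y = 0" for y
      using scalar[OF that] by (simp add: E_diff E_monom)
    ultimately obtain z where "Polynomial.monom 1 n - \<Phi> (j' * h) = ore_mult q z (\<Phi> e)"
      by (rule E_right_divide) blast+
    then have "degree e \<le> degree (Polynomial.monom (1 :: 'l) n)"
      using multiplier_bounded[of "Polynomial.monom 1 n" e] ordinary_frobenius_not_scalar[OF ord] Qnz
      by (simp add: e_def)
    then have "(K - r) * degree Q \<le> n" using Qnz by (simp add: e_def degree_power_eq degree_monom_eq mult.commute)
    moreover have "K - r \<le> (K - r) * degree Q" using monic_irreducible_degree[OF Q(1)] by simp
    moreover have "n < K - r" using r by (simp add: K_def)
    ultimately show False by linarith
  qed
  have determinant: "Q ^ k dvd D - dt k" for k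
  proof (rule dvd_of_kill)
    have "Q ^ k \<star> F (v k) = 0" using v(2) by (simp add: act_frobenius)
    then have "(c - tr k) \<star> F (v k) = 0" using trace scale_dvd_zero by blast
    then show "(D - dt k) \<star> v k = 0" using rel_v by simp
  qed
  have "[poly.coeff [:D, - c, 1:] r =
      poly.coeff (char_poly (mat_of_rows_list 2 [[m11 k, m12 k], [m21 k, m22 k]])) r] (mod Q ^ k)" for k r
  proof -
    have "[- c = - tr k] (mod Q ^ k)"
      using trace[of k] by (simp add: cong_iff_dvd_diff) (metis dvd_minus_iff minus_diff_eq)
    moreover have "[D = dt k] (mod Q ^ k)" using determinant[of k] by (simp add: cong_iff_dvd_diff)
    ultimately show ?thesis
      unfolding char_poly_2x2 tr_def dt_def by (auto simp: coeff_pCons split: nat.split)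
  qed
  moreover have "tate_frobenius CARD('k) n v = tate_sum Q m11 v m21 w"
    "tate_frobenius CARD('k) n w = tate_sum Q m12 v m22 w"
    unfolding tate_combination tate_frobenius_eq using m1(3) m2(3) by auto
  ultimately show ?thesis
    unfolding tate_charpoly_def using basis m1(1,2) m2(1,2)
    by (intro exI[of _ v] exI[of _ w] exI[of _ m11] exI[of _ m12] exI[of _ m21] exI[of _ m22]) simp
qed

end

section \<open>From the algebraic hypotheses to cardinalities and divisibility\<close>

lemma A_ideal_multiples: "A_ideal a = {x. a dvd (x :: 'k::comm_ring_1 poly)}"
  by (auto simp: cgenideal_def ring_of_type_algebra_def dvd_def mult.commute)

lemma A_ideal_product_dvd:
  fixes i j N :: "'k::comm_ring_1 poly"
  assumes "A_ideal i \<cdot>\<^bsub>A_ring\<^esub> A_ideal j = A_ideal N"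
  shows "N dvd i * j" "i * j dvd N"
proof -
  have "i \<otimes>\<^bsub>A_ring\<^esub> j \<in> A_ideal N"
    unfolding assms[symmetric] by (rule ideal_prod.prod) (simp_all add: A_ideal_multiples)
  then show "N dvd i * j"
    unfolding A_ideal_multiples by (simp add: ring_of_type_algebra_def)
  have mult: "i * j dvd x" if "x \<in> A_ideal i \<cdot>\<^bsub>A_ring\<^esub> A_ideal j" for x
    using that
  proof (induction rule: ideal_prod.induct)
    case (prod a b)
    then show ?case unfolding A_ideal_multiples by (simp add: ring_of_type_algebra_def mult_dvd_mono)
  next
    case (sum a b)
    then show ?case by (simp add: ring_of_type_algebra_def)
  qed
  have "N \<in> A_ideal N" by (simp add: A_ideal_multiples)
  then show "i * j dvd N" unfolding assms[symmetric] by (rule mult)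
qed

text \<open>
  \<open>K\<close> is only assumed to be a subring, which suits both ranges it is applied to; it is a field because
  in a finite field the inverse is a power.
\<close>

lemma card_of_dimension:
  fixes K :: "'l::{field,finite} set"
  assumes dim: "ring.dimension (ring_of_type_algebra :: 'l ring) n K E"
    and K: "1 \<in> K" "\<And>x y. x \<in> K \<Longrightarrow> y \<in> K \<Longrightarrow> x - y \<in> K" "\<And>x y. x \<in> K \<Longrightarrow> y \<in> K \<Longrightarrow> x * y \<in> K"
  shows "card E = card K ^ n"
proof -
  interpret R: ring "ring_of_type_algebra :: 'l ring" by (rule ring_from_type_algebra)
  have zero: "0 \<in> K" using K(1,2) by fastforce
  then have uminus: "- x \<in> K" if "x \<in> K" for x using K(2)[OF zero that] by simp
  have power: "x ^ j \<in> K" if "x \<in> K" for x j by (induction j) (use that K in auto)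
  have inverse: "inverse x \<in> K" if "x \<in> K" for x
  proof (cases "x = 0")
    case False
    have "card {0, 1 :: 'l} \<le> CARD('l)" by (rule card_mono) auto
    then have "CARD('l) = Suc (Suc (CARD('l) - 2))" by simp
    then have "x ^ (CARD('l) - 2) * x * x = x"
      using power_card_same[of x] by (metis power_Suc2)
    then have "x ^ (CARD('l) - 2) * x = 1" using False by simp
    then have "inverse x = x ^ (CARD('l) - 2)" using inverse_unique by (metis mult.commute)
    then show ?thesis using power[OF that] by simp
  qed (use zero in simp)
  have general: "card E' = card K ^ n' \<and> 0 \<in> E' \<and> (\<forall>x\<in>E'. \<forall>y\<in>E'. x - y \<in> E') \<and> (\<forall>k\<in>K. \<forall>x\<in>E'. k * x \<in> E')"
    if "R.dimension n' K' E'" "K' = K" for n' K' E'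
    using that
  proof (induction rule: R.dimension.induct)
    case (zero_dim K')
    then show ?case by (simp add: ring_of_type_algebra_def)
  next
    case (Suc_dim v E' n' K')
    then have IH: "card E' = card K ^ n'" "0 \<in> E'" "\<And>x y. x \<in> E' \<Longrightarrow> y \<in> E' \<Longrightarrow> x - y \<in> E'"
      "\<And>k x. k \<in> K \<Longrightarrow> x \<in> E' \<Longrightarrow> k * x \<in> E'" by auto
    let ?f = "\<lambda>(k, e). k * v + e"
    have ext: "R.line_extension K' v E' = ?f ` (K \<times> E')"
      using Suc_dim.prems R.line_extension_mem_iff[of _ K v E']
      by (auto simp: ring_of_type_algebra_def)
    have "inj_on ?f (K \<times> E')"
    proof (rule inj_onI; clarsimp)
      fix k e k' e' assume *: "k \<in> K" "e \<in> E'" "k' \<in> K" "e' \<in> E'" "k * v + e = k' * v + e'"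
      then have eq: "(k - k') * v = e' - e" by (simp add: algebra_simps)
      have "k = k'"
      proof (rule ccontr)
        assume "k \<noteq> k'"
        then have "v = inverse (k - k') * (e' - e)" by (simp flip: eq)
        then have "v \<in> E'" using IH(3,4) * inverse K(2) by metis
        then show False using Suc_dim.hyps by blast
      qed
      then show "k = k' \<and> e = e'" using *(5) by simp
    qed
    then have "card (?f ` (K \<times> E')) = card K ^ Suc n'" using IH(1) by (simp add: card_image card_cartesian_product)
    moreover have "0 \<in> ?f ` (K \<times> E')" using zero IH(2) by (intro image_eqI[of _ _ "(0, 0)"]) auto
    moreover have "x - y \<in> ?f ` (K \<times> E')" if x: "x \<in> ?f ` (K \<times> E')" and y: "y \<in> ?f ` (K \<times> E')" for x y
    proof -
      obtain k e where "k \<in> K" "e \<in> E'" "x = k * v + e" using x by auto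
      moreover obtain k' e' where "k' \<in> K" "e' \<in> E'" "y = k' * v + e'" using y by auto
      ultimately show ?thesis
        using K(2) IH(3) by (intro image_eqI[of _ _ "(k - k', e - e')"]) (auto simp: algebra_simps)
    qed
    moreover have "c * x \<in> ?f ` (K \<times> E')" if "c \<in> K" "x \<in> ?f ` (K \<times> E')" for c x
    proof -
      obtain k e where "k \<in> K" "e \<in> E'" "x = k * v + e" using \<open>x \<in> ?f ` (K \<times> E')\<close> by auto
      then show ?thesis
        using K(3) IH(4) that(1) by (intro image_eqI[of _ _ "(c * k, c * e)"]) (auto simp: algebra_simps)
    qed
    ultimately show ?case unfolding ext by blast
  qed
  from general[OF dim refl] show ?thesis by blast
qed

text \<open>
  The polynomial \<open>(X + 1)^q - X^q - 1\<close> over the field of \<open>q\<close> elements has degree less than \<open>q\<close> and vanishes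
  everywhere, so the inner binomial coefficients of exponent \<open>q\<close> are zero in that field, hence in every
  ring that receives a map from it.
\<close>

lemma finite_field_frobenius:
  fixes \<phi> :: "'k::{field,finite} \<Rightarrow> 'e::comm_ring_1"
  assumes \<phi>: "\<And>n. \<phi> (of_nat n) = of_nat n" "\<phi> 0 = 0"
  shows "of_nat CARD('k) = (0 :: 'e)" "(x + y) ^ CARD('k) = x ^ CARD('k) + (y :: 'e) ^ CARD('k)"
    "CARD('k) \<ge> 2"
proof -
  let ?q = "CARD('k)"
  have "card {0, 1 :: 'k} \<le> ?q" by (rule card_mono) auto
  then show q: "?q \<ge> 2" by simp
  define p :: "'k poly" where "p = [:1, 1:] ^ ?q - (Polynomial.monom 1 ?q + 1)"
  have coeffs: "poly.coeff p i = (if 0 < i \<and> i < ?q then of_nat (?q choose i) else 0)" for i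
  proof (cases "i \<le> ?q")
    case True
    then show ?thesis using q by (auto simp: p_def coeff_linear_poly_power)
  next
    case False
    then have "poly.coeff ([:1, 1:] ^ ?q :: 'k poly) i = 0"
      using degree_linear_power[of "1 :: 'k" ?q] by (intro coeff_eq_0) simp
    then show ?thesis using False by (simp add: p_def)
  qed
  have "p = 0"
  proof (rule ccontr)
    assume "p \<noteq> 0"
    have "poly p x = 0" for x
      using power_card_same[of x] power_card_same[of "1 + x"] by (simp add: p_def poly_monom)
    then have "card (UNIV :: 'k set) \<le> degree p" using card_poly_roots_bound[OF \<open>p \<noteq> 0\<close>] by simp
    moreover have "degree p < ?q" using q by (intro degree_lessI) (auto simp: coeffs)
    ultimately show False by simp
  qed
  then have "(of_nat (?q choose i) :: 'k) = 0" if "0 < i" "i < ?q" for i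
    using coeffs[of i] that by simp
  then have zero: "(of_nat (?q choose i) :: 'e) = 0" if "0 < i" "i < ?q" for i
    using \<phi> that by metis
  show "of_nat ?q = (0 :: 'e)" using zero[of 1] q by simp
  have "(x + y) ^ ?q = (\<Sum>i\<le>?q. of_nat (?q choose i) * x ^ i * y ^ (?q - i))" by (rule binomial_ring)
  also have "\<dots> = (\<Sum>i\<in>{0, ?q}. of_nat (?q choose i) * x ^ i * y ^ (?q - i))"
    by (rule sum.mono_neutral_right) (use zero in auto)
  also have "\<dots> = x ^ ?q + y ^ ?q" using q by simp
  finally show "(x + y) ^ ?q = x ^ ?q + y ^ ?q" .
qed

section \<open>Isomorphism with a sum of two cyclic modules\<close>

lemma A_ideal_coset:
  fixes i :: "'k::field poly"
  defines "coset \<equiv> \<lambda>a. A_ideal i +>\<^bsub>A_ring\<^esub> a"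
  shows "carrier (quotient_module (A_ideal i)) = range coset"
    and "coset a \<oplus>\<^bsub>quotient_module (A_ideal i)\<^esub> coset b = coset (a + b)"
    and "r \<odot>\<^bsub>quotient_module (A_ideal i)\<^esub> coset b = coset (r * b)"
    and "coset a = coset b \<longleftrightarrow> i dvd a - b"
proof -
  interpret A: cring "A_ring :: 'k poly ring" by (rule cring_from_type_algebra)
  interpret I: ideal "A_ideal i" "A_ring :: 'k poly ring"
    by (rule A.cgenideal_ideal) (simp add: ring_of_type_algebra_def)
  have univ: "x \<in> carrier (A_ring :: 'k poly ring)" for x by (simp add: ring_of_type_algebra_def)
  show "carrier (quotient_module (A_ideal i)) = range coset"
    by (auto simp: quotient_module_def FactRing_def A_RCOSETS_def' coset_def ring_of_type_algebra_def)
  show "coset a \<oplus>\<^bsub>quotient_module (A_ideal i)\<^esub> coset b = coset (a + b)"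
    using I.a_rcos_sum[OF univ univ, of a b]
    by (simp add: quotient_module_def FactRing_def coset_def) (simp add: ring_of_type_algebra_def)
  show "r \<odot>\<^bsub>quotient_module (A_ideal i)\<^esub> coset b = coset (r * b)"
    using I.rcoset_mult_add[OF univ univ, of r b]
    by (simp add: quotient_module_def FactRing_def coset_def) (simp add: ring_of_type_algebra_def)
  have coset_eq: "coset a = {x. i dvd x - a}" for a
  proof -
    have "coset a = {x. \<exists>h\<in>A_ideal i. x = h + a}"
      unfolding coset_def a_r_coset_def' by (auto simp: ring_of_type_algebra_def)
    also have "\<dots> = {x. i dvd x - a}"
      unfolding A_ideal_multiples by (auto intro: exI[of _ "_ - a"])
    finally show ?thesis .
  qed
  show "coset a = coset b \<longleftrightarrow> i dvd a - b"
  proof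
    assume "coset a = coset b"
    moreover have "a \<in> coset a" unfolding coset_eq by simp
    ultimately show "i dvd a - b" unfolding coset_eq by blast
  next
    assume "i dvd a - b"
    then have "i dvd x - a \<longleftrightarrow> i dvd x - b" for x
      using dvd_add[of i "x - a" "a - b"] dvd_diff[of i "x - b" "a - b"] by auto
    then show "coset a = coset b" unfolding coset_eq by simp
  qed
qed

text \<open>
  Coordinates with respect to \<open>v, w\<close> are chosen arbitrarily; the relations say that their classes do not
  depend on the choice.
\<close>

lemma sum_of_cyclic_isomorphic:
  fixes M :: "('k::field poly, 'b::ab_group_add) module" and i j :: "'k poly"
    and act :: "'k poly \<Rightarrow> 'b \<Rightarrow> 'b" (infixr \<open>\<star>\<close> 75)
  assumes M: "carrier M = UNIV" "\<And>x y. x \<oplus>\<^bsub>M\<^esub> y = x + y" "\<And>a x. a \<odot>\<^bsub>M\<^esub> x = a \<star> x"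
    and act: "Modules.module (\<star>)"
    and span: "\<And>x. \<exists>a b. x = a \<star> v + b \<star> w"
    and rel: "\<And>a b. a \<star> v + b \<star> w = 0 \<longleftrightarrow> i dvd a \<and> j dvd b"
  shows "module_isomorphic A_ring M (direct_sum (quotient_module (A_ideal i)) (quotient_module (A_ideal j)))"
proof -
  interpret Modules.module "(\<star>)" by (rule act)
  let ?N = "direct_sum (quotient_module (A_ideal i)) (quotient_module (A_ideal j))"
  let ?cos = "\<lambda>i a. A_ideal i +>\<^bsub>A_ring\<^esub> a"
  obtain \<alpha> \<beta> where coord: "\<And>x. x = \<alpha> x \<star> v + \<beta> x \<star> w" using span by metis
  define f where "f = (\<lambda>x. (?cos i (\<alpha> x), ?cos j (\<beta> x)))"
  have f: "f (a \<star> v + b \<star> w) = (?cos i a, ?cos j b)" for a b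
  proof -
    let ?x = "a \<star> v + b \<star> w"
    have "(\<alpha> ?x - a) \<star> v + (\<beta> ?x - b) \<star> w = (\<alpha> ?x \<star> v + \<beta> ?x \<star> w) - ?x"
      by (simp add: scale_left_diff_distrib)
    also have "\<dots> = 0" using coord[of ?x] by simp
    finally show ?thesis unfolding f_def rel by (simp add: A_ideal_coset(4))
  qed
  have "inj f"
  proof (rule injI)
    fix x y assume "f x = f y"
    then have "i dvd \<alpha> x - \<alpha> y \<and> j dvd \<beta> x - \<beta> y" by (simp add: f_def A_ideal_coset(4))
    then have "(\<alpha> x - \<alpha> y) \<star> v + (\<beta> x - \<beta> y) \<star> w = 0" unfolding rel .
    moreover have "x - y = (\<alpha> x \<star> v + \<beta> x \<star> w) - (\<alpha> y \<star> v + \<beta> y \<star> w)"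
      by (simp only: coord[symmetric])
    ultimately show "x = y" by (simp add: scale_left_diff_distrib algebra_simps)
  qed
  moreover have "range f = carrier ?N"
  proof
    show "range f \<subseteq> carrier ?N" by (auto simp: f_def direct_sum_def A_ideal_coset(1))
    show "carrier ?N \<subseteq> range f"
    proof
      fix z assume "z \<in> carrier ?N"
      then obtain a b where "z = (?cos i a, ?cos j b)" by (auto simp: direct_sum_def A_ideal_coset(1))
      then show "z \<in> range f" using f[of a b] by (metis rangeI)
    qed
  qed
  ultimately have "bij_betw f (carrier M) (carrier ?N)" by (simp add: bij_betw_def M(1))
  moreover have "f \<in> LinearCombinations.module_hom A_ring M ?N"
    unfolding LinearCombinations.module_hom_def
  proof (intro CollectI conjI allI impI)
    show "f \<in> carrier M \<rightarrow> carrier ?N" using \<open>range f = carrier ?N\<close> by auto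
    show "f (x \<oplus>\<^bsub>M\<^esub> y) = f x \<oplus>\<^bsub>?N\<^esub> f y" for x y
    proof -
      have "x + y = (\<alpha> x \<star> v + \<beta> x \<star> w) + (\<alpha> y \<star> v + \<beta> y \<star> w)"
        unfolding coord[symmetric] ..
      also have "\<dots> = (\<alpha> x + \<alpha> y) \<star> v + (\<beta> x + \<beta> y) \<star> w"
        by (simp add: scale_left_distrib)
      finally have "f (x + y) = (?cos i (\<alpha> x + \<alpha> y), ?cos j (\<beta> x + \<beta> y))" using f by metis
      then show ?thesis by (simp add: M(2) direct_sum_def f_def A_ideal_coset(2))
    qed
    show "f (r \<odot>\<^bsub>M\<^esub> x) = r \<odot>\<^bsub>?N\<^esub> f x" for r x
    proof -
      have "r \<star> x = r \<star> (\<alpha> x \<star> v + \<beta> x \<star> w)"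
        unfolding coord[symmetric] ..
      also have "\<dots> = (r * \<alpha> x) \<star> v + (r * \<beta> x) \<star> w"
        by (simp add: scale_right_distrib)
      finally have "f (r \<star> x) = (?cos i (r * \<alpha> x), ?cos j (r * \<beta> x))" using f by metis
      then show ?thesis by (simp add: M(3) direct_sum_def f_def A_ideal_coset(3))
    qed
  qed
  ultimately show ?thesis unfolding module_isomorphic_def by blast
qed

section \<open>The isogeny class contains the required module\<close>

lemma monic_irreducible_linear: "monic_irreducible [:a, 1 :: 'k::field:]"
proof -
  have "irreducible [:a, 1 :: 'k:]"
  proof (rule irreducibleI)
    fix x y assume eq: "[:a, 1 :: 'k:] = x * y"
    then have nz: "x \<noteq> 0" "y \<noteq> 0" by auto
    then have "degree x + degree y = 1" using arg_cong[OF eq, of degree] by (simp add: degree_mult_eq)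
    then have "degree x = 0 \<or> degree y = 0" by linarith
    then show "is_unit x \<or> is_unit y" using nz is_unit_iff_degree by blast
  qed auto
  then show ?thesis by (simp add: monic_irreducible_def)
qed

context drinfeld_module
begin

text \<open>
  Otherwise the middle term \<open>c F\<close> has larger degree in \<open>\<tau>\<close> than the two others.
\<close>

lemma trace_degree_bound:
  assumes eq: "\<And>x. F (F x) - c \<star> F x + D \<star> x = 0" and D: "degree D = n"
  shows "2 * degree c \<le> n"
proof (cases "c = 0")
  case False
  have "ore_mult q (\<Phi> c) (Polynomial.monom 1 n) = Polynomial.monom 1 (n + n) + \<Phi> D"
  proof (rule E_eqI)
    fix x
    have "c \<star> F x = F (F x) + D \<star> x" using eq[of x] by (simp add: algebra_simps eq_neg_iff_add_eq_0)
    then show "E (ore_mult q (\<Phi> c) (Polynomial.monom 1 n)) x = E (Polynomial.monom 1 (n + n) + \<Phi> D) x"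
      by (simp add: E_mult E_add E_monom power_add power_mult)
  qed
  moreover have "degree (ore_mult q (\<Phi> c) (Polynomial.monom 1 n)) = 2 * degree c + n"
    using L.degree_ore_mult(1)[of "\<Phi> c" "Polynomial.monom 1 n"] degree_\<Phi>[OF False] by (simp add: degree_monom_eq)
  moreover have "degree (\<Phi> D) = n + n" using degree_\<Phi>[of D] D by (cases "D = 0") auto
  then have "degree (Polynomial.monom 1 (n + n) + \<Phi> D) \<le> n + n"
    by (intro degree_add_le) (auto simp: degree_monom_le)
  ultimately show ?thesis by simp
qed simp

lemma point_module_isomorphic:
  assumes v: "F v = v" "F w = w" and span: "\<And>x. F x = x \<Longrightarrow> \<exists>a b. x = a \<star> v + b \<star> w"
    and rel: "\<And>a b. a \<star> v + b \<star> w = 0 \<longleftrightarrow> i dvd a \<and> j dvd b"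
  shows "module_isomorphic A_ring (point_module \<Phi>)
    (direct_sum (quotient_module (A_ideal i)) (quotient_module (A_ideal j)))"
proof -
  obtain v0 w0 where v0: "v = to_ac v0" "w = to_ac w0" using v frobenius_fixed by blast
  let ?act = "\<lambda>a x. ore_eval q (\<Phi> a) x"
  have comb: "to_ac (?act a x + ?act b y) = a \<star> to_ac x + b \<star> to_ac y" for a b x y
    by (simp add: E_to_ac)
  show ?thesis
  proof (rule sum_of_cyclic_isomorphic)
    show "carrier (point_module \<Phi>) = UNIV" "x \<oplus>\<^bsub>point_module \<Phi>\<^esub> y = x + y"
      "a \<odot>\<^bsub>point_module \<Phi>\<^esub> x = ?act a x" for a x y
      by (simp_all add: point_module_def q_eq)
    show "Modules.module ?act"
      by unfold_locales
        (simp_all add: L.ore_eval_add_right \<Phi>_add L.ore_eval_add \<Phi>_mult L.ore_eval_mult \<Phi>_one)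
    show "\<exists>a b. x = ?act a v0 + ?act b w0" for x
    proof -
      have "F (to_ac x) = to_ac x" using frobenius_fixed by blast
      then obtain a b where "to_ac x = a \<star> to_ac v0 + b \<star> to_ac w0" using span v0 by blast
      then show ?thesis unfolding comb[symmetric] to_ac_eq_iff by blast
    qed
    show "?act a v0 + ?act b w0 = 0 \<longleftrightarrow> i dvd a \<and> j dvd b" for a b
      using rel[of a b] unfolding v0 comb[symmetric] to_ac_eq_0_iff .
  qed
qed

end

theorem theorem1p1:
  fixes \<iota> :: "'k::{field,finite} \<Rightarrow> 'l::{field,finite}"
    and \<gamma> :: "'k poly \<Rightarrow> 'l"
    and P c i1 i2 :: "'k poly"
    and \<mu> :: 'k
    and m n :: nat
  assumes \<iota>_hom: "\<iota> \<in> Ring.ring_hom ring_of_type_algebra ring_of_type_algebra"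
    and n_degree: "ring.dimension (ring_of_type_algebra :: 'l ring) n (range \<iota>) UNIV"
    and \<gamma>_hom: "\<gamma> \<in> Ring.ring_hom A_ring ring_of_type_algebra"
    and \<gamma>_algebra: "\<And>a. \<gamma> [:a:] = \<iota> a"
    and P_prime: "irreducible P" "lead_coeff P = 1"
    and P_char: "a_kernel A_ring ring_of_type_algebra \<gamma> = A_ideal P"
    and m_degree: "ring.dimension (ring_of_type_algebra :: 'l ring) m (range \<gamma>) UNIV"
    and \<mu>_nz: "\<mu> \<noteq> 0"
    and c_\<mu>: "\<exists>\<Phi>\<^sub>0 :: 'k poly \<Rightarrow> 'l poly. drinfeld_rank2 \<iota> \<gamma> \<Phi>\<^sub>0 \<and> ordinary \<Phi>\<^sub>0 P \<and>
               frobenius_charpoly n P \<Phi>\<^sub>0 [:Polynomial.smult \<mu> (P ^ m), - c, 1:]"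
    and i_monic: "lead_coeff i1 = 1" "lead_coeff i2 = 1"
    and I_prod: "A_ideal i1 \<cdot>\<^bsub>A_ring\<^esub> A_ideal i2 =
                   A_ideal (1 - c + Polynomial.smult \<mu> (P ^ m))"
    and i2_dvd: "i2 dvd i1" "i2 dvd (c - 2)"
  shows "\<exists>\<Phi> :: 'k poly \<Rightarrow> 'l poly.
           drinfeld_rank2 \<iota> \<gamma> \<Phi> \<and> ordinary \<Phi> P \<and>
           frobenius_charpoly n P \<Phi> [:Polynomial.smult \<mu> (P ^ m), - c, 1:] \<and>
           module_isomorphic A_ring (point_module \<Phi>)
             (direct_sum (quotient_module (A_ideal i1)) (quotient_module (A_ideal i2)))"
proof -
  let ?q = "CARD('k)"
  define D where "D = Polynomial.smult \<mu> (P ^ m)"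
  define N where "N = 1 - c + D"
  have P: "monic_irreducible P" using P_prime by (simp add: monic_irreducible_def)
  have \<iota>: "\<iota> (a + b) = \<iota> a + \<iota> b" "\<iota> (a * b) = \<iota> a * \<iota> b" "\<iota> 1 = 1" for a b
    using \<iota>_hom by (auto simp: Ring.ring_hom_def ring_of_type_algebra_def)
  have \<gamma>: "\<gamma> (f + g) = \<gamma> f + \<gamma> g" "\<gamma> (f * g) = \<gamma> f * \<gamma> g" "\<gamma> 1 = 1" for f g
    using \<gamma>_hom by (auto simp: Ring.ring_hom_def ring_of_type_algebra_def)
  have kernel: "\<gamma> f = 0 \<longleftrightarrow> P dvd f" for f
    using P_char unfolding a_kernel_def' A_ideal_multiples
    by (auto simp: ring_of_type_algebra_def set_eq_iff)
  have \<iota>0: "\<iota> 0 = 0" using \<iota>(1)[of 0 0] by (metis add_0 add_cancel_right_right)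
  have \<iota>_nat: "\<iota> (of_nat j) = of_nat j" for j by (induction j) (simp_all add: \<iota>0 \<iota>)
  have \<iota>_diff: "\<iota> (a - b) = \<iota> a - \<iota> b" for a b using \<iota>(1)[of "a - b" b] by simp
  have \<gamma>_diff: "\<gamma> (f - g) = \<gamma> f - \<gamma> g" for f g using \<gamma>(1)[of "f - g" g] by simp
  have inj: "inj \<iota>"
  proof (rule injI)
    fix a b assume "\<iota> a = \<iota> b"
    then have "\<gamma> [:a - b:] = 0" by (simp add: \<gamma>_algebra \<iota>_diff)
    then have "P dvd [:a - b:]" using kernel by blast
    then show "a = b"
      using monic_irreducible_degree[OF P] dvd_imp_degree_le[of P "[:a - b:]"] by (cases "a = b") auto
  qed
  have card_n: "CARD('l) = ?q ^ n"
  proof -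
    have "CARD('l) = card (range \<iota>) ^ n"
    proof (rule card_of_dimension[OF n_degree])
      show "1 \<in> range \<iota>" using \<iota>(3) by (metis rangeI)
    qed (auto simp flip: \<iota>_diff \<iota>(2))
    then show ?thesis using card_image[OF inj] by simp
  qed
  have card_\<gamma>: "card (range \<gamma>) = ?q ^ degree P"
  proof -
    let ?R = "{a. a mod P = a}"
    have "\<gamma> a = \<gamma> (a mod P)" for a
      using kernel[of "a - a mod P"] by (simp add: \<gamma>_diff dvd_minus_mod)
    then have "range \<gamma> = \<gamma> ` ?R" by (auto intro!: image_eqI[of _ _ "_ mod P"])
    moreover have "inj_on \<gamma> ?R"
    proof (rule inj_onI)
      fix a b assume "a \<in> ?R" "b \<in> ?R" "\<gamma> a = \<gamma> b"
      moreover from this have "P dvd a - b" using kernel[of "a - b"] \<gamma>_diff[of a b] by simp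
      ultimately show "a = b" using mod_eq_dvd_iff[of a P b] by simp
    qed
    ultimately show ?thesis using card_residues[OF monic_irreducible_nz[OF P]] by (simp add: card_image)
  qed
  have "CARD('l) = (?q ^ degree P) ^ m"
    unfolding card_\<gamma>[symmetric]
  proof (rule card_of_dimension[OF m_degree])
    show "1 \<in> range \<gamma>" using \<gamma>(3) by (metis rangeI)
  qed (auto simp flip: \<gamma>_diff \<gamma>(2))
  then have "?q ^ n = ?q ^ (degree P * m)" using card_n by (simp add: power_mult)
  moreover have q2: "?q \<ge> 2" by (rule finite_field_frobenius(3)[of \<iota>]) (use \<iota>0 \<iota>_nat in auto)
  ultimately have n: "n = degree P * m" by (simp add: power_inject_exp)
  interpret drinfeld_setting ?q "TYPE('l alg_closure)" n \<iota> \<gamma> P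
  proof
    note fr = finite_field_frobenius[of "\<lambda>a. to_ac (\<iota> a)", simplified \<iota>_nat \<iota>0 to_ac_of_nat to_ac_0]
    show "of_nat ?q = (0 :: 'l alg_closure)" using fr(1) by simp
    show "(x + y) ^ ?q = x ^ ?q + y ^ ?q" for x y :: "'l alg_closure" using fr(2) by simp
  qed (use q2 card_n \<iota> \<gamma> \<gamma>_algebra P kernel in auto)
  obtain \<Phi>0 :: "'k poly \<Rightarrow> 'l poly" where \<Phi>0: "drinfeld_rank2 \<iota> \<gamma> \<Phi>0" "ordinary \<Phi>0 P"
    "frobenius_charpoly n P \<Phi>0 [:D, - c, 1:]"
    using c_\<mu> unfolding D_def by blast
  interpret Phi0: drinfeld_module ?q "TYPE('l alg_closure)" n \<iota> \<gamma> P \<Phi>0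
    by unfold_locales (rule \<Phi>0(1))
  obtain Q :: "'k poly" where Q: "monic_irreducible Q" "Q \<noteq> P"
    using monic_irreducible_linear[of 0] monic_irreducible_linear[of 1] by (metis pCons_eq_iff zero_neq_one)
  then have "tate_charpoly n \<Phi>0 Q [:D, - c, 1:]"
    using \<Phi>0(3) unfolding frobenius_charpoly_def monic_irreducible_def by blast
  note eq0 = Phi0.frobenius_equation_of_tate[OF Q(1) this]
  have deg_D: "degree D = n"
    using \<mu>_nz P monic_irreducible_nz[OF P] by (simp add: D_def n degree_power_eq mult.commute)
  have "2 * degree c \<le> n" by (rule Phi0.trace_degree_bound[OF eq0 deg_D])
  then have "degree (1 - c) < n" using n_pos by (intro degree_diff_less) auto
  then have deg_N: "degree N = n" unfolding N_def using deg_D by (subst degree_add_eq_right) auto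
  then have N0: "N \<noteq> 0" using n_pos by auto
  have m_pos: "m > 0" using n n_pos by (cases m) auto
  note prod = A_ideal_product_dvd[OF I_prod[folded D_def, folded N_def]]
  obtain u where u: "N = i1 * i2 * u" using prod(2) by (auto simp: dvd_def)
  obtain r where r: "i1 = i2 * r" using i2_dvd(1) by (auto simp: dvd_def)
  obtain t where t: "c - 2 = t * i2" using i2_dvd(2) by (auto simp: dvd_def mult.commute)
  have unit_u: "is_unit u"
  proof -
    have "i1 * i2 * u dvd i1 * i2 * 1" using prod(1) u by simp
    moreover have "i1 * i2 \<noteq> 0" using u N0 by auto
    ultimately show ?thesis by (metis dvd_mult_cancel_left)
  qed
  \<comment> \<open>\<open>u\<close> is the unit between \<open>i1 i2\<close> and \<open>N\<close>, so \<open>s i2 = u i1\<close>.\<close>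
  define s where "s = r * u"
  have s: "1 - c + D = s * i2 * i2" using u unfolding N_def s_def r by (simp add: algebra_simps)
  have s0: "s \<noteq> 0" "i2 \<noteq> 0" using N0 s unfolding N_def by auto
  have deg_s: "n = degree s + 2 * degree i2"
    using deg_N s s0 unfolding N_def by (simp add: degree_mult_eq)
  have i2P: "\<not> P dvd i2"
  proof
    assume "P dvd i2"
    then have d: "P dvd c - 2" "P dvd 1 - c + D" using t s by (metis dvd_mult, metis dvd_mult)
    have "P dvd D" unfolding D_def using m_pos by (intro dvd_smult) (simp add: dvd_power)
    with d(2) have "P dvd (1 - c + D) - D" by (rule dvd_diff)
    then have "P dvd (1 - c + D) - D + (c - 2)" using d(1) by (rule dvd_add)
    moreover have "(1 - c + D) - D + (c - 2) = - 1" by simp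
    ultimately show False using P_prime(1) by (metis dvd_minus_iff irreducible_def)
  qed
  obtain \<Phi>1 where \<Phi>1: "drinfeld_rank2 \<iota> \<gamma> \<Phi>1" "ordinary \<Phi>1 P"
    "\<And>x. F (F x) - E (\<Phi>1 c) (F x) + E (\<Phi>1 D) x = 0" "\<And>x. E (\<Phi>1 i2) x = 0 \<Longrightarrow> F x = x"
    using Phi0.rational_torsion_isogeny[OF \<Phi>0(2) eq0 i2P t s] by blast
  interpret Phi1: drinfeld_module ?q "TYPE('l alg_closure)" n \<iota> \<gamma> P \<Phi>1
    by unfold_locales (rule \<Phi>1(1))
  obtain \<Phi> y where \<Phi>: "drinfeld_rank2 \<iota> \<gamma> \<Phi>" "ordinary \<Phi> P"
    "\<And>x. F (F x) - E (\<Phi> c) (F x) + E (\<Phi> D) x = 0" "\<And>x. E y (E (\<Phi> i2) x) = F x - x"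
    "\<And>Q. monic_irreducible Q \<Longrightarrow> Q \<noteq> P \<Longrightarrow> \<exists>x. E (\<Phi> Q) x = 0 \<and> E y x \<noteq> 0"
    using Phi1.cyclic_frobenius_isogeny[OF \<Phi>1(2,3) i2P \<Phi>1(4)] by blast
  interpret Phi: drinfeld_module ?q "TYPE('l alg_closure)" n \<iota> \<gamma> P \<Phi>
    by unfold_locales (rule \<Phi>(1))
  obtain v w where vw: "F v = v" "F w = w" "\<And>x. F x = x \<Longrightarrow> \<exists>a b. x = E (\<Phi> a) v + E (\<Phi> b) w"
    "\<And>a b. E (\<Phi> a) v + E (\<Phi> b) w = 0 \<longleftrightarrow> s * i2 dvd a \<and> i2 dvd b"
    using Phi.rational_points_structure[OF i2P \<Phi>(4,5,3) t s s0(1) deg_s] by blast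
  have "s * i2 = i1 * u" by (simp add: s_def r algebra_simps)
  then have "s * i2 dvd a \<longleftrightarrow> i1 dvd a" for a using unit_u by (simp add: mult_unit_dvd_iff)
  then have "module_isomorphic A_ring (point_module \<Phi>)
      (direct_sum (quotient_module (A_ideal i1)) (quotient_module (A_ideal i2)))"
    using vw by (intro Phi.point_module_isomorphic[of v w]) auto
  moreover have "frobenius_charpoly n P \<Phi> [:D, - c, 1:]"
    unfolding frobenius_charpoly_def
    using Phi.tate_charpoly_of_frobenius_equation[OF \<Phi>(2,3)] by (auto simp: monic_irreducible_def)
  ultimately show ?thesis using \<Phi>(1,2) unfolding D_def by blast
qed

end
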